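(* Let $1<q<\infty$. Let $1<p<t<r<\infty$ or $1<p\le t<r=\infty$. Let $T$ be a Calderón-Zygmund operator associated with a kernel $K\in\mathrm{SK}(\delta,A)$. Let $b\in L^1_{\mathrm{loc}}(\mathbb R^n)$ and let $T$ be homogeneous. Then $b\in\mathrm{BMO}(\mathbb R^n)$ and $$\|b\|_{\mathrm{BMO}(\mathbb R^n)}\lesssim\|[b,T]\|_{M_{p,q}^{t,r}(\mathbb R^n)\to M_{p,q}^{t,r}(\mathbb R^n)}.$$
   Context: $\mathrm{BMO}(\mathbb R^n)$: locally integrable $f$ with $\|f\|_{\mathrm{BMO}(\mathbb R^n)}=\sup_Q\frac1{|Q|}\int_Q|f-f_Q|<\infty$, $f_Q=\frac1{|Q|}\int_Qf$, supremum over all cubes $Q$. $A\lesssim B$ means $A\le cB$ for a constant $c>0$. Calderón-Zygmund operator: for $\delta,A>0$, $\mathrm{SK}(\delta,A)$ is the class of functions $K(x,y)$ on $\{(x,y)\in\mathbb R^n\times\mathbb R^n:x\ne y\}$ with $|K(x,y)|\le A|x-y|^{-n}$; $|K(x,y)-K(x',y)|\le\frac{A|x-x'|^\delta}{(|x-y|+|x'-y|)^{n+\delta}}$ whenever $|x-x'|\le\frac12\max(|x-y|,|x'-y|)$; and $|K(x,y)-K(x,y')|\le\frac{A|y-y'|^\delta}{(|x-y|+|x-y'|)^{n+\delta}}$ whenever $|y-y'|\le\frac12\max(|x-y|,|x-y'|)$. A continuous linear operator $T:\mathscr S(\mathbb R^n)\to\mathscr S'(\mathbb R^n)$ is a Calderón-Zygmund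 operator associated with $K$ if $Tf(x)=\int K(x,y)f(y)\,dy$ for $f\in C_c^\infty(\mathbb R^n)$ and $x\notin\operatorname{supp}f$, and $T$ extends boundedly to $L^2(\mathbb R^n)$. The transpose $T^*$ is given by $\int Tf\,g=\int f\,T^*g$ for $f,g\in C_c^\infty(\mathbb R^n)$. Homogeneous: $T$ is homogeneous if for any cube $Q$ with center $c_Q$ and side length $\ell(Q)$, $|T(\chi_\Omega)(x)|\ge\frac{|\Omega|}{M^n|Q|}$ for any Borel set $\Omega\subset Q$ and all $x$ with $|x-c_Q|=M\ell(Q)/2$, $M>10$. Commutator: $[b,T]f=b\,T(f)-T(bf)$, initially on bounded compactly supported functions $L_c^\infty(\mathbb R^n)$; on $M_{p,q}^{t,r}(\mathbb R^n)$ it is understood by duality with the block space $\mathcal H_{p',q'}^{t',r'}(\mathbb R^n)$ (whose dual is $M_{p,q}^{t,r}(\mathbb R^n)$ under the pairing $\int fg\,dx$, and in which $L_c^\infty(\mathbb R^n)$ is dense): $[b,T]f$ is the element $h\in M_{p,q}^{t,r}(\mathbb R^n)$ with $\int hg\,dx=-\int f\,[b,T^*]g\,dx$ for all $g\in\mathcal H_{p',q'}^{t',r'}(\mathbb R^n)$. Block space (primes denote conjugate exponents): a function $a$ is a $(p',q',t')$-block supported on a cube $Q$ if $a$ is supported on $Q$ and $\|a\|_{L^{p',q'}}\le|Q|^{1/p'-1/t'}$. $\mathcal H_{p',q'}^{t',r'}(\mathbb R^n)$ is the set of measurable $f=\sum_{(j,k)\in\mathbb Z^{1+n}}\lambda_{j,k}a_{j,k}$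 (convergence in $L^1_{\mathrm{loc}}$) with $\lambda\in\ell^{r'}(\mathbb Z^{1+n})$ and each $a_{j,k}$ a $(p',q',t')$-block supported on $Q_{j,k}$; its norm is $\inf\|\lambda\|_{\ell^{r'}}$ over such representations. Lorentz norm: with $d_f(s)=|\{x:|f(x)|>s\}|$ and $f^*(u)=\inf\{s>0:d_f(s)\le u\}$, $\|f\|_{L^{p,q}}=\left(\int_0^\infty(u^{1/p}f^*(u))^q\frac{du}{u}\right)^{1/q}$ for $q<\infty$; $\|f\|_{L^{p,q}(Q)}=\|f\chi_Q\|_{L^{p,q}}$. Dyadic cubes: $Q_{j,m}=\prod_{i=1}^n[2^{-j}m_i,2^{-j}(m_i+1))$, $j\in\mathbb Z$, $m\in\mathbb Z^n$; $\mathcal D$ is the set of all of them. $M_{p,q}^{t,r}(\mathbb R^n)$ is the set of measurable $f$ with $\|f\|_{M_{p,q}^{t,r}(\mathbb R^n)}=\left(\sum_{Q\in\mathcal D}|Q|^{r/t-r/p}\|f\|_{L^{p,q}(Q)}^r\right)^{1/r}<\infty$ (supremum over $Q\in\mathcal D$ of $|Q|^{1/t-1/p}\|f\|_{L^{p,q}(Q)}$ if $r=\infty$).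
   Formalization: The formal theorem additionally assumes that the operator norm of [b,T] on M_{p,q}^{t,r} is finite; without this, b in BMO fails (n=1, T a large multiple of the Hilbert transform, b(x)=x). *)

theory Defs
  imports "HOL-Analysis.Analysis"
begin

text \<open>All functions on \<open>\<real>\<^sup>n\<close> are complex valued, \<open>n\<close> is \<open>CARD('n)\<close>, and elements of the function
  spaces are represented by Lebesgue measurable functions, with identities understood almost
  everywhere. Norms take values in \<open>ennreal\<close>.\<close>

type_synonym 'n cfun = "real ^ 'n \<Rightarrow> complex"


section \<open>Exponents\<close>

definition epowr :: "ennreal \<Rightarrow> real \<Rightarrow> ennreal" where
  "epowr x a = (if x = \<infinity> then \<infinity> else ennreal (enn2real x powr a))" \<comment> \<open>meant for \<open>a > 0\<close>\<close>

definition conj_exp :: "real \<Rightarrow> real" where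
  "conj_exp p = p / (p - 1)"

definition econj_exp :: "ereal \<Rightarrow> real" where
  "econj_exp r = (if r = \<infinity> then 1 else conj_exp (real_of_ereal r))"


section \<open>Cubes and BMO\<close>

definition cube :: "real ^ 'n \<Rightarrow> real \<Rightarrow> (real ^ 'n) set" where
  "cube c l = {x. \<forall>i. \<bar>x $ i - c $ i\<bar> \<le> l / 2}"

definition dyadic_cube :: "int \<Rightarrow> int ^ 'n \<Rightarrow> (real ^ 'n) set" where
  "dyadic_cube j m =
     {x. \<forall>i. 2 powi (- j) * of_int (m $ i) \<le> x $ i \<and> x $ i < 2 powi (- j) * (of_int (m $ i) + 1)}"

definition dyadic_cubes :: "(real ^ 'n) set set" where
  "dyadic_cubes = {dyadic_cube j m | j m. True}"

definition L1_loc :: "('n::finite) cfun set" where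
  "L1_loc = {f \<in> borel_measurable lebesgue. \<forall>S. compact S \<longrightarrow> set_integrable lebesgue S f}"

definition mean :: "('n::finite) cfun \<Rightarrow> (real ^ 'n) set \<Rightarrow> complex" where
  "mean f Q = (LINT x:Q|lebesgue. f x) / of_real (measure lebesgue Q)"

definition BMO_norm :: "('n::finite) cfun \<Rightarrow> ennreal" where
  "BMO_norm f = (SUP (c, l) \<in> UNIV \<times> {0<..}.
     (\<integral>\<^sup>+x\<in>cube c l. ennreal (cmod (f x - mean f (cube c l))) \<partial>lebesgue)
       / emeasure lebesgue (cube c l))"

definition BMO :: "('n::finite) cfun set" where
  "BMO = {f \<in> L1_loc. BMO_norm f < \<infinity>}"


section \<open>Lorentz norms, Bourgain--Morrey--Lorentz spaces and block spaces\<close>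

definition distr_fun :: "('n::finite) cfun \<Rightarrow> real \<Rightarrow> ennreal" where
  "distr_fun f s = emeasure lebesgue {x. s < cmod (f x)}"

definition rearr :: "('n::finite) cfun \<Rightarrow> real \<Rightarrow> ennreal" where
  "rearr f u = Inf {ennreal s | s. 0 < s \<and> distr_fun f s \<le> ennreal u}"

definition lorentz_norm :: "real \<Rightarrow> real \<Rightarrow> ('n::finite) cfun \<Rightarrow> ennreal" where
  "lorentz_norm p q f =
     epowr (\<integral>\<^sup>+u\<in>{0<..}. epowr (ennreal (u powr (1 / p)) * rearr f u) q / ennreal u \<partial>lborel) (1 / q)"

definition lorentz_norm_on :: "real \<Rightarrow> real \<Rightarrow> (real ^ 'n) set \<Rightarrow> ('n::finite) cfun \<Rightarrow> ennreal" where
  "lorentz_norm_on p q Q f = lorentz_norm p q (\<lambda>x. f x * indicator Q x)"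

definition M_norm :: "real \<Rightarrow> real \<Rightarrow> real \<Rightarrow> ereal \<Rightarrow> ('n::finite) cfun \<Rightarrow> ennreal" where
  "M_norm p q t r f =
     (if r = \<infinity>
      then (SUP Q \<in> dyadic_cubes.
              ennreal (measure lebesgue Q powr (1 / t - 1 / p)) * lorentz_norm_on p q Q f)
      else (let s = real_of_ereal r in
              epowr (\<Sum>\<^sub>\<infinity>Q \<in> dyadic_cubes.
                ennreal (measure lebesgue Q powr (s / t - s / p)) * epowr (lorentz_norm_on p q Q f) s)
              (1 / s)))"

definition M_space :: "real \<Rightarrow> real \<Rightarrow> real \<Rightarrow> ereal \<Rightarrow> ('n::finite) cfun set" where
  "M_space p q t r = {f \<in> borel_measurable lebesgue. M_norm p q t r f < \<infinity>}"

text \<open>The block notions below are used with the conjugates of the exponents of \<open>M_space\<close>; these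
  are all finite, also when \<open>r = \<infinity>\<close>.\<close>

definition block :: "real \<Rightarrow> real \<Rightarrow> real \<Rightarrow> (real ^ 'n) set \<Rightarrow> ('n::finite) cfun \<Rightarrow> bool" where
  "block p q t Q a \<longleftrightarrow>
     a \<in> borel_measurable lebesgue \<and> (\<forall>x. x \<notin> Q \<longrightarrow> a x = 0) \<and>
     lorentz_norm p q a \<le> ennreal (measure lebesgue Q powr (1 / p - 1 / t))"

definition lseq_norm :: "real \<Rightarrow> ('i \<Rightarrow> complex) \<Rightarrow> ennreal" where
  "lseq_norm r lam = epowr (\<Sum>\<^sub>\<infinity>i. ennreal (cmod (lam i) powr r)) (1 / r)"

definition block_repr ::
  "real \<Rightarrow> real \<Rightarrow> real \<Rightarrow> real \<Rightarrow> (int \<times> (int ^ 'n) \<Rightarrow> complex) \<Rightarrow> (int \<times> (int ^ 'n) \<Rightarrow> 'n cfun)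
     \<Rightarrow> ('n::finite) cfun \<Rightarrow> bool" where
  "block_repr p q t r lam a f \<longleftrightarrow>
     lseq_norm r lam < \<infinity> \<and>
     (\<forall>j k. block p q t (dyadic_cube j k) (a (j, k))) \<and>
     (\<forall>S. compact S \<longrightarrow>
        ((\<lambda>F. \<integral>\<^sup>+x\<in>S. ennreal (cmod (f x - (\<Sum>i\<in>F. lam i * a i x))) \<partial>lebesgue)
           \<longlongrightarrow> 0) (finite_subsets_at_top UNIV))"

definition H_norm :: "real \<Rightarrow> real \<Rightarrow> real \<Rightarrow> real \<Rightarrow> ('n::finite) cfun \<Rightarrow> ennreal" where
  "H_norm p q t r f = Inf {lseq_norm r lam | lam. \<exists>a. block_repr p q t r lam a f}"

definition H_space :: "real \<Rightarrow> real \<Rightarrow> real \<Rightarrow> real \<Rightarrow> ('n::finite) cfun set" where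
  "H_space p q t r = {f \<in> borel_measurable lebesgue. \<exists>lam a. block_repr p q t r lam a f}"


section \<open>Test functions and tempered distributions\<close>

definition pdiff :: "'n \<Rightarrow> ('n::finite) cfun \<Rightarrow> 'n cfun" where
  "pdiff i f x = vector_derivative (\<lambda>s. f (x + s *\<^sub>R axis i 1)) (at 0)"

text \<open>Iterated partial derivatives are indexed by lists of directions rather than by
  multi-indices; for smooth functions the order of the list is immaterial.\<close>

definition pdiffs :: "'n list \<Rightarrow> ('n::finite) cfun \<Rightarrow> 'n cfun" where
  "pdiffs is f = foldr pdiff is f"

definition smooth :: "('n::finite) cfun \<Rightarrow> bool" where
  "smooth f \<longleftrightarrow> (\<forall>is x. pdiffs is f differentiable (at x))"

definition supp :: "('n::finite) cfun \<Rightarrow> (real ^ 'n) set" where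
  "supp f = closure {x. f x \<noteq> 0}"

definition Cc_infty :: "('n::finite) cfun set" where
  "Cc_infty = {f. smooth f \<and> compact (supp f)}"

definition schwartz :: "('n::finite) cfun set" where
  "schwartz =
     {f. smooth f \<and> (\<forall>N is. bounded (range (\<lambda>x. (1 + norm x) ^ N *\<^sub>R pdiffs is f x)))}"

definition schwartz_tendsto :: "(nat \<Rightarrow> 'n cfun) \<Rightarrow> ('n::finite) cfun \<Rightarrow> bool" where
  "schwartz_tendsto F f \<longleftrightarrow>
     (\<forall>N is. uniform_limit UNIV (\<lambda>k x. (1 + norm x) ^ N *\<^sub>R pdiffs is (F k) x)
        (\<lambda>x. (1 + norm x) ^ N *\<^sub>R pdiffs is f x) sequentially)"

text \<open>The Schwartz space is metrizable, so continuity of maps on it is sequential continuity.\<close>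

definition tempered_distribution :: "(('n::finite) cfun \<Rightarrow> complex) \<Rightarrow> bool" where
  "tempered_distribution u \<longleftrightarrow>
     (\<forall>f\<in>schwartz. \<forall>g\<in>schwartz. u (\<lambda>x. f x + g x) = u f + u g) \<and>
     (\<forall>c. \<forall>f\<in>schwartz. u (\<lambda>x. c * f x) = c * u f) \<and>
     (\<forall>F. \<forall>f\<in>schwartz. (\<forall>k. F k \<in> schwartz) \<and> schwartz_tendsto F f \<longrightarrow> (\<lambda>k. u (F k)) \<longlonglongrightarrow> u f)"

text \<open>An operator from Schwartz functions to tempered distributions is a map \<open>T\<close> such that
  \<open>T f g\<close> is the value of the distribution \<open>T f\<close> on the Schwartz function \<open>g\<close>.
  Values at functions outside the Schwartz space are irrelevant.
  The space of distributions carries the weak-* topology.\<close>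

type_synonym 'n dist_op = "'n cfun \<Rightarrow> 'n cfun \<Rightarrow> complex"

definition continuous_linear_op :: "('n::finite) dist_op \<Rightarrow> bool" where
  "continuous_linear_op T \<longleftrightarrow>
     (\<forall>f\<in>schwartz. tempered_distribution (T f)) \<and>
     (\<forall>f\<in>schwartz. \<forall>g\<in>schwartz. \<forall>h\<in>schwartz. T (\<lambda>x. f x + g x) h = T f h + T g h) \<and>
     (\<forall>c. \<forall>f\<in>schwartz. \<forall>h\<in>schwartz. T (\<lambda>x. c * f x) h = c * T f h) \<and>
     (\<forall>F. \<forall>f\<in>schwartz. \<forall>h\<in>schwartz. (\<forall>k. F k \<in> schwartz) \<and> schwartz_tendsto F f \<longrightarrow>
        (\<lambda>k. T (F k) h) \<longlonglongrightarrow> T f h)"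

definition transpose_op :: "('n::finite) dist_op \<Rightarrow> 'n dist_op" where
  "transpose_op T f g = T g f"


section \<open>Calderon--Zygmund operators\<close>

definition SK :: "real \<Rightarrow> real \<Rightarrow> (real ^ 'n \<Rightarrow> real ^ 'n \<Rightarrow> complex) set" where
  "SK \<delta> A = {K.
     (\<forall>x y. x \<noteq> y \<longrightarrow> cmod (K x y) \<le> A / norm (x - y) ^ CARD('n)) \<and>
     (\<forall>x x' y. x \<noteq> y \<and> x' \<noteq> y \<and> norm (x - x') \<le> max (norm (x - y)) (norm (x' - y)) / 2 \<longrightarrow>
        cmod (K x y - K x' y)
          \<le> A * norm (x - x') powr \<delta> / (norm (x - y) + norm (x' - y)) powr (real CARD('n) + \<delta>)) \<and>
     (\<forall>x y y'. x \<noteq> y \<and> x \<noteq> y' \<and> norm (y - y') \<le> max (norm (x - y)) (norm (x - y')) / 2 \<longrightarrow>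
        cmod (K x y - K x y')
          \<le> A * norm (y - y') powr \<delta> / (norm (x - y) + norm (x - y')) powr (real CARD('n) + \<delta>))}"

definition L1 :: "('n::finite) cfun set" where
  "L1 = {f. integrable lebesgue f}"

definition L2 :: "('n::finite) cfun set" where
  "L2 = {f \<in> borel_measurable lebesgue. integrable lebesgue (\<lambda>x. (cmod (f x))\<^sup>2)}"

definition L1_norm :: "('n::finite) cfun \<Rightarrow> real" where
  "L1_norm f = (LINT x|lebesgue. cmod (f x))"

definition L2_norm :: "('n::finite) cfun \<Rightarrow> real" where
  "L2_norm f = sqrt (LINT x|lebesgue. (cmod (f x))\<^sup>2)"

text \<open>\<open>U\<close> is the bounded extension of \<open>T\<close> to the space of square integrable functions;
  up to null sets there is at most one.\<close>

definition L2_extension :: "('n::finite) dist_op \<Rightarrow> ('n cfun \<Rightarrow> 'n cfun) \<Rightarrow> bool" where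
  "L2_extension T U \<longleftrightarrow>
     (\<forall>f\<in>L2. U f \<in> L2) \<and>
     (\<forall>f\<in>L2. \<forall>g\<in>L2. AE x in lebesgue. U (\<lambda>x. f x + g x) x = U f x + U g x) \<and>
     (\<forall>c. \<forall>f\<in>L2. AE x in lebesgue. U (\<lambda>x. c * f x) x = c * U f x) \<and>
     (\<exists>C. \<forall>f\<in>L2. L2_norm (U f) \<le> C * L2_norm f) \<and>
     (\<forall>f\<in>schwartz. \<forall>g\<in>schwartz. T f g = (LINT x|lebesgue. U f x * g x))"

definition cz_operator ::
  "(real ^ 'n \<Rightarrow> real ^ 'n \<Rightarrow> complex) \<Rightarrow> ('n::finite) dist_op \<Rightarrow> bool" where
  "cz_operator K T \<longleftrightarrow>
     continuous_linear_op T \<and>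
     (\<exists>U. L2_extension T U \<and>
       (\<forall>f\<in>Cc_infty. AE x in lebesgue. x \<notin> supp f \<longrightarrow> U f x = (LINT y|lebesgue. K x y * f y)))"

text \<open>Since \<open>T(\<chi>\<^sub>\<Omega>)\<close> is an element of the space of square integrable functions, its values are
  only constrained for almost every \<open>x\<close>. Here \<open>M\<close> ranges over all reals above \<open>10\<close>.\<close>

definition homogeneous :: "('n::finite) dist_op \<Rightarrow> bool" where
  "homogeneous T \<longleftrightarrow>
     (\<exists>U. L2_extension T U \<and>
       (\<forall>c l \<Omega>. 0 < l \<and> \<Omega> \<in> sets borel \<and> \<Omega> \<subseteq> cube c l \<longrightarrow>
         (AE x in lebesgue. \<forall>M>10. norm (x - c) = M * l / 2 \<longrightarrow>
            cmod (U (indicator \<Omega>) x)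
              \<ge> measure lebesgue \<Omega> / (M ^ CARD('n) * measure lebesgue (cube c l)))))"


section \<open>Commutators\<close>

definition Lc_infty :: "('n::finite) cfun set" where
  "Lc_infty = {f \<in> borel_measurable lebesgue.
     (\<exists>B. AE x in lebesgue. cmod (f x) \<le> B) \<and> (\<exists>R. AE x in lebesgue. R < norm x \<longrightarrow> f x = 0)}"

text \<open>For \<open>b\<close> locally integrable and \<open>f\<close> bounded with compact support, \<open>b f\<close> is merely integrable,
  and \<open>T (b f)\<close> refers to the continuous extension of \<open>T\<close> from integrable to weakly integrable
  functions given by the weak type \<open>(1,1)\<close> estimate. The following says that \<open>g\<close> is the value
  at \<open>f\<close> of this extension, where \<open>U\<close> is the operator on square integrable functions.\<close>

definition L1_value :: "(('n::finite) cfun \<Rightarrow> 'n cfun) \<Rightarrow> 'n cfun \<Rightarrow> 'n cfun \<Rightarrow> bool" where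
  "L1_value U f g \<longleftrightarrow>
     f \<in> L1 \<and> g \<in> borel_measurable lebesgue \<and>
     (\<forall>u. (\<forall>k. u k \<in> L1 \<inter> L2) \<and> (\<lambda>k::nat. L1_norm (\<lambda>x. u k x - f x)) \<longlonglongrightarrow> 0 \<longrightarrow>
        (\<forall>\<epsilon>>0. (\<lambda>k. emeasure lebesgue {x. \<epsilon> < cmod (U (u k) x - g x)}) \<longlonglongrightarrow> 0))"

text \<open>\<open>h = [b,T] f\<close> for \<open>f\<close> bounded with compact support.\<close>

definition comm_Lc :: "('n::finite) cfun \<Rightarrow> 'n dist_op \<Rightarrow> 'n cfun \<Rightarrow> 'n cfun \<Rightarrow> bool" where
  "comm_Lc b T f h \<longleftrightarrow>
     f \<in> Lc_infty \<and> h \<in> borel_measurable lebesgue \<and>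
     (\<exists>U g. L2_extension T U \<and> L1_value U (\<lambda>x. b x * f x) g \<and>
        (AE x in lebesgue. h x = b x * U f x - g x))"

text \<open>\<open>h = [b,T] g\<close> for \<open>g\<close> in the block space: the extension of the previous operator by
  continuity, bounded functions with compact support being dense.\<close>

definition comm_H ::
  "real \<Rightarrow> real \<Rightarrow> real \<Rightarrow> real \<Rightarrow> ('n::finite) cfun \<Rightarrow> 'n dist_op \<Rightarrow> 'n cfun \<Rightarrow> 'n cfun \<Rightarrow> bool" where
  "comm_H p q t r b T g h \<longleftrightarrow>
     g \<in> H_space p q t r \<and> h \<in> H_space p q t r \<and>
     (\<forall>u::nat \<Rightarrow> 'n cfun.
        (\<forall>k. u k \<in> Lc_infty) \<and> (\<lambda>k. H_norm p q t r (\<lambda>x. u k x - g x)) \<longlonglongrightarrow> 0 \<longrightarrow>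
        (\<exists>v. (\<forall>k. comm_Lc b T (u k) (v k)) \<and> (\<lambda>k. H_norm p q t r (\<lambda>x. v k x - h x)) \<longlonglongrightarrow> 0))"

text \<open>\<open>h = [b,T] f\<close> for \<open>f\<close> in the Bourgain--Morrey--Lorentz space, by duality.\<close>

definition comm_M ::
  "real \<Rightarrow> real \<Rightarrow> real \<Rightarrow> ereal \<Rightarrow> ('n::finite) cfun \<Rightarrow> 'n dist_op \<Rightarrow> 'n cfun \<Rightarrow> 'n cfun \<Rightarrow> bool" where
  "comm_M p q t r b T f h \<longleftrightarrow>
     f \<in> M_space p q t r \<and> h \<in> M_space p q t r \<and>
     (\<forall>g \<in> H_space (conj_exp p) (conj_exp q) (conj_exp t) (econj_exp r).
        \<exists>G. comm_H (conj_exp p) (conj_exp q) (conj_exp t) (econj_exp r) b (transpose_op T) g G \<and>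
            (LINT x|lebesgue. h x * g x) = - (LINT x|lebesgue. f x * G x))"

text \<open>The operator norm of \<open>[b,T]\<close>; it is infinite if \<open>[b,T]\<close> is not defined on the whole space.\<close>

definition comm_op_norm ::
  "real \<Rightarrow> real \<Rightarrow> real \<Rightarrow> ereal \<Rightarrow> ('n::finite) cfun \<Rightarrow> 'n dist_op \<Rightarrow> ennreal" where
  "comm_op_norm p q t r b T =
     Inf {C. \<forall>f \<in> M_space p q t r. \<exists>h. comm_M p q t r b T f h \<and> M_norm p q t r h \<le> C * M_norm p q t r f}"

end

theory Submission
  imports Defs
begin

text \<open>Fix a cube \<open>Q\<close> of side \<open>l\<close> and its translate \<open>Q'\<close> by \<open>N l\<close> along a coordinate axis. For large \<open>N\<close> the
  kernel is on \<open>Q' \<times> Q\<close> within \<open>\<epsilon> = O(N\<^sup>-\<^sup>n\<^sup>-\<^sup>\<delta> l\<^sup>-\<^sup>n)\<close> of a constant \<open>\<kappa>\<close>, while homogeneity applied to \<open>\<Omega> = Q\<close>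
  forces \<open>\<bar>\<kappa>\<bar>\<close> to be at least of order \<open>N\<^sup>-\<^sup>n l\<^sup>-\<^sup>n\<close>, so \<open>\<epsilon>\<close> is a small fraction of \<open>\<bar>\<kappa>\<bar>\<close>. Hence for
  \<open>\<bar>f\<bar> \<le> \<chi>\<^sub>Q\<close> and \<open>\<bar>g\<bar> \<le> \<chi>\<^sub>Q\<^sub>'\<close> the pairing of \<open>[b,T] f\<close> with \<open>g\<close> is, up to sign, \<open>\<kappa>\<close> times the integral of
  \<open>(b(y) - b(x)) f(y) g(x)\<close>, with an error of at most \<open>\<epsilon> \<bar>Q\<bar>\<close> times the total oscillation
  \<open>S = \<integral>\<^sub>Q \<bar>b - b\<^sub>Q\<bar> + \<integral>\<^sub>Q\<^sub>' \<bar>b - b\<^sub>Q\<^sub>'\<bar> + \<bar>Q\<bar> \<bar>b\<^sub>Q - b\<^sub>Q\<^sub>'\<bar>\<close>. Testing with characteristic functions and with the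
  conjugate signs of \<open>b - b\<^sub>Q\<close> and \<open>b - b\<^sub>Q\<^sub>'\<close>, made mean free, recovers \<open>S\<close>, and the error is absorbed.
  The pairing is at most the operator norm times a multiple of \<open>\<bar>Q\<bar>\<close>, because \<open>\<chi>\<^sub>Q\<close> has norm
  \<open>O(\<bar>Q\<bar>\<^bsup>1/t\<^esup>)\<close> and integrals over \<open>Q'\<close> are at most \<open>O(\<bar>Q\<bar>\<^bsup>1-1/t\<^esup>)\<close> times the norm.\<close>

section \<open>Smooth bump functions\<close>

text \<open>The obstacle is that every object is accessible only indirectly. The kernel represents
  \<open>T\<close> only on smooth functions and off their supports; the extensions of
  \<open>T\<close> behind homogeneity and behind the commutator are separate choices;
  \<open>[b,T]\<close> is defined by duality with the block space, where the commutator of the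
  transpose is a limit in the block norm, and its value on a merely integrable product
  \<open>b g\<close> is a limit in measure. The common currency is therefore
  \<open>T \<phi> \<psi>\<close> for test functions supported in the two cubes themselves, on which
  all extensions agree. Estimates for it pass by density to bounded functions, and back to almost
  everywhere bounds by testing. Limits in the block norm are handled by an embedding of the block
  space into the integrable functions on a cube. A large \<open>N\<close> helps because the kernel
  oscillation beats the homogeneity bound by the factor N^-\<delta>, uniformly in the cube.
  Absorbing the error is legitimate because \<open>S\<close> is finite for a locally integrable
  \<open>b\<close>.\<close>

definition flat_exp :: "nat \<Rightarrow> real \<Rightarrow> real" where
  "flat_exp k y = (if 0 < y then exp (- 1 / y) / y ^ k else 0)"

text \<open>This is the difference quotient at 0, the only point where smoothness is in doubt. From
  the right, the substitution of 1/y for y turns it into x^(k+1) / exp x at infinity.\<close>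

lemma flat_exp_over_id_tendsto: "((\<lambda>y. flat_exp k y / y) \<longlongrightarrow> 0) (at 0)"
proof -
  have "((\<lambda>y. flat_exp k y / y) \<longlongrightarrow> 0) (at_left 0)"
  proof -
    have "eventually (\<lambda>y::real. 0 = flat_exp k y / y) (at_left 0)"
      by (auto simp: flat_exp_def eventually_at_filter)
    then show ?thesis by (rule Lim_transform_eventually[rotated]) simp
  qed
  moreover have "((\<lambda>y. flat_exp k y / y) \<longlongrightarrow> 0) (at_right 0)"
  proof -
    have "((\<lambda>x::real. x ^ Suc k / exp x) \<longlongrightarrow> 0) at_top"
      by (rule tendsto_power_div_exp_0)
    then have "((\<lambda>y::real. inverse y ^ Suc k / exp (inverse y)) \<longlongrightarrow> 0) (at_right 0)"
      by (rule filterlim_compose[OF _ filterlim_inverse_at_top_right])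
    moreover have "eventually (\<lambda>y::real. inverse y ^ Suc k / exp (inverse y) = flat_exp k y / y) (at_right 0)"
      unfolding eventually_at_filter
      by (auto simp: flat_exp_def exp_minus field_simps)
    ultimately show ?thesis by (rule Lim_transform_eventually)
  qed
  ultimately show ?thesis by (simp add: filterlim_split_at)
qed

text \<open>The powers \<open>y ^ k\<close> are carried along for the sake of this formula:
  derivatives stay in the linear span of the family.\<close>

lemma flat_exp_deriv:
  "(flat_exp k has_real_derivative (flat_exp (k + 2) y - k * flat_exp (k + 1) y)) (at y)"
proof -
  consider "y > 0" | "y < 0" | "y = 0" by linarith
  then show ?thesis
  proof cases
    case 1
    have "((\<lambda>y. exp (- 1 / y) / y ^ k) has_real_derivative
       (flat_exp (k + 2) y - k * flat_exp (k + 1) y)) (at y)"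
      apply (rule derivative_eq_intros refl | (use 1 in simp; fail))+
      using 1 by (cases k) (simp_all add: flat_exp_def field_simps power2_eq_square)
    moreover have "eventually (\<lambda>y. flat_exp k y = exp (- 1 / y) / y ^ k) (nhds y)"
      using eventually_nhds_in_open[of "{0<..}" y] 1 by (auto elim!: eventually_mono simp: flat_exp_def)
    ultimately show ?thesis by (subst DERIV_cong_ev[OF refl _ refl])
  next
    case 2
    have "((\<lambda>y. 0) has_real_derivative
       (flat_exp (k + 2) y - k * flat_exp (k + 1) y)) (at y)"
      using 2 by (simp add: flat_exp_def)
    moreover have "eventually (\<lambda>y. flat_exp k y = 0) (nhds y)"
      using eventually_nhds_in_open[of "{..<0}" y] 2 by (auto elim!: eventually_mono simp: flat_exp_def)
    ultimately show ?thesis by (subst DERIV_cong_ev[OF refl _ refl])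
  next
    case 3
    then show ?thesis
      using flat_exp_over_id_tendsto[of k] by (simp add: DERIV_def flat_exp_def)
  qed
qed

text \<open>This algebra is closed under \<^const>\<open>pdiff\<close>, so its members are smooth without a Leibniz rule for
  iterated derivatives.\<close>

inductive smooth_alg :: "('n::finite) cfun \<Rightarrow> bool" where
  const: "smooth_alg (\<lambda>x. c)"
| flat: "smooth_alg (\<lambda>x. of_real (flat_exp k (u \<bullet> x + d)))"
| add: "smooth_alg f \<Longrightarrow> smooth_alg g \<Longrightarrow> smooth_alg (\<lambda>x. f x + g x)"
| mult: "smooth_alg f \<Longrightarrow> smooth_alg g \<Longrightarrow> smooth_alg (\<lambda>x. f x * g x)"

text \<open>Since \<open>pdiff\<close> differentiates along a line, the chain rule identifies it
  with a value of the total derivative; sum and product rules are then inherited.\<close>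

lemma pdiff_has_derivative:
  fixes f :: "('n::finite) cfun"
  assumes "(f has_derivative f') (at x)"
  shows "pdiff i f x = f' (axis i 1)"
proof -
  have "((\<lambda>s. x + s *\<^sub>R axis i 1) has_derivative (\<lambda>s. s *\<^sub>R axis i 1)) (at (0::real))"
    by (auto intro!: derivative_eq_intros)
  moreover have "(f has_derivative f') (at (x + 0 *\<^sub>R axis i 1))" using assms by simp
  ultimately have "((f \<circ> (\<lambda>s. x + s *\<^sub>R axis i 1)) has_derivative f' \<circ> (\<lambda>s. s *\<^sub>R axis i 1)) (at (0::real))"
    by (rule diff_chain_at)
  moreover have "f' \<circ> (\<lambda>s. s *\<^sub>R axis i 1) = (\<lambda>s. s *\<^sub>R f' (axis i 1))"
    using has_derivative_linear[OF assms] by (auto simp: linear_scale)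
  ultimately have "((\<lambda>s. f (x + s *\<^sub>R axis i 1)) has_vector_derivative f' (axis i 1)) (at 0)"
    by (simp add: has_vector_derivative_def o_def)
  then show ?thesis unfolding pdiff_def by (rule vector_derivative_at)
qed

lemma smooth_alg_flat_derivative:
  "((\<lambda>x::real^'n. complex_of_real (flat_exp k (u \<bullet> x + d))) has_derivative
     (\<lambda>h. of_real ((flat_exp (k + 2) (u \<bullet> x + d) - k * flat_exp (k + 1) (u \<bullet> x + d)) * (u \<bullet> h)))) (at x)"
proof -
  have "((\<lambda>x. u \<bullet> x + d) has_derivative (\<lambda>h. u \<bullet> h)) (at x)"
    by (auto intro!: derivative_eq_intros)
  from diff_chain_at[OF this flat_exp_deriv[of k "u \<bullet> x + d", unfolded has_field_derivative_def]]
  have "((\<lambda>x. flat_exp k (u \<bullet> x + d)) has_derivative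
     (\<lambda>h. (flat_exp (k + 2) (u \<bullet> x + d) - k * flat_exp (k + 1) (u \<bullet> x + d)) * (u \<bullet> h))) (at x)"
    by (simp only: o_def)
  then show ?thesis by (rule has_derivative_of_real)
qed

lemma smooth_alg_closed:
  assumes "smooth_alg f"
  shows "f differentiable (at x)" "smooth_alg (pdiff i f)"
proof -
  have "(\<forall>x. f differentiable (at x)) \<and> smooth_alg (pdiff i f)"
    using assms
  proof induction
    case (const c)
    have "pdiff i (\<lambda>x. c) = (\<lambda>x. 0)"
      using pdiff_has_derivative[OF has_derivative_const] by blast
    then show ?case by (auto intro: smooth_alg.const)
  next
    case (flat k u d)
    let ?f = "\<lambda>j x. complex_of_real (flat_exp j (u \<bullet> x + d))"
    have "pdiff i (?f k) = (\<lambda>x. (?f (k + 2) x + (- of_nat k) * ?f (k + 1) x) * of_real (u \<bullet> axis i 1))"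
      using pdiff_has_derivative[OF smooth_alg_flat_derivative] by (auto simp: fun_eq_iff)
    moreover have "smooth_alg (\<lambda>x. (?f (k + 2) x + (- of_nat k) * ?f (k + 1) x) * of_real (u \<bullet> axis i 1))"
      by (intro smooth_alg.intros)
    moreover have "?f k differentiable (at x)" for x
      unfolding differentiable_def using smooth_alg_flat_derivative by blast
    ultimately show ?case by simp
  next
    case (add f g)
    have "pdiff i (\<lambda>x. f x + g x) x = pdiff i f x + pdiff i g x" for x
    proof -
      obtain f' g' where D: "(f has_derivative f') (at x)" "(g has_derivative g') (at x)"
        using add by (meson differentiable_def)
      show ?thesis using pdiff_has_derivative[OF D(1)] pdiff_has_derivative[OF D(2)]
          pdiff_has_derivative[OF has_derivative_add[OF D]] by simp
    qed
    then have "pdiff i (\<lambda>x. f x + g x) = (\<lambda>x. pdiff i f x + pdiff i g x)" by blast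
    with add show ?case by (simp add: smooth_alg.add)
  next
    case (mult f g)
    have "pdiff i (\<lambda>x. f x * g x) x = f x * pdiff i g x + pdiff i f x * g x" for x
    proof -
      obtain f' g' where D: "(f has_derivative f') (at x)" "(g has_derivative g') (at x)"
        using mult by (meson differentiable_def)
      show ?thesis using pdiff_has_derivative[OF D(1)] pdiff_has_derivative[OF D(2)]
          pdiff_has_derivative[OF has_derivative_mult[OF D]] by simp
    qed
    then have "pdiff i (\<lambda>x. f x * g x) = (\<lambda>x. f x * pdiff i g x + pdiff i f x * g x)" by blast
    with mult show ?case by (simp add: smooth_alg.intros)
  qed
  then show "f differentiable (at x)" "smooth_alg (pdiff i f)" by auto
qed

lemma smooth_alg_smooth: "smooth_alg f \<Longrightarrow> smooth f"
proof -
  have "smooth_alg f \<Longrightarrow> smooth_alg (pdiffs is f)" for "is" :: "'a::finite list" and f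
    by (induction "is") (simp_all add: pdiffs_def smooth_alg_closed)
  then show "smooth_alg f \<Longrightarrow> smooth f" by (auto simp: smooth_def smooth_alg_closed)
qed

lemma smooth_alg_prod:
  "finite I \<Longrightarrow> (\<And>i. i \<in> I \<Longrightarrow> smooth_alg (f i)) \<Longrightarrow> smooth_alg (\<lambda>x. \<Prod>i\<in>I. f i x)"
  by (induction I rule: finite_induct) (auto intro: smooth_alg.intros)

section \<open>Compact supports and Schwartz functions\<close>

lemma compact_suppI:
  assumes "compact Q" "\<And>x. x \<notin> Q \<Longrightarrow> f x = 0"
  shows "compact (supp f)" "supp f \<subseteq> Q"
proof -
  show *: "supp f \<subseteq> Q"
    unfolding supp_def using assms by (intro closure_minimal compact_imp_closed) auto
  then show "compact (supp f)"
    using assms(1) compact_closure bounded_subset[OF compact_imp_bounded[OF assms(1)]]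
    by (simp add: compact_eq_bounded_closed supp_def)
qed

lemma pdiffs_outside_supp: "x \<notin> supp f \<Longrightarrow> pdiffs is f x = 0"
proof (induction "is" arbitrary: x)
  case Nil
  then show ?case using closure_subset[of "{x. f x \<noteq> 0}"] by (auto simp: pdiffs_def supp_def)
next
  case (Cons i "is")
  have op: "open (- supp f)" unfolding supp_def by (rule open_Compl[OF closed_closure])
  have "(pdiffs is f has_derivative (\<lambda>h. 0)) (at x)"
  proof (rule has_derivative_transform_within_open[OF _ op])
    show "((\<lambda>_. 0) has_derivative (\<lambda>h. 0)) (at x)" by simp
  qed (use Cons in auto)
  from pdiff_has_derivative[OF this] show ?case by (simp add: pdiffs_def)
qed

text \<open>The identity between \<open>T\<close> and an extension of it is available only for pairs
  of Schwartz functions, so the bumps must be recognised as such. All iterated derivatives vanish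
  off the support and are bounded on it by compactness.\<close>

lemma Cc_infty_schwartz: "Cc_infty \<subseteq> schwartz"
proof
  fix f :: "('n::finite) cfun" assume f: "f \<in> Cc_infty"
  have "bounded (range (\<lambda>x. (1 + norm x) ^ N *\<^sub>R pdiffs is f x))" for N "is"
  proof -
    let ?g = "\<lambda>x. (1 + norm x) ^ N *\<^sub>R pdiffs is f x"
    have "continuous_on (supp f) (pdiffs is f)"
      using f by (intro continuous_at_imp_continuous_on ballI differentiable_imp_continuous_within)
        (auto simp: Cc_infty_def smooth_def)
    then have "compact (?g ` supp f)"
      using f by (intro compact_continuous_image continuous_intros) (auto simp: Cc_infty_def)
    then have "bounded (insert 0 (?g ` supp f))" by (simp add: compact_imp_bounded)
    then show ?thesis
      by (rule bounded_subset) (use pdiffs_outside_supp in fastforce)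
  qed
  with f show "f \<in> schwartz" by (auto simp: schwartz_def Cc_infty_def)
qed

text \<open>Dilating inside \<open>flat_exp 0\<close> raises the product towards 1 at each interior
  point and leaves it 0 off the open box. No approximant leaves the box, so supports in two disjoint
  cubes stay disjoint.\<close>

definition box_bump :: "real ^ 'n \<Rightarrow> real ^ 'n \<Rightarrow> nat \<Rightarrow> real ^ 'n \<Rightarrow> real" where
  "box_bump a b m x = (\<Prod>i\<in>UNIV. flat_exp 0 (real (Suc m) * (x $ i - a $ i)) *
                               flat_exp 0 (real (Suc m) * (b $ i - x $ i)))"

lemma flat_exp_0_bounds: "0 \<le> flat_exp 0 y" "flat_exp 0 y \<le> 1"
  by (auto simp: flat_exp_def)

lemma box_bump_bounds: "0 \<le> box_bump a b m x" "box_bump a b m x \<le> 1"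
  unfolding box_bump_def
  by (auto intro!: prod_nonneg prod_le_1 mult_le_one simp: flat_exp_0_bounds)

lemma box_bump_outside:
  assumes "x \<notin> box a b" shows "box_bump a b m x = 0"
proof -
  obtain i where i: "x $ i \<le> a $ i \<or> b $ i \<le> x $ i"
    using assms by (auto simp: mem_box_cart not_less)
  have z: "flat_exp 0 (real (Suc m) * s) = 0" if "s \<le> 0" for s
    using that by (simp add: flat_exp_def zero_less_mult_iff not_less)
  show ?thesis
    unfolding box_bump_def
  proof (rule prod_zero)
    show "\<exists>i\<in>UNIV. flat_exp 0 (real (Suc m) * (x $ i - a $ i)) * flat_exp 0 (real (Suc m) * (b $ i - x $ i)) = 0"
      using i z[of "x $ i - a $ i"] z[of "b $ i - x $ i"] by (intro bexI[of _ i]) (auto simp del: of_nat_Suc)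
  qed simp
qed

lemma box_bump_tendsto: "(\<lambda>m. box_bump a b m x) \<longlonglongrightarrow> indicator (box a b) x"
proof (cases "x \<in> box a b")
  case True
  have *: "(\<lambda>m. flat_exp 0 (real (Suc m) * s)) \<longlonglongrightarrow> 1" if "s > 0" for s
  proof -
    have "filterlim (\<lambda>m. real (Suc m) * s) at_top sequentially"
      by (rule filterlim_at_top_mult_tendsto_pos[OF tendsto_const that])
        (rule filterlim_compose[OF filterlim_real_sequentially filterlim_Suc])
    then have "(\<lambda>m. exp (- inverse (real (Suc m) * s))) \<longlonglongrightarrow> exp (- 0)"
      by (intro tendsto_exp tendsto_minus tendsto_inverse_0_at_top)
    then show ?thesis using that by (simp add: flat_exp_def inverse_eq_divide)
  qed
  have "(\<lambda>m. box_bump a b m x) \<longlonglongrightarrow> (\<Prod>i\<in>(UNIV::'a set). 1 * 1)"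
    unfolding box_bump_def using True
    by (intro tendsto_prod tendsto_mult *) (auto simp: mem_box_cart)
  with True show ?thesis by simp
qed (simp add: box_bump_outside)

lemma smooth_alg_box_bump: "smooth_alg (\<lambda>x::real^'n. complex_of_real (box_bump a b m x))"
proof -
  have e: "complex_of_real (box_bump a b m x) = (\<Prod>i\<in>UNIV.
      of_real (flat_exp 0 ((real (Suc m) *\<^sub>R axis i 1) \<bullet> x + (- real (Suc m) * a $ i))) *
      of_real (flat_exp 0 ((- real (Suc m) *\<^sub>R axis i 1) \<bullet> x + real (Suc m) * b $ i)))" for x
    by (simp add: box_bump_def inner_axis' algebra_simps)
  show ?thesis
    unfolding e by (intro smooth_alg_prod smooth_alg.intros) auto
qed

lemma smooth_alg_Cc_infty:
  assumes "smooth_alg f" "compact Q" "\<And>x. x \<notin> Q \<Longrightarrow> f x = 0"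
  shows "f \<in> Cc_infty"
  using assms compact_suppI(1)[of Q f] by (auto simp: Cc_infty_def smooth_alg_smooth)

section \<open>Density of test functions\<close>

text \<open>The square of the L^2 distance, whence the factors 2 in the triangle inequality. Values
  in \<open>ennreal\<close> postpone all questions of integrability.\<close>

definition l2_dist :: "('n::finite) cfun \<Rightarrow> 'n cfun \<Rightarrow> ennreal" where
  "l2_dist f g = (\<integral>\<^sup>+x. ennreal ((cmod (f x - g x))\<^sup>2) \<partial>lebesgue)"

text \<open>The approximants vanish off \<open>Q\<close> itself and not merely off a neighbourhood:
  the kernel formula will be used on a second cube, which must avoid their supports.\<close>

definition test_approx :: "(real ^ 'n) set \<Rightarrow> ('n::finite) cfun \<Rightarrow> bool" where
  "test_approx Q f \<longleftrightarrow> f \<in> borel_measurable lebesgue \<and>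
     (\<forall>e>0. \<exists>\<phi>. smooth_alg \<phi> \<and> (\<forall>x. x \<notin> Q \<longrightarrow> \<phi> x = 0) \<and> l2_dist \<phi> f < ennreal e)"

lemma l2_dist_triangle:
  assumes [measurable]: "f \<in> borel_measurable lebesgue" "g \<in> borel_measurable lebesgue" "h \<in> borel_measurable lebesgue"
  shows "l2_dist f h \<le> 2 * l2_dist f g + 2 * l2_dist g h"
proof -
  have p: "(cmod (f x - h x))\<^sup>2 \<le> 2 * (cmod (f x - g x))\<^sup>2 + 2 * (cmod (g x - h x))\<^sup>2" for x
  proof -
    have "cmod (f x - h x) \<le> cmod (f x - g x) + cmod (g x - h x)"
      using norm_triangle_ineq[of "f x - g x" "g x - h x"] by simp
    then have "(cmod (f x - h x))\<^sup>2 \<le> (cmod (f x - g x) + cmod (g x - h x))\<^sup>2"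
      by (intro power_mono) auto
    also have "\<dots> \<le> 2 * (cmod (f x - g x))\<^sup>2 + 2 * (cmod (g x - h x))\<^sup>2"
      by (smt (verit, best) power2_sum sum_squares_bound)
    finally show ?thesis .
  qed
  have "l2_dist f h \<le> (\<integral>\<^sup>+x. 2 * ennreal ((cmod (f x - g x))\<^sup>2) + 2 * ennreal ((cmod (g x - h x))\<^sup>2) \<partial>lebesgue)"
    unfolding l2_dist_def
  proof (rule nn_integral_mono)
    fix x
    show "ennreal ((cmod (f x - h x))\<^sup>2) \<le> 2 * ennreal ((cmod (f x - g x))\<^sup>2) + 2 * ennreal ((cmod (g x - h x))\<^sup>2)"
      using ennreal_leI[OF p[of x]] by (simp add: ennreal_plus ennreal_mult'')
  qed
  also have "\<dots> = 2 * l2_dist f g + 2 * l2_dist g h"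
    unfolding l2_dist_def by (subst nn_integral_add) (simp_all add: nn_integral_cmult)
  finally show ?thesis .
qed

lemma smooth_alg_measurable:
  assumes "smooth_alg f" shows "f \<in> borel_measurable lebesgue"
proof -
  have "continuous_on UNIV f"
    using smooth_alg_closed(1)[OF assms] differentiable_imp_continuous_within
    by (metis continuous_at_imp_continuous_on)
  then have "f \<in> borel_measurable borel" by (rule borel_measurable_continuous_onI)
  then show ?thesis by (simp add: measurable_completion)
qed

lemma test_approx_add:
  assumes "test_approx Q f" "test_approx Q g"
  shows "test_approx Q (\<lambda>x. f x + g x)"
  unfolding test_approx_def
proof (intro conjI allI impI)
  have [measurable]: "f \<in> borel_measurable lebesgue" "g \<in> borel_measurable lebesgue"
    using assms by (auto simp: test_approx_def)
  then show "(\<lambda>x. f x + g x) \<in> borel_measurable lebesgue" by measurable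
  fix e :: real assume "e > 0"
  \<comment> \<open>Two errors of a quarter, each doubled by the triangle inequality for squared
    distances, add up to \<open>e\<close>.\<close>
  then have e4: "e / 4 > 0" by simp
  obtain \<phi> \<psi> where p: "smooth_alg \<phi>" "\<forall>x. x \<notin> Q \<longrightarrow> \<phi> x = 0" "l2_dist \<phi> f < ennreal (e / 4)"
    and q: "smooth_alg \<psi>" "\<forall>x. x \<notin> Q \<longrightarrow> \<psi> x = 0" "l2_dist \<psi> g < ennreal (e / 4)"
    using assms e4 unfolding test_approx_def by meson
  note [measurable] = smooth_alg_measurable[OF p(1)] smooth_alg_measurable[OF q(1)]
  let ?s = "\<lambda>x. \<phi> x + \<psi> x"
  have "l2_dist ?s (\<lambda>x. f x + g x) \<le> 2 * l2_dist ?s (\<lambda>x. f x + \<psi> x) + 2 * l2_dist (\<lambda>x. f x + \<psi> x) (\<lambda>x. f x + g x)"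
    by (rule l2_dist_triangle) measurable
  also have "\<dots> = 2 * l2_dist \<phi> f + 2 * l2_dist \<psi> g" by (simp add: l2_dist_def)
  also have "\<dots> = (l2_dist \<phi> f + l2_dist \<psi> g) + (l2_dist \<phi> f + l2_dist \<psi> g)" by (simp add: mult_2 add_ac)
  also have "\<dots> < (ennreal (e/4) + ennreal (e/4)) + (ennreal (e/4) + ennreal (e/4))"
    by (intro add_strict_mono p q)
  also have "\<dots> = ennreal e" using \<open>e > 0\<close> by (simp flip: ennreal_plus)
  finally show "\<exists>\<phi>. smooth_alg \<phi> \<and> (\<forall>x. x \<notin> Q \<longrightarrow> \<phi> x = 0) \<and> l2_dist \<phi> (\<lambda>x. f x + g x) < ennreal e"
    using p q by (intro exI[of _ ?s]) (auto intro: smooth_alg.intros)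
qed

lemma test_approx_zero: "test_approx Q (\<lambda>x. 0)"
  unfolding test_approx_def l2_dist_def
  by (auto intro!: exI[of _ "\<lambda>x. 0"] smooth_alg.intros)

lemma test_approx_scale:
  assumes "test_approx Q f"
  shows "test_approx Q (\<lambda>x. c * f x)"
proof (cases "c = 0")
  case False
  have [measurable]: "f \<in> borel_measurable lebesgue" using assms by (auto simp: test_approx_def)
  show ?thesis unfolding test_approx_def
  proof (intro conjI allI impI)
    fix e :: real assume "e > 0"
    with False have "e / (cmod c)\<^sup>2 > 0" by simp
    then obtain \<phi> where p: "smooth_alg \<phi>" "\<forall>x. x \<notin> Q \<longrightarrow> \<phi> x = 0" "l2_dist \<phi> f < ennreal (e / (cmod c)\<^sup>2)"
      using assms unfolding test_approx_def by meson
    note [measurable] = smooth_alg_measurable[OF p(1)]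
    have "l2_dist (\<lambda>x. c * \<phi> x) (\<lambda>x. c * f x) = (\<integral>\<^sup>+x. ennreal ((cmod c)\<^sup>2) * ennreal ((cmod (\<phi> x - f x))\<^sup>2) \<partial>lebesgue)"
      unfolding l2_dist_def
      by (intro nn_integral_cong) (simp flip: right_diff_distrib add: norm_mult power_mult_distrib ennreal_mult)
    also have "\<dots> = ennreal ((cmod c)\<^sup>2) * l2_dist \<phi> f"
      unfolding l2_dist_def by (intro nn_integral_cmult) measurable
    also have "\<dots> < ennreal ((cmod c)\<^sup>2) * ennreal (e / (cmod c)\<^sup>2)"
      using False p(3) by (intro ennreal_mult_strict_left_mono) auto
    also have "\<dots> = ennreal e" using False \<open>e > 0\<close> by (simp flip: ennreal_mult)
    finally show "\<exists>\<phi>. smooth_alg \<phi> \<and> (\<forall>x. x \<notin> Q \<longrightarrow> \<phi> x = 0) \<and> l2_dist \<phi> (\<lambda>x. c * f x) < ennreal e"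
      using p by (intro exI[of _ "\<lambda>x. c * \<phi> x"]) (auto intro: smooth_alg.intros)
  qed measurable
qed (simp add: test_approx_zero)

lemma test_approx_sum:
  "finite I \<Longrightarrow> (\<And>i. i \<in> I \<Longrightarrow> test_approx Q (f i)) \<Longrightarrow> test_approx Q (\<lambda>x. \<Sum>i\<in>I. f i x)"
  by (induction I rule: finite_induct) (auto intro: test_approx_zero test_approx_add)

lemma l2_dist_dominated:
  fixes g :: "nat \<Rightarrow> ('n::finite) cfun"
  assumes g[measurable]: "\<And>n. g n \<in> borel_measurable lebesgue" and [measurable]: "f \<in> borel_measurable lebesgue"
    and Q: "Q \<in> lmeasurable"
    and lim: "AE x in lebesgue. (\<lambda>n. g n x) \<longlonglongrightarrow> f x"
    and B: "\<And>n x. cmod (g n x) \<le> B" and 0: "\<And>n x. x \<notin> Q \<Longrightarrow> g n x = 0"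
  shows "(\<lambda>n. l2_dist (g n) f) \<longlonglongrightarrow> 0"
proof -
  have [measurable]: "Q \<in> sets lebesgue" using Q by auto
  have B0: "0 \<le> B" using B[of 0 0] norm_ge_zero order_trans by blast
  have "(\<lambda>n. l2_dist (g n) f) \<longlonglongrightarrow> (\<integral>\<^sup>+(x::real^'n). 0 \<partial>lebesgue)"
    unfolding l2_dist_def
  proof (rule nn_integral_dominated_convergence[where w="\<lambda>x. ennreal ((2 * B)\<^sup>2) * indicator Q (x::real^'n)"])
    show "AE x in lebesgue. ennreal ((cmod (g j x - f x))\<^sup>2) \<le> ennreal ((2 * B)\<^sup>2) * indicator Q x" for j
      using lim
    proof eventually_elim
      case (elim x)
      have "cmod (f x) \<le> B"
        using tendsto_norm[OF elim] B by (meson LIMSEQ_le_const2)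
      then have "cmod (g j x - f x) \<le> 2 * B" using norm_triangle_ineq4[of "g j x" "f x"] B[of j x] by linarith
      then have "(cmod (g j x - f x))\<^sup>2 \<le> (2 * B)\<^sup>2" by (intro power_mono) auto
      moreover have "f x = 0" if "x \<notin> Q" using elim 0[OF that] by (simp add: LIMSEQ_const_iff)
      ultimately show ?case using 0[of x j] by (auto simp: indicator_def intro!: ennreal_leI simp del: power_mult_distrib)
    qed
    show "(\<integral>\<^sup>+x. ennreal ((2 * B)\<^sup>2) * indicator Q (x::real^'n) \<partial>lebesgue) < \<infinity>"
      using Q by (subst nn_integral_cmult) (auto simp: ennreal_mult_less_top fmeasurable_def)
    show "AE x in lebesgue. (\<lambda>i. ennreal ((cmod (g i x - f x))\<^sup>2)) \<longlonglongrightarrow> 0"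
      using lim
    proof eventually_elim
      case (elim x)
      have "(\<lambda>i. (cmod (g i x - f x))\<^sup>2) \<longlonglongrightarrow> (cmod (f x - f x))\<^sup>2"
        by (intro tendsto_intros elim)
      then show ?case using tendsto_ennrealI by fastforce
    qed
  qed measurable
  then show ?thesis by simp
qed

text \<open>Approximability survives uniformly bounded almost everywhere limits inside
  \<open>Q\<close>, by dominated convergence. Boxes, Borel sets, Lebesgue sets and bounded functions
  are all reached through limits of this kind.\<close>

lemma test_approx_limit:
  fixes g :: "nat \<Rightarrow> ('n::finite) cfun"
  assumes g: "\<And>n. test_approx Q (g n)" and [measurable]: "f \<in> borel_measurable lebesgue"
    and Q: "Q \<in> lmeasurable"
    and lim: "AE x in lebesgue. (\<lambda>n. g n x) \<longlonglongrightarrow> f x"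
    and B: "\<And>n x. cmod (g n x) \<le> B" and 0: "\<And>n x. x \<notin> Q \<Longrightarrow> g n x = 0"
  shows "test_approx Q f"
  unfolding test_approx_def
proof (intro conjI allI impI)
  have m[measurable]: "g n \<in> borel_measurable lebesgue" for n
    using g[of n] by (simp add: test_approx_def)
  fix e :: real assume e: "e > 0"
  then have e4: "e / 4 > 0" by simp
  have "(\<lambda>n. l2_dist (g n) f) \<longlonglongrightarrow> 0"
    using lim by (intro l2_dist_dominated[OF m _ Q _ B 0]) simp_all
  from order_tendstoD(2)[OF this, of "ennreal (e / 4)"]
  have "eventually (\<lambda>n. l2_dist (g n) f < ennreal (e / 4)) sequentially"
    using e by simp
  then obtain n where n: "l2_dist (g n) f < ennreal (e / 4)" by (auto simp: eventually_sequentially)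
  obtain \<phi> where p: "smooth_alg \<phi>" "\<forall>x. x \<notin> Q \<longrightarrow> \<phi> x = 0" "l2_dist \<phi> (g n) < ennreal (e / 4)"
    using g[of n] e4 unfolding test_approx_def by meson
  note [measurable] = smooth_alg_measurable[OF p(1)]
  have "l2_dist \<phi> f \<le> 2 * l2_dist \<phi> (g n) + 2 * l2_dist (g n) f"
    by (rule l2_dist_triangle) measurable
  also have "\<dots> = (l2_dist \<phi> (g n) + l2_dist (g n) f) + (l2_dist \<phi> (g n) + l2_dist (g n) f)"
    by (simp add: mult_2 add_ac)
  also have "\<dots> < (ennreal (e/4) + ennreal (e/4)) + (ennreal (e/4) + ennreal (e/4))"
    by (intro add_strict_mono p n)
  also have "\<dots> = ennreal e" using \<open>e > 0\<close> by (simp flip: ennreal_plus)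
  finally show "\<exists>\<phi>. smooth_alg \<phi> \<and> (\<forall>x. x \<notin> Q \<longrightarrow> \<phi> x = 0) \<and> l2_dist \<phi> f < ennreal e"
    using p by blast
qed measurable

lemma test_approx_box:
  fixes u v :: "real ^ 'n"
  assumes sub: "box u v \<subseteq> Q" and Q: "Q \<in> lmeasurable"
  shows "test_approx Q (indicator (box u v))"
proof (rule test_approx_limit[OF _ _ Q, where B=1])
  let ?g = "\<lambda>m x. complex_of_real (box_bump u v m x)"
  have z: "?g m x = 0" if "x \<notin> Q" for m x using sub that box_bump_outside[of x u v m] by auto
  then show "\<And>n x. x \<notin> Q \<Longrightarrow> ?g n x = 0" .
  show "cmod (?g m x) \<le> 1" for m x using box_bump_bounds[of u v m x] by simp
  show "AE x in lebesgue. (\<lambda>m. ?g m x) \<longlonglongrightarrow> indicator (box u v) x"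
  proof (rule AE_I2)
    fix x
    have "(\<lambda>m. ?g m x) \<longlonglongrightarrow> of_real (indicator (box u v) x)"
      by (intro tendsto_of_real box_bump_tendsto)
    moreover have "complex_of_real (indicator (box u v) x) = indicator (box u v) x"
      by (simp add: indicator_def)
    ultimately show "(\<lambda>m. ?g m x) \<longlonglongrightarrow> indicator (box u v) x" by simp
  qed
  show "test_approx Q (?g m)" for m
    unfolding test_approx_def
  proof (intro conjI allI impI)
    show "?g m \<in> borel_measurable lebesgue" by (rule smooth_alg_measurable[OF smooth_alg_box_bump])
    fix e :: real assume "e > 0"
    then show "\<exists>\<phi>. smooth_alg \<phi> \<and> (\<forall>x. x \<notin> Q \<longrightarrow> \<phi> x = 0) \<and> l2_dist \<phi> (?g m) < ennreal e"
      using smooth_alg_box_bump[of u v m] z by (intro exI[of _ "?g m"]) (simp add: l2_dist_def)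
  qed
  show "(indicator (box u v) :: _ \<Rightarrow> complex) \<in> borel_measurable lebesgue"
    by (intro borel_measurable_indicator) simp
qed

text \<open>Induction over the \<pi>-system of open boxes. Cutting with the open box
  \<open>box a b\<close> makes complements relative to a set of finite measure, so they become
  differences of two approximable indicators; disjoint unions are bounded limits of partial
  sums.\<close>

lemma test_approx_borel:
  fixes a b :: "real ^ 'n"
  assumes \<Omega>: "\<Omega> \<in> sets borel"
  shows "test_approx (cbox a b) (indicator (\<Omega> \<inter> box a b))"
proof -
  let ?Q = "cbox a b" and ?B = "box a b"
  have lm: "?Q \<in> lmeasurable" by simp
  have in_borel: "A \<in> sets borel" if "A \<in> sigma_sets UNIV (range (\<lambda>(a, b). box a b))" for A :: "(real^'n) set"
    using that by (simp add: borel_eq_box)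
  have "Int_stable (range (\<lambda>(a, b). box a b :: (real^'n) set))"
    by (auto simp: Int_stable_def box_Int_box)
  moreover have "range (\<lambda>(a, b). box a b :: (real^'n) set) \<subseteq> Pow UNIV" by simp
  moreover have "\<Omega> \<in> sigma_sets UNIV (range (\<lambda>(a, b). box a b))"
    using \<Omega> by (simp add: borel_eq_box)
  ultimately show ?thesis
  proof (induction rule: sigma_sets_induct_disjoint)
    fix A :: "(real^'n) set" assume "A \<in> range (\<lambda>(a, b). box a b)"
    then obtain u v where "A \<inter> ?B = box u v" by (auto simp: box_Int_box)
    moreover have "A \<inter> ?B \<subseteq> ?Q" using box_subset_cbox by blast
    ultimately show "test_approx ?Q (indicator (A \<inter> ?B))" using test_approx_box[OF _ lm] by metis
  next
    show "test_approx ?Q (indicator ({} \<inter> ?B))"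
      using test_approx_zero by (simp add: indicator_def[abs_def])
  next
    fix A :: "(real^'n) set" assume "test_approx ?Q (indicator (A \<inter> ?B))"
    then have "test_approx ?Q (\<lambda>x. indicator ?B x + (-1) * indicator (A \<inter> ?B) x)"
      by (intro test_approx_add test_approx_scale test_approx_box[OF _ lm] box_subset_cbox)
    also have "(\<lambda>x. indicator ?B x + (-1) * indicator (A \<inter> ?B) x) = (indicator ((UNIV - A) \<inter> ?B) :: _ \<Rightarrow> complex)"
      by (auto simp: indicator_def)
    finally show "test_approx ?Q (indicator ((UNIV - A) \<inter> ?B))" .
  next
    fix A :: "nat \<Rightarrow> (real^'n) set"
    assume dj: "disjoint_family A" and A: "range A \<subseteq> sigma_sets UNIV (range (\<lambda>(a, b). box a b))"
      and ap: "\<And>i. test_approx ?Q (indicator (A i \<inter> ?B))"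
    have s: "(\<Sum>i<n. indicator (A i \<inter> ?B) x) = (indicator (\<Union>i<n. A i \<inter> ?B) x :: complex)" for n x
      by (rule indicator_UN_disjoint[symmetric]) (use dj in \<open>auto simp: disjoint_family_on_def\<close>)
    show "test_approx ?Q (indicator (\<Union> (range A) \<inter> ?B))"
    proof (rule test_approx_limit[OF _ _ lm, where B=1])
      let ?g = "\<lambda>n x. \<Sum>i<n. indicator (A i \<inter> ?B) x :: complex"
      show "test_approx ?Q (?g n)" for n by (intro test_approx_sum ap) auto
      have "\<Union> (range A) \<inter> ?B \<in> sets borel" using A in_borel by (intro sets.Int sets.countable_UN) auto
      then show "indicator (\<Union> (range A) \<inter> ?B) \<in> borel_measurable lebesgue"
        by (intro borel_measurable_indicator) simp
      show "cmod (?g n x) \<le> 1" for n x unfolding s by (simp add: indicator_def)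
      show "\<And>n x. x \<notin> ?Q \<Longrightarrow> ?g n x = 0" using box_subset_cbox[of a b] unfolding s by (auto simp: indicator_def)
      show "AE x in lebesgue. (\<lambda>n. ?g n x) \<longlonglongrightarrow> indicator (\<Union> (range A) \<inter> ?B) x"
      proof (rule AE_I2)
        fix x
        have "(\<lambda>n. indicator (\<Union>i<n. A i \<inter> ?B) x :: complex) \<longlonglongrightarrow> indicator (\<Union>i. A i \<inter> ?B) x"
          by (rule LIMSEQ_indicator_UN)
        then show "(\<lambda>n. ?g n x) \<longlonglongrightarrow> indicator (\<Union> (range A) \<inter> ?B) x" unfolding s by simp
      qed
    qed
  qed
qed

text \<open>A Lebesgue set is a Borel set up to a null set, and the faces of the box are null, so a
  constant sequence already converges almost everywhere.\<close>

lemma test_approx_lebesgue_set: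
  fixes a b :: "real ^ 'n"
  assumes S: "S \<in> sets lebesgue" "S \<subseteq> cbox a b"
  shows "test_approx (cbox a b) (indicator S)"
proof -
  let ?M = "main_part lborel S"
  have n: "null_part lborel S \<in> null_sets lebesgue"
  proof -
    obtain N where "N \<in> null_sets lborel" "null_part lborel S \<subseteq> N"
      using null_part[OF S(1)] by auto
    then show ?thesis
      using null_sets_completion_subset null_sets_completionI by metis
  qed
  have f: "cbox a b - box a b \<in> null_sets lebesgue"
    using negligible_frontier_interval[of a b] by (simp add: negligible_iff_null_sets)
  have "AE x in lebesgue. x \<notin> null_part lborel S \<and> x \<notin> cbox a b - box a b"
    using AE_not_in[OF n] AE_not_in[OF f] by eventually_elim auto
  then have AE: "AE x in lebesgue. (indicator (?M \<inter> box a b) x :: complex) = indicator S x"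
  proof eventually_elim
    case (elim x)
    have "x \<in> S \<longleftrightarrow> x \<in> ?M" using main_part_null_part_Un[OF S(1)] elim by blast
    then show ?case using elim S(2) by (auto simp: indicator_def)
  qed
  show ?thesis
  proof (rule test_approx_limit[where B=1 and g="\<lambda>n. indicator (?M \<inter> box a b)"])
    show "test_approx (cbox a b) (indicator (?M \<inter> box a b))"
      using main_part_sets[OF S(1)] by (intro test_approx_borel) simp
    show "AE x in lebesgue. (\<lambda>n. indicator (?M \<inter> box a b) x :: complex) \<longlonglongrightarrow> indicator S x"
      using AE by eventually_elim simp
    show "\<And>n x. x \<notin> cbox a b \<Longrightarrow> indicator (?M \<inter> box a b) x = (0::complex)"
      using box_subset_cbox[of a b] by (auto simp: indicator_def)
    show "indicator S \<in> borel_measurable lebesgue" using S by simp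
    show "cbox a b \<in> lmeasurable" by simp
    show "cmod (indicator (?M \<inter> box a b) x) \<le> 1" for x by (simp add: indicator_def)
  qed
qed

text \<open>Simple functions dominated by twice |f| converge to f. The domination serves two
  purposes: it gives the uniform bound, and it makes the simple functions vanish wherever f does, so
  that their level sets stay inside the box.\<close>

lemma test_approx_bounded:
  fixes f :: "('n::finite) cfun" and a b :: "real ^ 'n"
  assumes f[measurable]: "f \<in> borel_measurable lebesgue" and B: "\<And>x. cmod (f x) \<le> B"
    and 0: "\<And>x. x \<notin> cbox a b \<Longrightarrow> f x = 0"
  shows "test_approx (cbox a b) f"
proof -
  have "\<exists>F. (\<forall>i. simple_function lebesgue (F i)) \<and> (\<forall>x\<in>space lebesgue. (\<lambda>i. F i x) \<longlonglongrightarrow> f x) \<and>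
      (\<forall>i. \<forall>x\<in>space lebesgue. dist (F i x) 0 \<le> 2 * dist (f x) 0)"
    by (rule borel_measurable_implies_sequence_metric[OF f])
  then obtain F where "\<forall>i. simple_function lebesgue (F i)" "\<forall>x\<in>space lebesgue. (\<lambda>i. F i x) \<longlonglongrightarrow> f x"
    "\<forall>i. \<forall>x\<in>space lebesgue. dist (F i x) 0 \<le> 2 * dist (f x) 0" by (elim exE conjE)
  then have F: "simple_function lebesgue (F i)" and lim: "(\<lambda>i. F i x) \<longlonglongrightarrow> f x"
    and bd: "dist (F i x) 0 \<le> 2 * dist (f x) 0" for i x by simp_all
  show ?thesis
  proof (rule test_approx_limit[where B="2 * B" and g=F])
    show z: "\<And>n x. x \<notin> cbox a b \<Longrightarrow> F n x = 0" 
    proof -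
      fix n x assume "x \<notin> cbox a b"
      then show "F n x = 0" using bd[of n x] 0[of x] by simp
    qed
    show "cmod (F n x) \<le> 2 * B" for n x using bd[of n x] B[of x] by simp
    show "test_approx (cbox a b) (F n)" for n
    proof -
      have fin: "finite (range (F n))" using F[of n] by (simp add: simple_function_def)
      have "F n = (\<lambda>x. \<Sum>y\<in>range (F n) - {0}. y * indicator (F n -` {y}) x)"
      proof
        fix x
        have "(\<Sum>y\<in>range (F n) - {0}. y * indicator (F n -` {y}) x) = (\<Sum>y\<in>range (F n) - {0}. if y = F n x then y else 0)"
          by (intro sum.cong) (auto simp: indicator_def)
        also have "\<dots> = F n x" using fin by (subst sum.delta) auto
        finally show "F n x = (\<Sum>y\<in>range (F n) - {0}. y * indicator (F n -` {y}) x)" by simp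
      qed
      moreover have "test_approx (cbox a b) (\<lambda>x. \<Sum>y\<in>range (F n) - {0}. y * indicator (F n -` {y}) x)"
      proof (intro test_approx_sum test_approx_scale test_approx_lebesgue_set)
        fix y assume y: "y \<in> range (F n) - {0}"
        show "F n -` {y} \<in> sets lebesgue" using simple_functionD(2)[OF F[of n], of "{y}"] by simp
        show "F n -` {y} \<subseteq> cbox a b"
        proof
          fix x assume "x \<in> F n -` {y}"
          then show "x \<in> cbox a b" using y z[of x n] by fastforce
        qed
      next
        show "finite (range (F n) - {0})" using fin by simp
      qed
      ultimately show ?thesis by simp
    qed
    show "AE x in lebesgue. (\<lambda>n. F n x) \<longlonglongrightarrow> f x" using lim by simp
    show "f \<in> borel_measurable lebesgue" by fact
    show "cbox a b \<in> lmeasurable" by simp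
  qed
qed

section \<open>Lorentz norms\<close>

lemma epowr_ennreal [simp]: "0 \<le> x \<Longrightarrow> epowr (ennreal x) a = ennreal (x powr a)"
  by (simp add: epowr_def)

lemma epowr_0 [simp]: "epowr 0 a = 0"
  by (simp add: epowr_def)

lemma epowr_top [simp]: "epowr top a = top"
  by (simp add: epowr_def)

lemma epowr_mono: "x \<le> y \<Longrightarrow> 0 \<le> a \<Longrightarrow> epowr x a \<le> epowr y a"
  by (cases x; cases y) (auto intro!: ennreal_leI powr_mono2 simp: epowr_def top_unique)

lemma epowr_epowr_inverse: "0 < a \<Longrightarrow> epowr (epowr x a) (1 / a) = x"
  by (cases x) (auto simp: powr_powr)

lemma nn_integral_powr_interval:
  assumes "0 < a" "0 \<le> m" "0 \<le> c"
  shows "(\<integral>\<^sup>+u. ennreal (c * u powr (a - 1)) * indicator {0..m} u \<partial>lborel) = ennreal (c * (m powr a / a))"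
proof -
  have "((\<lambda>u. c * u powr (a - 1)) has_integral (c * (m powr (a - 1 + 1) / (a - 1 + 1)))) {0..m}"
    using assms by (intro has_integral_mult_right has_integral_powr_from_0) auto
  then have "((\<lambda>u. c * u powr (a - 1)) has_integral (c * (m powr a / a))) {0..m}" by simp
  from nn_integral_has_integral_lebesgue'[OF _ this] assms show ?thesis by simp
qed

lemma emeasure_lmeasurable: "S \<in> lmeasurable \<Longrightarrow> emeasure lebesgue S = ennreal (measure lebesgue S)"
  by (rule emeasure_eq_measure2)

lemma rearr_le:
  assumes "0 < B" "\<And>x. cmod (f x) \<le> B"
  shows "rearr f u \<le> ennreal B"
proof -
  have "{x. B < cmod (f x)} = {}" using assms(2) by (auto simp: not_less)
  then have "distr_fun f B \<le> ennreal u" by (simp add: distr_fun_def)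
  with assms(1) show ?thesis unfolding rearr_def by (auto intro: Inf_lower)
qed

lemma rearr_eq_0:
  assumes "S \<in> lmeasurable" "\<And>x. x \<notin> S \<Longrightarrow> f x = 0" "measure lebesgue S \<le> u"
  shows "rearr f u = 0"
proof -
  have "rearr f u \<le> ennreal s" if "s > 0" for s
  proof -
    have "distr_fun f s \<le> emeasure lebesgue S"
      unfolding distr_fun_def
    proof (rule emeasure_mono)
      show "{x. s < cmod (f x)} \<subseteq> S"
      proof
        fix x assume "x \<in> {x. s < cmod (f x)}"
        then show "x \<in> S" using assms(2)[of x] that by (cases "x \<in> S") auto
      qed
      show "S \<in> sets lebesgue" using assms(1) by auto
    qed
    also have "\<dots> \<le> ennreal u"
      unfolding emeasure_lmeasurable[OF assms(1)] using assms(3) by (rule ennreal_leI)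
    finally show ?thesis unfolding rearr_def using that by (auto intro: Inf_lower)
  qed
  then have "rearr f u \<le> 0 + ennreal s" if "s > 0" for s using that by simp
  then have "rearr f u \<le> 0" by (rule ennreal_le_epsilon)
  then show ?thesis by simp
qed

text \<open>The rearrangement is at most \<open>B\<close> up to the measure of \<open>S\<close> and
  vanishes beyond it, so only the integral of B^q u^(q/p - 1) over that interval remains. The factor
  \<open>(p / q) powr (1 / q)\<close> comes from this integral.\<close>

lemma lorentz_norm_bounded:
  fixes f :: "('n::finite) cfun"
  assumes p: "0 < p" and q: "0 < q" and B: "0 < B" "\<And>x. cmod (f x) \<le> B * indicator S x"
    and S: "S \<in> lmeasurable"
  shows "lorentz_norm p q f \<le> ennreal (B * measure lebesgue S powr (1 / p) * (p / q) powr (1 / q))"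
proof -
  let ?m = "measure lebesgue S"
  have b: "cmod (f x) \<le> B" for x using B(2)[of x] B(1) by (cases "x \<in> S") auto
  have z: "f x = 0" if "x \<notin> S" for x using B(2)[of x] that by simp
  have "(\<integral>\<^sup>+u\<in>{0<..}. epowr (ennreal (u powr (1 / p)) * rearr f u) q / ennreal u \<partial>lborel)
     \<le> (\<integral>\<^sup>+u. ennreal (B powr q * u powr (q / p - 1)) * indicator {0..?m} u \<partial>lborel)"
  proof (rule nn_integral_mono)
    fix u :: real
    show "epowr (ennreal (u powr (1 / p)) * rearr f u) q / ennreal u * indicator {0<..} u
      \<le> ennreal (B powr q * u powr (q / p - 1)) * indicator {0..?m} u"
    proof (cases "0 < u \<and> u \<le> ?m")
      case True
      have "epowr (ennreal (u powr (1 / p)) * rearr f u) q \<le> epowr (ennreal (u powr (1 / p)) * ennreal B) q"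
        using rearr_le[OF B(1) b] q by (intro epowr_mono mult_left_mono) auto
      also have "\<dots> = ennreal (B powr q * u powr (q / p))"
        using B True by (simp flip: ennreal_mult add: powr_mult powr_powr mult.commute)
      finally have "epowr (ennreal (u powr (1 / p)) * rearr f u) q / ennreal u \<le> ennreal (B powr q * u powr (q / p)) / ennreal u"
        by (rule divide_right_mono_ennreal)
      also have "\<dots> = ennreal (B powr q * u powr (q / p - 1))"
        using True by (simp add: divide_ennreal powr_diff)
      finally show ?thesis using True by simp
    next
      case False
      then have "0 < u \<Longrightarrow> rearr f u = 0" by (intro rearr_eq_0[OF S z]) auto
      with False show ?thesis by (auto simp: indicator_def)
    qed
  qed
  also have "\<dots> = ennreal (B powr q * (?m powr (q / p) / (q / p)))"
    using p q by (intro nn_integral_powr_interval) auto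
  finally have "lorentz_norm p q f \<le> epowr (ennreal (B powr q * (?m powr (q / p) / (q / p)))) (1 / q)"
    unfolding lorentz_norm_def using q by (intro epowr_mono) auto
  also have "\<dots> = ennreal (B * ?m powr (1 / p) * (p / q) powr (1 / q))"
    using p q B by (simp add: powr_mult powr_divide powr_powr)
  finally show ?thesis .
qed

section \<open>Weak type bounds and local integrability\<close>

lemma superlevel_measurable:
  fixes f :: "('n::finite) cfun"
  assumes [measurable]: "f \<in> borel_measurable lebesgue"
  shows "{x. s < cmod (f x)} \<in> sets lebesgue"
proof -
  have "{x \<in> space lebesgue. s < cmod (f x)} \<in> sets lebesgue" by measurable
  then show ?thesis by simp
qed

text \<open>The embedding of L^{p,q} into weak L^p: the rearrangement is at least \<open>s\<close>
  on (0, d). The real number \<open>d\<close> stands in for the distribution function, which may be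
  infinite.\<close>

lemma lorentz_norm_weak:
  fixes f :: "('n::finite) cfun"
  assumes f: "f \<in> borel_measurable lebesgue" and p: "0 < p" and q: "0 < q"
    and s: "0 < s" and d: "0 \<le> d" "ennreal d \<le> distr_fun f s"
  shows "ennreal ((p / q) powr (1 / q) * s * d powr (1 / p)) \<le> lorentz_norm p q f"
proof -
  have r: "ennreal s \<le> rearr f u" if u: "0 \<le> u" "u < d" for u
    unfolding rearr_def
  proof (rule Inf_greatest, clarify)
    fix s' assume s': "0 < s'" "distr_fun f s' \<le> ennreal u"
    have "ennreal u < ennreal d" using u by (simp add: ennreal_lessI)
    show "ennreal s \<le> ennreal s'"
    proof (rule ccontr)
      assume "\<not> ennreal s \<le> ennreal s'"
      then have "s' \<le> s" using s s'(1) by (auto simp: ennreal_le_iff2)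
      then have "distr_fun f s \<le> distr_fun f s'"
        unfolding distr_fun_def by (intro emeasure_mono superlevel_measurable[OF f]) auto
      also have "\<dots> \<le> ennreal u" by (rule s'(2))
      finally show False using d \<open>ennreal u < ennreal d\<close> by (auto dest: leD order_trans)
    qed
  qed
  have "ennreal (s powr q * (d powr (q / p) / (q / p))) = (\<integral>\<^sup>+u. ennreal (s powr q * u powr (q / p - 1)) * indicator {0..d} u \<partial>lborel)"
    using p q d by (intro nn_integral_powr_interval[symmetric]) auto
  also have "\<dots> \<le> (\<integral>\<^sup>+u\<in>{0<..}. epowr (ennreal (u powr (1 / p)) * rearr f u) q / ennreal u \<partial>lborel)"
  proof (rule nn_integral_mono_AE)
    show "AE u in lborel. ennreal (s powr q * u powr (q / p - 1)) * indicator {0..d} u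
       \<le> epowr (ennreal (u powr (1 / p)) * rearr f u) q / ennreal u * indicator {0<..} u"
      using AE_lborel_singleton[of 0] AE_lborel_singleton[of d]
    proof eventually_elim
      case (elim u)
      show ?case
      proof (cases "0 < u \<and> u < d")
        case True
        have "ennreal (s powr q * u powr (q / p - 1)) = ennreal (s powr q * u powr (q / p)) / ennreal u"
          using True by (simp add: divide_ennreal powr_diff)
        also have "ennreal (s powr q * u powr (q / p)) = epowr (ennreal (u powr (1 / p)) * ennreal s) q"
          using s True by (simp flip: ennreal_mult add: powr_mult powr_powr mult.commute)
        also have "\<dots> \<le> epowr (ennreal (u powr (1 / p)) * rearr f u) q"
          using True r[of u] q by (intro epowr_mono mult_left_mono) auto
        finally show ?thesis using True by (simp add: divide_right_mono_ennreal)
      qed (use elim in \<open>auto simp: indicator_def\<close>)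
    qed
  qed
  finally have "epowr (ennreal (s powr q * (d powr (q / p) / (q / p)))) (1 / q) \<le> lorentz_norm p q f"
    unfolding lorentz_norm_def using q by (intro epowr_mono) auto
  moreover have "epowr (ennreal (s powr q * (d powr (q / p) / (q / p)))) (1 / q) = ennreal ((p / q) powr (1 / q) * s * d powr (1 / p))"
    using p q d s by (simp add: powr_mult powr_divide powr_powr mult_ac)
  ultimately show ?thesis by simp
qed

text \<open>Contrapositive of the weak type bound: if the distribution function exceeded the claimed
  value, some finite \<open>d\<close> strictly between the two would violate
  \<open>lorentz_norm_weak\<close>.\<close>

lemma distr_fun_le:
  fixes f :: "('n::finite) cfun"
  assumes f: "f \<in> borel_measurable lebesgue" and p: "0 < p" and q: "0 < q"
    and s: "0 < s" and N: "0 \<le> N" "lorentz_norm p q f \<le> ennreal N"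
  shows "distr_fun f s \<le> ennreal (((q / p) powr (1 / q) * N / s) powr p)"
proof (rule ccontr)
  let ?X = "((q / p) powr (1 / q) * N / s) powr p"
  assume "\<not> distr_fun f s \<le> ennreal ?X"
  then have "ennreal ?X < distr_fun f s" by simp
  from dense[OF this] obtain y where y: "ennreal ?X < y" "y < distr_fun f s" by blast
  then have "y < top" by (meson less_le_trans top_greatest)
  then obtain d where d: "y = ennreal d" "0 \<le> d" by (cases y) auto
  then have Xd: "?X < d" using y by (simp add: ennreal_less_iff)
  then have d0: "0 < d" using powr_ge_zero[of _ p] by (meson le_less_trans)
  have "ennreal ((p / q) powr (1 / q) * s * d powr (1 / p)) \<le> ennreal N"
    using lorentz_norm_weak[OF f p q s d(2)] y d N by (meson less_imp_le order_trans)
  then have a: "(p / q) powr (1 / q) * s * d powr (1 / p) \<le> N" using N by (simp add: ennreal_le_iff)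
  have one: "(p / q) powr (1 / q) * (q / p) powr (1 / q) = 1"
    using p q by (simp flip: powr_mult)
  have "s * d powr (1 / p) \<le> (q / p) powr (1 / q) * N"
  proof -
    have "s * d powr (1 / p) = ((p / q) powr (1 / q) * (q / p) powr (1 / q)) * (s * d powr (1 / p))"
      by (simp only: one mult_1)
    also have "\<dots> = (q / p) powr (1 / q) * ((p / q) powr (1 / q) * s * d powr (1 / p))"
      by (simp only: mult_ac)
    also have "\<dots> \<le> (q / p) powr (1 / q) * N" using a by (intro mult_left_mono) auto
    finally show ?thesis .
  qed
  then have "d powr (1 / p) \<le> (q / p) powr (1 / q) * N / s" using s by (simp add: field_simps)
  then have "(d powr (1 / p)) powr p \<le> ?X" using p by (intro powr_mono2) auto
  with Xd p d0 show False by (simp add: powr_powr)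
qed

text \<open>The constant results from splitting \<open>\<bar>f\<bar>\<close> into the layers \<open>2\<^sup>k s\<^sub>0 < \<bar>f\<bar>\<close> and inserting the weak type
  bound of \<open>distr_fun_le\<close>.\<close>

definition lorentz_L1_const :: "real \<Rightarrow> real \<Rightarrow> real" where
  "lorentz_L1_const p q = (q / p) powr (1 / q) * (1 + 2 / (1 - 2 powr (1 - p)))"

lemma lorentz_L1_const_pos: "1 < p \<Longrightarrow> 0 < q \<Longrightarrow> 0 < lorentz_L1_const p q"
proof -
  assume "1 < p" "0 < q"
  moreover from this have "2 powr (1 - p) < (1::real)" by (simp add: powr_less_one)
  ultimately show ?thesis unfolding lorentz_L1_const_def by (intro mult_pos_pos add_pos_nonneg) auto
qed

lemma nn_integral_le_lorentz_aux:
  fixes f :: "('n::finite) cfun"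
  assumes f[measurable]: "f \<in> borel_measurable lebesgue" and p: "1 < p" and q: "0 < q"
    and N: "0 < N" "lorentz_norm p q f \<le> ennreal N" and S: "S \<in> lmeasurable" and m0: "0 < measure lebesgue S"
  shows "(\<integral>\<^sup>+x\<in>S. ennreal (cmod (f x)) \<partial>lebesgue)
    \<le> ennreal (lorentz_L1_const p q * measure lebesgue S powr (1 - 1 / p) * N)"
proof -
  let ?m = "measure lebesgue S"
  define N' where "N' = (q / p) powr (1 / q) * N"
  \<comment> \<open>The height that balances the two contributions: \<open>s0\<close> times the
    measure of \<open>S\<close>, and the sum over the layers above \<open>s0\<close>, are both
    multiples of the same power of the measure.\<close>
  define s0 where "s0 = N' * ?m powr (- 1 / p)"
  have N': "0 < N'" using p q N by (simp add: N'_def)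
  have s0: "0 < s0" using N' m0 by (simp add: s0_def)
  have [measurable]: "S \<in> sets lebesgue" using S by auto
  \<comment> \<open>From one layer to the next the height doubles while the bound on its measure
    shrinks by 2^-p; the ratio is below 1 because p > 1.\<close>
  define \<rho> where "\<rho> = 2 powr (1 - p)"
  have \<rho>: "0 < \<rho>" "\<rho> < 1" using p by (auto simp: \<rho>_def powr_less_one)
  have pw: "ennreal (cmod (f x)) * indicator S x \<le> ennreal s0 * indicator S x +
      (\<Sum>k. ennreal (2 ^ (k + 1) * s0) * indicator {x. 2 ^ k * s0 < cmod (f x)} x)" for x
  proof (cases "cmod (f x) \<le> s0")
    case True
    then show ?thesis by (intro add_increasing2 mult_right_mono ennreal_leI) auto
  next
    case False
    obtain n :: nat where "cmod (f x) / s0 < 2 ^ n" using real_arch_pow[of 2] by auto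
    then have ex: "cmod (f x) \<le> 2 ^ n * s0" using s0 by (simp add: field_simps)
    \<comment> \<open>Minimality of this level puts |f x| between \<open>2 ^ k * s0\<close> and
      \<open>2 ^ (k + 1) * s0\<close>, so a single term of the series dominates it.\<close>
    define n where "n = (LEAST n. cmod (f x) \<le> 2 ^ n * s0)"
    have n: "cmod (f x) \<le> 2 ^ n * s0" unfolding n_def using ex by (rule LeastI)
    with False obtain k where k: "n = Suc k" by (cases n) auto
    then have "\<not> cmod (f x) \<le> 2 ^ k * s0" using not_less_Least[of k] unfolding n_def by (metis lessI)
    then have "ennreal (cmod (f x)) \<le> (\<Sum>k\<in>{k}. ennreal (2 ^ (k + 1) * s0) * indicator {x. 2 ^ k * s0 < cmod (f x)} x)"
      using n k by (auto intro: ennreal_leI)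
    also have "\<dots> \<le> (\<Sum>k. ennreal (2 ^ (k + 1) * s0) * indicator {x. 2 ^ k * s0 < cmod (f x)} x)"
      by (rule sum_le_suminf) auto
    finally show ?thesis by (auto simp: indicator_def intro: add_increasing)
  qed
  have layer: "ennreal (2 ^ (k + 1) * s0) * distr_fun f (2 ^ k * s0) \<le> ennreal (2 * s0 powr (1 - p) * N' powr p * \<rho> ^ k)" for k
  proof -
    have "ennreal (2 ^ (k + 1) * s0) * distr_fun f (2 ^ k * s0) \<le> ennreal (2 ^ (k + 1) * s0) * ennreal ((N' / (2 ^ k * s0)) powr p)"
      unfolding N'_def using p q N s0 by (intro mult_left_mono distr_fun_le f) auto
    also have "\<dots> = ennreal (2 ^ (k + 1) * s0 * (N' / (2 ^ k * s0)) powr p)"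
      using s0 by (simp add: ennreal_mult)
    also have "2 ^ (k + 1) * s0 * (N' / (2 ^ k * s0)) powr p = 2 * s0 powr (1 - p) * N' powr p * \<rho> ^ k"
    proof -
      have "\<rho> ^ k = 2 powr (real k * (1 - p))" using \<rho> by (simp add: \<rho>_def powr_power mult.commute)
      also have "\<dots> = 2 ^ k / (2 ^ k) powr p"
        by (simp add: right_diff_distrib powr_diff powr_realpow[symmetric] powr_powr)
      finally have r: "\<rho> ^ k = 2 ^ k / (2 ^ k) powr p" .
      show ?thesis unfolding r using s0 N' by (simp add: powr_divide powr_mult powr_diff mult_ac)
    qed
    finally show ?thesis .
  qed
  have "(\<integral>\<^sup>+x\<in>S. ennreal (cmod (f x)) \<partial>lebesgue) \<le> (\<integral>\<^sup>+x. ennreal s0 * indicator S x +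
      (\<Sum>k. ennreal (2 ^ (k + 1) * s0) * indicator {x. 2 ^ k * s0 < cmod (f x)} x) \<partial>lebesgue)"
    by (rule nn_integral_mono) (rule pw)
  also have "\<dots> = ennreal s0 * emeasure lebesgue S + (\<Sum>k. ennreal (2 ^ (k + 1) * s0) * distr_fun f (2 ^ k * s0))"
  proof -
    have [measurable]: "{x. 2 ^ k * s0 < cmod (f x)} \<in> sets lebesgue" for k by (rule superlevel_measurable[OF f])
    have "(\<integral>\<^sup>+x. ennreal s0 * indicator S x + (\<Sum>k. ennreal (2 ^ (k + 1) * s0) * indicator {x. 2 ^ k * s0 < cmod (f x)} x) \<partial>lebesgue)
      = (\<integral>\<^sup>+x. ennreal s0 * indicator S x \<partial>lebesgue) + (\<integral>\<^sup>+x. (\<Sum>k. ennreal (2 ^ (k + 1) * s0) * indicator {x. 2 ^ k * s0 < cmod (f x)} x) \<partial>lebesgue)"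
      by (rule nn_integral_add) measurable
    also have "(\<integral>\<^sup>+x. ennreal s0 * indicator S x \<partial>lebesgue) = ennreal s0 * emeasure lebesgue S"
      by (rule nn_integral_cmult_indicator) measurable
    also have "(\<integral>\<^sup>+x. (\<Sum>k. ennreal (2 ^ (k + 1) * s0) * indicator {x. 2 ^ k * s0 < cmod (f x)} x) \<partial>lebesgue)
       = (\<Sum>k. (\<integral>\<^sup>+x. ennreal (2 ^ (k + 1) * s0) * indicator {x. 2 ^ k * s0 < cmod (f x)} x \<partial>lebesgue))"
      by (rule nn_integral_suminf) measurable
    also have "\<dots> = (\<Sum>k. ennreal (2 ^ (k + 1) * s0) * distr_fun f (2 ^ k * s0))"
      unfolding distr_fun_def by (subst nn_integral_cmult_indicator) auto
    finally show ?thesis .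
  qed
  also have "\<dots> \<le> ennreal s0 * ennreal ?m + (\<Sum>k. ennreal (2 * s0 powr (1 - p) * N' powr p * \<rho> ^ k))"
    unfolding emeasure_lmeasurable[OF S] by (intro add_mono suminf_le layer) auto
  also have "(\<Sum>k. ennreal (2 * s0 powr (1 - p) * N' powr p * \<rho> ^ k)) = ennreal (2 * s0 powr (1 - p) * N' powr p * (1 / (1 - \<rho>)))"
    using \<rho> s0 N' by (intro suminf_ennreal_eq sums_mult geometric_sums) auto
  also have "ennreal s0 * ennreal ?m + \<dots> = ennreal (s0 * ?m + 2 * s0 powr (1 - p) * N' powr p * (1 / (1 - \<rho>)))"
    using s0 m0 \<rho> by (simp add: ennreal_mult ennreal_plus)
  also have "s0 * ?m + 2 * s0 powr (1 - p) * N' powr p * (1 / (1 - \<rho>)) = lorentz_L1_const p q * ?m powr (1 - 1 / p) * N"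
  proof -
    have a: "s0 * ?m = N' * ?m powr (1 - 1 / p)"
      using m0 by (simp add: s0_def powr_diff powr_minus divide_inverse)
    have "- 1 / p * (1 - p) = 1 - 1 / p" using p by (simp add: field_simps)
    then have "s0 powr (1 - p) = N' powr (1 - p) * ?m powr (1 - 1 / p)"
      unfolding s0_def using N' m0 by (simp only: powr_mult powr_powr less_imp_le powr_ge_zero)
    moreover have "N' powr (1 - p) * N' powr p = N'" using N' by (simp flip: powr_add)
    ultimately have b: "s0 powr (1 - p) * N' powr p = N' * ?m powr (1 - 1 / p)"
      by (metis mult.assoc mult.commute)
    have "s0 * ?m + 2 * s0 powr (1 - p) * N' powr p * (1 / (1 - \<rho>)) = s0 * ?m + (s0 powr (1 - p) * N' powr p) * (2 / (1 - \<rho>))"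
      by simp
    also have "\<dots> = N' * (1 + 2 / (1 - \<rho>)) * ?m powr (1 - 1 / p)"
      unfolding a b by (simp add: algebra_simps)
    finally show ?thesis by (simp add: lorentz_L1_const_def N'_def \<rho>_def)
  qed
  finally show ?thesis .
qed

lemma nn_integral_le_lorentz:
  fixes f :: "('n::finite) cfun"
  assumes f[measurable]: "f \<in> borel_measurable lebesgue" and p: "1 < p" and q: "0 < q" and S: "S \<in> lmeasurable"
  shows "(\<integral>\<^sup>+x\<in>S. ennreal (cmod (f x)) \<partial>lebesgue)
    \<le> ennreal (lorentz_L1_const p q * measure lebesgue S powr (1 - 1 / p)) * lorentz_norm p q f"
proof (cases "measure lebesgue S = 0")
  case True
  then have "S \<in> null_sets lebesgue" using emeasure_lmeasurable[OF S] S by (intro null_setsI) auto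
  then have "AE x in lebesgue. x \<notin> S" by (rule AE_not_in)
  then have "AE x in lebesgue. ennreal (cmod (f x)) * indicator S x = 0" by eventually_elim simp
  then have "(\<integral>\<^sup>+x\<in>S. ennreal (cmod (f x)) \<partial>lebesgue) = (\<integral>\<^sup>+(x::real^'n). 0 \<partial>lebesgue)"
    by (rule nn_integral_cong_AE)
  then show ?thesis by simp
next
  case False
  then have m0: "0 < measure lebesgue S" by (simp add: zero_less_measure_iff)
  define D where "D = lorentz_L1_const p q * measure lebesgue S powr (1 - 1 / p)"
  have D: "0 < D" using m0 p q by (simp add: D_def lorentz_L1_const_pos)
  show ?thesis
  proof (cases "lorentz_norm p q f")
    case top
    then show ?thesis using D unfolding D_def[symmetric] by (simp add: ennreal_mult_top)
  next
    case (real N)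
    show ?thesis
    proof (rule ennreal_le_epsilon)
      \<comment> \<open>The auxiliary lemma wants a positive bound on the norm, which may vanish;
        raising \<open>N\<close> by \<open>e / D\<close> costs exactly \<open>e\<close>.\<close>
      fix e :: real assume e: "0 < e"
      have "(\<integral>\<^sup>+x\<in>S. ennreal (cmod (f x)) \<partial>lebesgue) \<le> ennreal (D * (N + e / D))"
        unfolding D_def
        by (rule nn_integral_le_lorentz_aux[OF f p q _ _ S m0])
          (use real e D in \<open>auto simp: D_def[symmetric] intro!: ennreal_leI add_nonneg_pos\<close>)
      also have "\<dots> = ennreal D * lorentz_norm p q f + ennreal e"
        using D e real by (simp add: distrib_left ennreal_plus ennreal_mult)
      finally show "(\<integral>\<^sup>+x\<in>S. ennreal (cmod (f x)) \<partial>lebesgue) \<le>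
          ennreal (lorentz_L1_const p q * measure lebesgue S powr (1 - 1 / p)) * lorentz_norm p q f + ennreal e"
        unfolding D_def .
    qed
  qed
qed

section \<open>Cubes\<close>

lemma cube_eq_cbox: "cube c l = cbox (\<chi> i. c $ i - l / 2) (\<chi> i. c $ i + l / 2)"
proof -
  have "\<bar>x $ i - c $ i\<bar> \<le> l / 2 \<longleftrightarrow> c $ i - l / 2 \<le> x $ i \<and> x $ i \<le> c $ i + l / 2" for x i
    by (simp only: abs_le_iff) linarith
  then show ?thesis by (simp add: cube_def set_eq_iff mem_box_cart)
qed

lemma cube_compact: "compact (cube c l)"
  by (simp add: cube_eq_cbox)

lemma cube_lmeasurable [simp]: "cube c l \<in> lmeasurable"
  by (simp add: cube_eq_cbox)

lemma cube_sets [measurable]: "cube c l \<in> sets lebesgue"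
  by (simp add: cube_eq_cbox)

lemma measure_cube:
  assumes "0 \<le> l" shows "measure lebesgue (cube (c :: real ^ 'n) l) = l ^ CARD('n)"
proof -
  have ne: "cbox (\<chi> i. c $ i - l / 2) (\<chi> i. c $ i + l / 2) \<noteq> {}"
    using assms by (auto simp: interval_eq_empty_cart not_less)
  show ?thesis unfolding cube_eq_cbox using content_cbox_cart[OF ne] by simp
qed

lemma dyadic_cube_bounds:
  fixes m :: "int ^ 'n" and j :: int
  defines "lo \<equiv> ((\<chi> i. 2 powi (- j) * of_int (m $ i)) :: real ^ 'n)"
    and "hi \<equiv> ((\<chi> i. 2 powi (- j) * (of_int (m $ i) + 1)) :: real ^ 'n)"
  shows "box lo hi \<subseteq> dyadic_cube j m" "dyadic_cube j m \<subseteq> cbox lo hi"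
  by (auto simp: dyadic_cube_def mem_box_cart lo_def hi_def less_imp_le)

text \<open>The half-open cube lies between an open and a closed box that differ only by negligible
  faces.\<close>

lemma dyadic_cube_measure:
  fixes m :: "int ^ 'n"
  shows "dyadic_cube j m \<in> lmeasurable"
    and "measure lebesgue (dyadic_cube j m) = 2 powr (- real CARD('n) * of_int j)"
proof -
  define lo where "lo = ((\<chi> i. 2 powi (- j) * of_int (m $ i)) :: real ^ 'n)"
  define hi where "hi = ((\<chi> i. 2 powi (- j) * (of_int (m $ i) + 1)) :: real ^ 'n)"
  note sub = dyadic_cube_bounds[of j m, folded lo_def hi_def]
  have "negligible (cbox lo hi - box lo hi)" by (rule negligible_frontier_interval)
  then have n: "negligible (cbox lo hi - dyadic_cube j m \<union> (dyadic_cube j m - cbox lo hi))"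
    by (rule negligible_subset) (use sub in blast)
  show "dyadic_cube j m \<in> lmeasurable"
    using lmeasurable_negligible_symdiff[OF _ n] by simp
  have "measure lebesgue (dyadic_cube j m) = measure lebesgue (cbox lo hi)"
    using measure_negligible_symdiff[of "cbox lo hi" "dyadic_cube j m"] n by simp
  also have "\<dots> = (\<Prod>i\<in>(UNIV::'n set). hi $ i - lo $ i)"
  proof -
    have "cbox lo hi \<noteq> {}" by (auto simp: interval_eq_empty_cart not_less lo_def hi_def)
    then show ?thesis using content_cbox_cart by simp
  qed
  also have "\<dots> = (2 powi (- j)) ^ CARD('n)"
    by (simp add: lo_def hi_def algebra_simps)
  also have "\<dots> = 2 powr (- real CARD('n) * of_int j)"
    by (simp add: powr_real_of_int'[symmetric] powr_power mult.commute)
  finally show "measure lebesgue (dyadic_cube j m) = 2 powr (- real CARD('n) * of_int j)" .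
qed

lemma dyadic_cube_unique: "x \<in> dyadic_cube j m \<Longrightarrow> m = (\<chi> i. \<lfloor>2 powi j * x $ i\<rfloor>)"
proof -
  assume x: "x \<in> dyadic_cube j m"
  have "m $ i = \<lfloor>2 powi j * x $ i\<rfloor>" for i
  proof -
    have "2 powi (- j) * of_int (m $ i) \<le> x $ i" "x $ i < 2 powi (- j) * (of_int (m $ i) + 1)"
      using x by (auto simp: dyadic_cube_def)
    then have "of_int (m $ i) \<le> 2 powi j * x $ i \<and> 2 powi j * x $ i < of_int (m $ i) + 1"
      by (simp add: power_int_minus field_simps)
    then show ?thesis by linarith
  qed
  then show ?thesis by (simp add: vec_eq_iff)
qed

lemma dyadic_cubes_disjoint: "m \<noteq> m' \<Longrightarrow> dyadic_cube j m \<inter> dyadic_cube j m' = {}"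
  using dyadic_cube_unique by blast

section \<open>Summation over dyadic cubes\<close>

text \<open>On either side of \<open>j0\<close> the distance to \<open>j0\<close> is injective, so
  each half is a subsum of one geometric series.\<close>

lemma sum_two_sided_geometric:
  fixes \<rho> :: real and J :: "int set"
  assumes \<rho>: "0 < \<rho>" "\<rho> < 1" and "finite J"
  shows "(\<Sum>j\<in>J. \<rho> ^ nat \<bar>j - j0\<bar>) \<le> 2 / (1 - \<rho>)"
proof -
  have *: "(\<Sum>j\<in>I. \<rho> ^ nat \<bar>j - j0\<bar>) \<le> 1 / (1 - \<rho>)" if "inj_on (\<lambda>j. nat \<bar>j - j0\<bar>) I" "finite I" for I
  proof -
    have "(\<Sum>j\<in>I. \<rho> ^ nat \<bar>j - j0\<bar>) = (\<Sum>k\<in>(\<lambda>j. nat \<bar>j - j0\<bar>) ` I. \<rho> ^ k)"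
      using that(1) by (simp add: sum.reindex)
    also have "\<dots> \<le> (\<Sum>k. \<rho> ^ k)"
      using \<rho> that(2) by (intro sum_le_suminf summable_geometric) auto
    also have "\<dots> = 1 / (1 - \<rho>)" using \<rho> by (intro suminf_geometric) auto
    finally show ?thesis .
  qed
  have "(\<Sum>j\<in>J. \<rho> ^ nat \<bar>j - j0\<bar>) = (\<Sum>j\<in>J \<inter> {j0..}. \<rho> ^ nat \<bar>j - j0\<bar>) + (\<Sum>j\<in>J - {j0..}. \<rho> ^ nat \<bar>j - j0\<bar>)"
    using assms(3) by (rule sum.Int_Diff)
  also have "\<dots> \<le> 1 / (1 - \<rho>) + 1 / (1 - \<rho>)"
    using assms(3) by (intro add_mono *) (auto simp: inj_on_def)
  finally show ?thesis by simp
qed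

text \<open>Write a for the measure of S and D for that of a cube of generation j. In the power s/p
  of each intersection, one factor is summed to at most a and the others are bounded by min(a, D).
  For D \<le> a this leaves a^(s/t) (D/a)^(s/t - 1), for D \<ge> a it leaves a^(s/t) (a/D)^(s/p -
  s/t). Strictness in p < t < s makes both exponents positive, hence geometric decay away from the
  scale of S.\<close>

lemma dyadic_scale_sum:
  fixes S :: "(real ^ 'n) set" and p t s :: real and j :: int
  assumes S: "S \<in> lmeasurable" and a: "0 < measure lebesgue S" and e: "0 < p" "p < t" "t < s" and K: "finite K"
  defines "\<gamma> \<equiv> min (s / t - 1) (s / p - s / t)"
  shows "(\<Sum>k\<in>K. (measure lebesgue (S \<inter> dyadic_cube j k) powr (1 / p) *
             measure lebesgue (dyadic_cube j k) powr (1 / t - 1 / p)) powr s)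
    \<le> measure lebesgue S powr (s / t) * 2 powr (- \<gamma> * \<bar>real CARD('n) * j + log 2 (measure lebesgue S)\<bar>)"
proof -
  let ?a = "measure lebesgue S"
  define D where "D = 2 powr (- real CARD('n) * of_int j)"
  have D: "0 < D" by (simp add: D_def)
  let ?m = "\<lambda>k. measure lebesgue (S \<inter> dyadic_cube j k)"
  have QD: "measure lebesgue (dyadic_cube j k) = D" for k :: "int ^ 'n"
    unfolding D_def by (rule dyadic_cube_measure)
  have tp: "0 < t" "0 < s" using e by auto
  have sp: "1 < s / p" using e by (simp add: field_simps)
  have Qm: "dyadic_cube j k \<in> lmeasurable" for k :: "int ^ 'n" by (rule dyadic_cube_measure)
  have int: "S \<inter> dyadic_cube j k \<in> lmeasurable" for k using S Qm by (rule fmeasurable.Int)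
  have mb: "?m k \<le> min ?a D" for k
  proof -
    have "?m k \<le> ?a" using S Qm[of k] by (intro measure_mono_fmeasurable) auto
    moreover have "?m k \<le> measure lebesgue (dyadic_cube j k)" using S Qm[of k] by (intro measure_mono_fmeasurable) auto
    ultimately show ?thesis by (simp add: D_def dyadic_cube_measure)
  qed
  have sm: "(\<Sum>k\<in>K. ?m k) \<le> ?a"
  proof -
    have "(\<Sum>k\<in>K. ?m k) = measure lebesgue (\<Union>k\<in>K. S \<inter> dyadic_cube j k)"
      using K int dyadic_cubes_disjoint
      by (intro measure_finite_Union[symmetric])
        (auto simp: disjoint_family_on_def simp del: emeasure_completion dest: fmeasurableD2, blast)
    also have "\<dots> \<le> ?a"
      using S K int by (intro measure_mono_fmeasurable sets.finite_UN) (auto intro: fmeasurableD)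
    finally show ?thesis .
  qed
  have "(\<Sum>k\<in>K. (?m k powr (1 / p) * measure lebesgue (dyadic_cube j k) powr (1 / t - 1 / p)) powr s)
    \<le> (\<Sum>k\<in>K. ?m k * (min ?a D powr (s / p - 1) * D powr (s / t - s / p)))"
  proof (rule sum_mono)
    fix k
    have "(?m k powr (1 / p) * measure lebesgue (dyadic_cube j k) powr (1 / t - 1 / p)) powr s
        = ?m k powr (s / p) * D powr (s / t - s / p)"
      unfolding QD by (simp add: powr_mult powr_powr left_diff_distrib)
    also have "?m k powr (s / p) = ?m k * ?m k powr (s / p - 1)"
      by (cases "?m k = 0") (simp_all add: powr_diff zero_less_measure_iff)
    also have "\<dots> * D powr (s / t - s / p) \<le> ?m k * min ?a D powr (s / p - 1) * D powr (s / t - s / p)"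
      using mb[of k] sp by (intro mult_right_mono mult_left_mono powr_mono2) auto
    finally show "(?m k powr (1 / p) * measure lebesgue (dyadic_cube j k) powr (1 / t - 1 / p)) powr s
       \<le> ?m k * (min ?a D powr (s / p - 1) * D powr (s / t - s / p))" by (simp only: mult.assoc)
  qed
  also have "\<dots> = (\<Sum>k\<in>K. ?m k) * (min ?a D powr (s / p - 1) * D powr (s / t - s / p))"
    by (rule sum_distrib_right[symmetric])
  also have "\<dots> \<le> ?a * (min ?a D powr (s / p - 1) * D powr (s / t - s / p))"
    using sm by (intro mult_right_mono) auto
  also have "\<dots> \<le> ?a powr (s / t) * 2 powr (- \<gamma> * \<bar>real CARD('n) * j + log 2 ?a\<bar>)"
  proof -
    \<comment> \<open>In logarithms to base 2 the exponents are linear on either side of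
      \<open>L = M\<close>; the two cases account for the two entries of the minimum
      \<gamma>.\<close>
    define L where "L = log 2 ?a"
    define M where "M = - real CARD('n) * of_int j"
    have aL: "?a = 2 powr L" using a by (simp add: L_def)
    have DM: "D = 2 powr M" by (simp add: D_def M_def)
    have n: "real CARD('n) * j + log 2 ?a = L - M" by (simp add: L_def M_def)
    have "?a * (min ?a D powr (s / p - 1) * D powr (s / t - s / p)) =
        2 powr (L + min L M * (s / p - 1) + M * (s / t - s / p))"
    proof -
      have "min ?a D = 2 powr (min L M)" unfolding aL DM by (auto simp: min_def)
      then show ?thesis unfolding DM by (simp add: powr_powr powr_add aL)
    qed
    also have "\<dots> \<le> 2 powr (L * (s / t) + (- \<gamma> * \<bar>L - M\<bar>))"
    proof (intro powr_mono)
      define u v where "u = s / t" and "v = s / p"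
      have "L + min L M * (v - 1) + M * (u - v) \<le> L * u + (- \<gamma> * \<bar>L - M\<bar>)"
      proof (cases "L \<le> M")
        case True
        have "\<gamma> * (M - L) \<le> (v - u) * (M - L)"
          using True unfolding \<gamma>_def u_def v_def by (intro mult_right_mono) auto
        then show ?thesis using True by (simp add: min_def algebra_simps)
      next
        case False
        have "\<gamma> * (L - M) \<le> (u - 1) * (L - M)"
          using False unfolding \<gamma>_def u_def by (intro mult_right_mono) auto
        then show ?thesis using False by (simp add: min_def algebra_simps)
      qed
      then show "L + min L M * (s / p - 1) + M * (s / t - s / p) \<le> L * (s / t) + (- \<gamma> * \<bar>L - M\<bar>)"
        by (simp only: u_def v_def)
    qed simp
    also have "\<dots> = ?a powr (s / t) * 2 powr (- \<gamma> * \<bar>L - M\<bar>)"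
      unfolding powr_add aL powr_powr by simp
    finally show ?thesis unfolding n .
  qed
  finally show ?thesis .
qed

text \<open>The fraction is the two-sided geometric sum with ratio 2^-\<gamma>; the factor
  \<open>2 powr \<gamma>\<close> pays for rounding the critical scale to an integer
  generation.\<close>

definition dyadic_const :: "real \<Rightarrow> real \<Rightarrow> real \<Rightarrow> real" where
  "dyadic_const p t s = (let \<gamma> = min (s / t - 1) (s / p - s / t) in 2 powr \<gamma> * (2 / (1 - 2 powr (- \<gamma>))))"

lemma dyadic_exponent_pos:
  assumes "0 < p" "p < t" "t < (s::real)"
  shows "0 < min (s / t - 1) (s / p - s / t)"
  using assms by (auto simp: field_simps)

lemma dyadic_const_pos: "0 < p \<Longrightarrow> p < t \<Longrightarrow> t < s \<Longrightarrow> 0 < dyadic_const p t s"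
  using dyadic_exponent_pos[of p t s] by (simp add: dyadic_const_def Let_def powr_less_one)

lemma dyadic_sum_le:
  fixes S :: "(real ^ 'n) set" and p t s :: real
  assumes S: "S \<in> lmeasurable" and a: "0 < measure lebesgue S" and e: "0 < p" "p < t" "t < s" and F: "finite F"
  shows "(\<Sum>(j, k)\<in>F. (measure lebesgue (S \<inter> dyadic_cube j k) powr (1 / p) *
             measure lebesgue (dyadic_cube j k) powr (1 / t - 1 / p)) powr s)
    \<le> dyadic_const p t s * measure lebesgue S powr (s / t)"
proof -
  let ?a = "measure lebesgue S"
  define \<gamma> where "\<gamma> = min (s / t - 1) (s / p - s / t)"
  have \<gamma>: "0 < \<gamma>" unfolding \<gamma>_def using e by (rule dyadic_exponent_pos)
  define L where "L = log 2 ?a"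
  define \<rho> where "\<rho> = 2 powr (- \<gamma>)"
  have \<rho>: "0 < \<rho>" "\<rho> < 1" using \<gamma> by (auto simp: \<rho>_def powr_less_one)
  define n where "n = real CARD('n)"
  have n: "1 \<le> n" by (simp add: n_def Suc_leI)
  \<comment> \<open>The generation whose cubes are about as large as \<open>S\<close>, that is n j +
    L = 0 up to rounding. Rounding changes the distance of \<open>j\<close> to it by at most
    1.\<close>
  define j0 where "j0 = \<lfloor>- L / n\<rfloor>"
  let ?f = "\<lambda>j k. (measure lebesgue (S \<inter> dyadic_cube j k) powr (1 / p) *
             measure lebesgue (dyadic_cube j k) powr (1 / t - 1 / p)) powr s"
  have "(\<Sum>(j, k)\<in>F. ?f j k) \<le> (\<Sum>(j, k)\<in>fst ` F \<times> snd ` F. ?f j k)"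
    using F by (intro sum_mono2) (auto simp: image_iff, force+)
  also have "\<dots> = (\<Sum>j\<in>fst ` F. \<Sum>k\<in>snd ` F. ?f j k)"
    by (rule sum.cartesian_product[symmetric])
  also have "\<dots> \<le> (\<Sum>j\<in>fst ` F. ?a powr (s / t) * (2 powr \<gamma> * \<rho> ^ nat \<bar>j - j0\<bar>))"
  proof (rule sum_mono)
    fix j
    have "(\<Sum>k\<in>snd ` F. ?f j k) \<le> ?a powr (s / t) * 2 powr (- \<gamma> * \<bar>n * j + L\<bar>)"
      unfolding \<gamma>_def n_def L_def using F by (intro dyadic_scale_sum S a e) auto
    also have "2 powr (- \<gamma> * \<bar>n * j + L\<bar>) \<le> 2 powr (\<gamma> + (- \<gamma> * \<bar>of_int (j - j0)\<bar>))"
    proof (intro powr_mono)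
      have "\<bar>of_int (j - j0)\<bar> - 1 \<le> \<bar>of_int j - (- L / n)\<bar>"
        unfolding j0_def by linarith
      also have "\<dots> \<le> n * \<bar>of_int j - (- L / n)\<bar>" using n by (simp add: mult_le_cancel_right1)
      also have "\<dots> = \<bar>n * j + L\<bar>"
      proof -
        have "n * \<bar>of_int j - (- L / n)\<bar> = \<bar>n * (of_int j - (- L / n))\<bar>"
          using n by (simp add: abs_mult)
        also have "n * (of_int j - (- L / n)) = n * j + L" using n by (simp add: field_simps)
        finally show ?thesis .
      qed
      finally have "\<gamma> * (\<bar>of_int (j - j0)\<bar> - 1) \<le> \<gamma> * \<bar>n * j + L\<bar>" using \<gamma> by (intro mult_left_mono) auto
      then show "- \<gamma> * \<bar>n * j + L\<bar> \<le> \<gamma> + (- \<gamma> * \<bar>of_int (j - j0)\<bar>)" by (simp add: algebra_simps)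
    qed simp
    also have "\<dots> = 2 powr \<gamma> * \<rho> ^ nat \<bar>j - j0\<bar>"
    proof -
      have "\<rho> ^ nat \<bar>j - j0\<bar> = 2 powr (- \<gamma> * real (nat \<bar>j - j0\<bar>))"
        unfolding \<rho>_def by (simp add: powr_power mult.commute)
      also have "real (nat \<bar>j - j0\<bar>) = \<bar>of_int (j - j0)\<bar>" by simp
      finally show ?thesis by (simp only: powr_add)
    qed
    finally show "(\<Sum>k\<in>snd ` F. ?f j k) \<le> ?a powr (s / t) * (2 powr \<gamma> * \<rho> ^ nat \<bar>j - j0\<bar>)"
      by (simp add: mult_left_mono)
  qed
  also have "\<dots> = ?a powr (s / t) * (2 powr \<gamma> * (\<Sum>j\<in>fst ` F. \<rho> ^ nat \<bar>j - j0\<bar>))"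
    by (simp add: sum_distrib_left)
  also have "\<dots> \<le> ?a powr (s / t) * (2 powr \<gamma> * (2 / (1 - \<rho>)))"
    using F \<rho> by (intro mult_left_mono sum_two_sided_geometric) auto
  finally show ?thesis
    by (simp add: dyadic_const_def Let_def \<gamma>_def \<rho>_def mult.commute)
qed

text \<open>The counterpart for r = \<infinity>, where no summation occurs and p = t is allowed: of
  the power 1/p of the intersection, the part 1/t is bounded through \<open>S\<close> and the rest
  through the dyadic cube.\<close>

lemma dyadic_term_le:
  fixes S :: "(real ^ 'n) set" and p t :: real
  assumes S: "S \<in> lmeasurable" and e: "0 < p" "p \<le> t"
  shows "measure lebesgue (S \<inter> dyadic_cube j k) powr (1 / p) *
             measure lebesgue (dyadic_cube j k) powr (1 / t - 1 / p) \<le> measure lebesgue S powr (1 / t)"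
proof -
  let ?m = "measure lebesgue (S \<inter> dyadic_cube j k)" and ?D = "measure lebesgue (dyadic_cube j k)"
  have Qm: "dyadic_cube j k \<in> lmeasurable" by (rule dyadic_cube_measure)
  have D: "0 < ?D" by (simp add: dyadic_cube_measure)
  have m1: "?m \<le> measure lebesgue S" and m2: "?m \<le> ?D"
    using S Qm by (auto intro!: measure_mono_fmeasurable)
  have ge: "0 \<le> 1 / p - 1 / t" using e by (simp add: field_simps)
  show ?thesis
  proof (cases "?m = 0")
    case False
    have "?m powr (1 / p) * ?D powr (1 / t - 1 / p) = ?m powr (1 / t) * ?m powr (1 / p - 1 / t) * ?D powr (1 / t - 1 / p)"
      by (simp flip: powr_add)
    also have "\<dots> \<le> measure lebesgue S powr (1 / t) * ?D powr (1 / p - 1 / t) * ?D powr (1 / t - 1 / p)"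
      using m1 m2 ge e by (intro mult_right_mono mult_mono powr_mono2) auto
    also have "\<dots> = measure lebesgue S powr (1 / t) * (?D powr (1 / p - 1 / t) * ?D powr (1 / t - 1 / p))"
      by (rule mult.assoc)
    also have "?D powr (1 / p - 1 / t) * ?D powr (1 / t - 1 / p) = 1"
      using D by (simp flip: powr_add)
    finally show ?thesis by simp
  qed simp
qed

section \<open>Bourgain--Morrey--Lorentz norms of bounded functions\<close>

lemma infsum_ennreal_le:
  fixes f :: "'a \<Rightarrow> ennreal"
  assumes "\<And>F. finite F \<Longrightarrow> F \<subseteq> A \<Longrightarrow> sum f F \<le> B"
  shows "infsum f A \<le> B"
  using assms by (subst nonneg_infsum_complete) (auto intro: SUP_least)

lemma sum_le_infsum_ennreal:
  fixes f :: "'a \<Rightarrow> ennreal"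
  assumes "finite F" "F \<subseteq> A"
  shows "sum f F \<le> infsum f A"
  using assms by (subst nonneg_infsum_complete) (auto intro: SUP_upper)

lemma lorentz_norm_on_bounded:
  fixes f :: "('n::finite) cfun"
  assumes "0 < p" "0 < q" "\<And>x. cmod (f x) \<le> indicator S x" "S \<in> lmeasurable" "Q \<in> lmeasurable"
  shows "lorentz_norm_on p q Q f \<le> ennreal ((p / q) powr (1 / q) * measure lebesgue (S \<inter> Q) powr (1 / p))"
proof -
  have "lorentz_norm p q (\<lambda>x. f x * indicator Q x) \<le> ennreal (1 * measure lebesgue (S \<inter> Q) powr (1 / p) * (p / q) powr (1 / q))"
  proof (rule lorentz_norm_bounded)
    show "cmod (f x * indicator Q x) \<le> 1 * indicator (S \<inter> Q) x" for x
      using assms(3)[of x] by (auto simp: indicator_def)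
  qed (use assms in \<open>auto intro: fmeasurable.Int\<close>)
  then show ?thesis by (simp add: lorentz_norm_on_def mult.commute)
qed

lemma dyadic_cubesE:
  assumes "Q \<in> dyadic_cubes" obtains j k where "Q = dyadic_cube j k"
  using assms by (auto simp: dyadic_cubes_def)

lemma M_norm_bounded_finite:
  fixes f :: "('n::finite) cfun" and p q t s :: real
  assumes e: "0 < p" "0 < q" "p < t" "t < s" and f: "\<And>x. cmod (f x) \<le> indicator S x"
    and S: "S \<in> lmeasurable" "0 < measure lebesgue S"
  shows "M_norm p q t (ereal s) f \<le>
    ennreal ((p / q) powr (1 / q) * dyadic_const p t s powr (1 / s) * measure lebesgue S powr (1 / t))"
proof -
  define c where "c = (p / q) powr (1 / q)"
  define C where "C = dyadic_const p t s * measure lebesgue S powr (s / t)"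
  let ?w = "\<lambda>Q. ennreal (measure lebesgue Q powr (s / t - s / p)) * epowr (lorentz_norm_on p q Q f) s"
  let ?v = "\<lambda>Q. (measure lebesgue (S \<inter> Q) powr (1 / p) * measure lebesgue Q powr (1 / t - 1 / p)) powr s"
  have s: "0 < s" using e by simp
  have c: "0 \<le> c" by (simp add: c_def)
  have C: "0 \<le> C" unfolding C_def using dyadic_const_pos[of p t s] e by (intro mult_nonneg_nonneg) auto
  have wv: "?w Q \<le> ennreal (c powr s * ?v Q)" if Q: "Q \<in> dyadic_cubes" for Q
  proof -
    have "Q \<in> lmeasurable" using Q dyadic_cube_measure(1) by (metis dyadic_cubesE)
    then have "lorentz_norm_on p q Q f \<le> ennreal (c * measure lebesgue (S \<inter> Q) powr (1 / p))"
      unfolding c_def using lorentz_norm_on_bounded[OF e(1,2) f S(1)] by blast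
    then have "?w Q \<le> ennreal (measure lebesgue Q powr (s / t - s / p)) * epowr (ennreal (c * measure lebesgue (S \<inter> Q) powr (1 / p))) s"
      using s by (intro mult_left_mono epowr_mono) auto
    also have "\<dots> = ennreal (c powr s * ?v Q)"
      using c by (simp add: powr_mult powr_powr left_diff_distrib right_diff_distrib mult_ac flip: ennreal_mult)
    finally show ?thesis .
  qed
  have "infsum ?w dyadic_cubes \<le> ennreal (c powr s * C)"
  proof (rule infsum_ennreal_le)
    fix F :: "(real^'n) set set" assume F: "finite F" "F \<subseteq> dyadic_cubes"
    \<comment> \<open>The norm sums over cubes as sets, \<open>dyadic_sum_le\<close> over their
      indices. An injective choice of indices for the finitely many cubes in \<open>F\<close>
      identifies the two sums.\<close>
    have "dyadic_cubes = (\<lambda>(j, k). dyadic_cube j k) ` (UNIV :: (int \<times> (int^'n)) set)"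
      by (auto simp: dyadic_cubes_def)
    then obtain G where G: "inj_on (\<lambda>(j, k). dyadic_cube j k) G" "F = (\<lambda>(j, k). dyadic_cube j k) ` (G :: (int \<times> (int^'n)) set)"
      using F(2) subset_image_inj[of F "\<lambda>(j, k). dyadic_cube j k" "UNIV :: (int \<times> (int^'n)) set"] by auto
    then have fG: "finite G" using F(1) finite_imageD by blast
    have "sum ?w F \<le> (\<Sum>Q\<in>F. ennreal (c powr s * ?v Q))"
      using wv F(2) by (intro sum_mono) auto
    also have "\<dots> = ennreal (\<Sum>Q\<in>F. c powr s * ?v Q)" by (intro sum_ennreal) auto
    also have "(\<Sum>Q\<in>F. c powr s * ?v Q) = c powr s * (\<Sum>(j, k)\<in>G. ?v (dyadic_cube j k))"
      unfolding G(2) by (subst sum.reindex[OF G(1)]) (simp add: sum_distrib_left case_prod_unfold)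
    also have "\<dots> \<le> c powr s * C"
      unfolding C_def using dyadic_sum_le[OF S e(1,3,4) fG] by (intro mult_left_mono) auto
    finally show "sum ?w F \<le> ennreal (c powr s * C)" by (simp add: ennreal_leI)
  qed
  then have "M_norm p q t (ereal s) f \<le> epowr (ennreal (c powr s * C)) (1 / s)"
    unfolding M_norm_def using s by (auto simp: Let_def intro!: epowr_mono)
  also have "\<dots> = ennreal (c * dyadic_const p t s powr (1 / s) * measure lebesgue S powr (1 / t))"
    using s c C dyadic_const_pos[of p t s] e by (simp add: powr_mult powr_powr C_def)
  finally show ?thesis by (simp add: c_def)
qed

lemma M_norm_bounded_infinite:
  fixes f :: "('n::finite) cfun" and p q t :: real
  assumes e: "0 < p" "0 < q" "p \<le> t" and f: "\<And>x. cmod (f x) \<le> indicator S x"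
    and S: "S \<in> lmeasurable"
  shows "M_norm p q t \<infinity> f \<le> ennreal ((p / q) powr (1 / q) * measure lebesgue S powr (1 / t))"
proof -
  define c where "c = (p / q) powr (1 / q)"
  have "ennreal (measure lebesgue Q powr (1 / t - 1 / p)) * lorentz_norm_on p q Q f \<le> ennreal (c * measure lebesgue S powr (1 / t))"
    if Q: "Q \<in> dyadic_cubes" for Q
  proof -
    obtain j k where jk: "Q = dyadic_cube j k" using Q by (rule dyadic_cubesE)
    then have "Q \<in> lmeasurable" using dyadic_cube_measure(1) by metis
    then have "lorentz_norm_on p q Q f \<le> ennreal (c * measure lebesgue (S \<inter> Q) powr (1 / p))"
      unfolding c_def using lorentz_norm_on_bounded[OF e(1,2) f S(1)] by blast
    then have "ennreal (measure lebesgue Q powr (1 / t - 1 / p)) * lorentz_norm_on p q Q f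
       \<le> ennreal (measure lebesgue Q powr (1 / t - 1 / p)) * ennreal (c * measure lebesgue (S \<inter> Q) powr (1 / p))"
      by (rule mult_left_mono) simp
    also have "\<dots> = ennreal (c * (measure lebesgue (S \<inter> Q) powr (1 / p) * measure lebesgue Q powr (1 / t - 1 / p)))"
      by (simp add: c_def mult_ac flip: ennreal_mult)
    also have "\<dots> \<le> ennreal (c * measure lebesgue S powr (1 / t))"
      unfolding jk using dyadic_term_le[OF S e(1,3)] by (intro ennreal_leI mult_left_mono) (auto simp: c_def)
    finally show ?thesis .
  qed
  then show ?thesis unfolding M_norm_def c_def by (auto intro: SUP_least)
qed

text \<open>Keep only the entry of \<open>Q\<close> in the sum or supremum, and undo its weight,
  which is positive because dyadic cubes are not null.\<close>

lemma lorentz_norm_on_le_M_norm: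
  fixes h :: "('n::finite) cfun"
  assumes Q: "Q \<in> dyadic_cubes" and r: "0 < r"
  shows "lorentz_norm_on p q Q h \<le> ennreal (measure lebesgue Q powr (1 / p - 1 / t)) * M_norm p q t r h"
proof -
  obtain j k where "Q = dyadic_cube j k" using Q by (rule dyadic_cubesE)
  then have m: "0 < measure lebesgue Q" by (simp add: dyadic_cube_measure)
  have *: "ennreal (measure lebesgue Q powr (1 / t - 1 / p)) * lorentz_norm_on p q Q h \<le> M_norm p q t r h"
  proof (cases "r = \<infinity>")
    case True
    then show ?thesis unfolding M_norm_def using Q by (auto intro: SUP_upper2)
  next
    case False
    with r obtain s where s: "r = ereal s" "0 < s" by (cases r) auto
    let ?w = "\<lambda>Q. ennreal (measure lebesgue Q powr (s / t - s / p)) * epowr (lorentz_norm_on p q Q h) s"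
    have "?w Q = epowr (ennreal (measure lebesgue Q powr (1 / t - 1 / p)) * lorentz_norm_on p q Q h) s"
    proof (cases "lorentz_norm_on p q Q h")
      case (real x)
      then show ?thesis using s(2)
        by (simp add: powr_mult powr_powr left_diff_distrib flip: ennreal_mult)
    qed (use m in \<open>simp add: ennreal_mult_top\<close>)
    then have "epowr (?w Q) (1 / s) = ennreal (measure lebesgue Q powr (1 / t - 1 / p)) * lorentz_norm_on p q Q h"
      using s(2) by (simp add: epowr_epowr_inverse)
    moreover have "?w Q \<le> infsum ?w dyadic_cubes"
      using sum_le_infsum_ennreal[of "{Q}" dyadic_cubes ?w] Q by simp
    then have "epowr (?w Q) (1 / s) \<le> epowr (infsum ?w dyadic_cubes) (1 / s)"
      using s(2) by (intro epowr_mono) auto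
    ultimately show ?thesis using s by (simp add: M_norm_def Let_def)
  qed
  have "lorentz_norm_on p q Q h = ennreal (measure lebesgue Q powr (1 / p - 1 / t)) *
      (ennreal (measure lebesgue Q powr (1 / t - 1 / p)) * lorentz_norm_on p q Q h)"
    using m by (simp flip: mult.assoc ennreal_mult powr_add)
  also have "\<dots> \<le> ennreal (measure lebesgue Q powr (1 / p - 1 / t)) * M_norm p q t r h"
    using * by (rule mult_left_mono) simp
  finally show ?thesis .
qed

section \<open>Covering arbitrary cubes by dyadic ones\<close>

definition near_dyadic :: "real ^ 'n \<Rightarrow> real \<Rightarrow> int \<Rightarrow> ('n \<Rightarrow> bool) \<Rightarrow> int ^ 'n" where
  "near_dyadic c l j \<epsilon> = (\<chi> i. \<lfloor>2 powi j * (c $ i - l / 2)\<rfloor> + (if \<epsilon> i then 1 else 0))"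

text \<open>In each coordinate, an interval of length at most 2^-j meets only the dyadic interval
  containing its left end and the next one; \<epsilon> records which of the two contains the point.
  So 2^n dyadic cubes suffice.\<close>

lemma cube_covered:
  fixes c :: "real ^ 'n"
  assumes l: "l \<le> 2 powi (- j)"
  shows "cube c l \<subseteq> (\<Union>\<epsilon>. dyadic_cube j (near_dyadic c l j \<epsilon>))"
proof
  fix x assume x: "x \<in> cube c l"
  define \<epsilon> where "\<epsilon> i = (\<lfloor>2 powi j * x $ i\<rfloor> \<noteq> \<lfloor>2 powi j * (c $ i - l / 2)\<rfloor>)" for i
  have pos: "0 < (2::real) powi j" by simp
  have "near_dyadic c l j \<epsilon> $ i = \<lfloor>2 powi j * x $ i\<rfloor>" for i
  proof -
    have "c $ i - l / 2 \<le> x $ i \<and> x $ i \<le> c $ i + l / 2"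
      using x by (simp add: cube_eq_cbox mem_box_cart)
    then have xi: "c $ i - l / 2 \<le> x $ i" "x $ i \<le> c $ i - l / 2 + l" by auto
    have "2 powi j * (c $ i - l / 2) \<le> 2 powi j * x $ i"
      using xi by (intro mult_left_mono) auto
    moreover have "2 powi j * x $ i \<le> 2 powi j * (c $ i - l / 2) + 1"
    proof -
      have "2 powi j * x $ i \<le> 2 powi j * (c $ i - l / 2 + 2 powi (- j))"
        using xi l by (intro mult_left_mono) auto
      also have "\<dots> = 2 powi j * (c $ i - l / 2) + 1"
        by (simp add: distrib_left power_int_minus)
      finally show ?thesis .
    qed
    ultimately have "\<lfloor>2 powi j * x $ i\<rfloor> = \<lfloor>2 powi j * (c $ i - l / 2)\<rfloor> \<or>
        \<lfloor>2 powi j * x $ i\<rfloor> = \<lfloor>2 powi j * (c $ i - l / 2)\<rfloor> + 1" by linarith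
    then show ?thesis unfolding near_dyadic_def \<epsilon>_def by auto
  qed
  note nd = this
  have "x \<in> dyadic_cube j (near_dyadic c l j \<epsilon>)"
  proof -
    have "of_int \<lfloor>2 powi j * x $ i\<rfloor> \<le> 2 powi j * x $ i" "2 powi j * x $ i < of_int \<lfloor>2 powi j * x $ i\<rfloor> + 1" for i
      by linarith+
    then have "2 powi (- j) * of_int \<lfloor>2 powi j * x $ i\<rfloor> \<le> 2 powi (- j) * (2 powi j * x $ i)"
      "2 powi (- j) * (2 powi j * x $ i) < 2 powi (- j) * (of_int \<lfloor>2 powi j * x $ i\<rfloor> + 1)" for i
      by (auto intro!: mult_left_mono mult_strict_left_mono)
    moreover have "2 powi (- j) * (2 powi j * x $ i) = x $ i" for i by (simp add: power_int_minus)
    ultimately show ?thesis unfolding dyadic_cube_def nd by simp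
  qed
  then show "x \<in> (\<Union>\<epsilon>. dyadic_cube j (near_dyadic c l j \<epsilon>))" by blast
qed

lemma dyadic_scale_exists:
  assumes "0 < (l::real)" obtains j :: int where "l \<le> 2 powi (- j)" "2 powi (- j) \<le> 2 * l"
proof
  define j where "j = - \<lceil>log 2 l\<rceil>"
  have p: "(2::real) powi (- j) = 2 powr \<lceil>log 2 l\<rceil>" by (simp add: j_def powr_real_of_int')
  have "2 powr log 2 l \<le> (2::real) powr \<lceil>log 2 l\<rceil>" by (intro powr_mono) auto
  then show "l \<le> 2 powi (- j)" using assms p by simp
  have "(2::real) powr \<lceil>log 2 l\<rceil> \<le> 2 powr (log 2 l + 1)" by (intro powr_mono) linarith+
  then show "2 powi (- j) \<le> 2 * l" using assms p by (simp add: powr_add)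
qed

text \<open>The norm sees dyadic cubes only, so the cube is covered by 2^n of them with side at most
  2 l. On each, the Hoelder exponent 1 - 1/p and the exponent 1/p - 1/t of the weight add up to 1 -
  1/t. The count 2^n appears as \<open>CARD('n \<Rightarrow> bool)\<close>.\<close>

lemma nn_integral_cube_le_M_norm:
  fixes h :: "('n::finite) cfun"
  assumes e: "1 < p" "0 < q" "1 \<le> t" "0 < r" and l: "0 < l" and h[measurable]: "h \<in> borel_measurable lebesgue"
  shows "(\<integral>\<^sup>+x\<in>cube c l. ennreal (cmod (h x)) \<partial>lebesgue) \<le>
    ennreal (real CARD('n \<Rightarrow> bool) * lorentz_L1_const p q * (2 ^ CARD('n) * measure lebesgue (cube c l)) powr (1 - 1 / t))
      * M_norm p q t r h"
proof -
  obtain j :: int where j: "l \<le> 2 powi (- j)" "2 powi (- j) \<le> 2 * l" using dyadic_scale_exists[OF l] .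
  let ?Q = "\<lambda>\<epsilon>. dyadic_cube j (near_dyadic c l j \<epsilon>)"
  let ?L = "lorentz_L1_const p q" and ?m = "2 ^ CARD('n) * measure lebesgue (cube c l)"
  have L: "0 < ?L" using e by (intro lorentz_L1_const_pos) auto
  have Qm: "?Q \<epsilon> \<in> lmeasurable" for \<epsilon> by (rule dyadic_cube_measure)
  have [measurable]: "?Q \<epsilon> \<in> sets lebesgue" for \<epsilon> using Qm by auto
  have one: "(\<integral>\<^sup>+x\<in>?Q \<epsilon>. ennreal (cmod (h x)) \<partial>lebesgue) \<le> ennreal (?L * ?m powr (1 - 1 / t)) * M_norm p q t r h" for \<epsilon>
  proof -
    let ?D = "measure lebesgue (?Q \<epsilon>)"
    have D: "0 < ?D" by (simp add: dyadic_cube_measure)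
    have Dm: "?D \<le> ?m"
    proof -
      have "?D = (2 powi (- j)) ^ CARD('n)"
        by (simp add: dyadic_cube_measure powr_real_of_int'[symmetric] powr_power mult.commute)
      also have "\<dots> \<le> (2 * l) ^ CARD('n)" using j by (intro power_mono) auto
      also have "\<dots> = ?m" using l by (simp add: measure_cube power_mult_distrib)
      finally show ?thesis .
    qed
    have "(\<integral>\<^sup>+x\<in>?Q \<epsilon>. ennreal (cmod (h x)) \<partial>lebesgue)
        = (\<integral>\<^sup>+x\<in>?Q \<epsilon>. ennreal (cmod (h x * indicator (?Q \<epsilon>) x)) \<partial>lebesgue)"
      by (intro nn_integral_cong) (auto simp: indicator_def)
    also have "\<dots> \<le> ennreal (?L * ?D powr (1 - 1 / p)) * lorentz_norm p q (\<lambda>x. h x * indicator (?Q \<epsilon>) x)"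
      using e by (intro nn_integral_le_lorentz Qm) auto
    also have "\<dots> \<le> ennreal (?L * ?D powr (1 - 1 / p)) * (ennreal (?D powr (1 / p - 1 / t)) * M_norm p q t r h)"
      using lorentz_norm_on_le_M_norm[of "?Q \<epsilon>" r p q h t] e(4)
      by (intro mult_left_mono) (auto simp: lorentz_norm_on_def dyadic_cubes_def)
    also have "\<dots> = ennreal (?L * ?D powr (1 - 1 / t)) * M_norm p q t r h"
    proof -
      have "?L * ?D powr (1 - 1 / p) * ?D powr (1 / p - 1 / t) = ?L * ?D powr (1 - 1 / t)"
        by (simp add: mult.assoc flip: powr_add)
      moreover have "ennreal (?L * ?D powr (1 - 1 / p)) * ennreal (?D powr (1 / p - 1 / t))
          = ennreal (?L * ?D powr (1 - 1 / p) * ?D powr (1 / p - 1 / t))"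
        using L by (intro ennreal_mult[symmetric]) auto
      ultimately show ?thesis by (simp only: mult.assoc[symmetric])
    qed
    also have "\<dots> \<le> ennreal (?L * ?m powr (1 - 1 / t)) * M_norm p q t r h"
      using L Dm e by (intro mult_right_mono ennreal_leI mult_left_mono powr_mono2) auto
    finally show ?thesis .
  qed
  have "(\<integral>\<^sup>+x\<in>cube c l. ennreal (cmod (h x)) \<partial>lebesgue) \<le> (\<integral>\<^sup>+x. (\<Sum>\<epsilon>\<in>UNIV. ennreal (cmod (h x)) * indicator (?Q \<epsilon>) x) \<partial>lebesgue)"
  proof (rule nn_integral_mono)
    fix x
    show "ennreal (cmod (h x)) * indicator (cube c l) x \<le> (\<Sum>\<epsilon>\<in>UNIV. ennreal (cmod (h x)) * indicator (?Q \<epsilon>) x)"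
    proof (cases "x \<in> cube c l")
      case True
      then obtain \<epsilon> where "x \<in> ?Q \<epsilon>" using cube_covered[OF j(1)] by blast
      then have "ennreal (cmod (h x)) * indicator (cube c l) x \<le> ennreal (cmod (h x)) * indicator (?Q \<epsilon>) x" by (simp add: indicator_def)
      also have "\<dots> \<le> (\<Sum>\<epsilon>\<in>UNIV. ennreal (cmod (h x)) * indicator (?Q \<epsilon>) x)"
        by (rule member_le_sum) auto
      finally show ?thesis .
    qed simp
  qed
  also have "\<dots> = (\<Sum>\<epsilon>\<in>UNIV. (\<integral>\<^sup>+x\<in>?Q \<epsilon>. ennreal (cmod (h x)) \<partial>lebesgue))"
    by (rule nn_integral_sum) measurable
  also have "\<dots> \<le> (\<Sum>\<epsilon>\<in>(UNIV :: ('n \<Rightarrow> bool) set). ennreal (?L * ?m powr (1 - 1 / t)) * M_norm p q t r h)"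
    by (intro sum_mono one)
  also have "\<dots> = ennreal (real CARD('n \<Rightarrow> bool) * ?L * ?m powr (1 - 1 / t)) * M_norm p q t r h"
    using L by (simp add: ennreal_mult ennreal_of_nat_eq_real_of_nat mult.assoc del: card_fun)
  finally show ?thesis .
qed

section \<open>Block spaces\<close>

lemma lorentz_norm_zero: "lorentz_norm p q (\<lambda>x :: real ^ 'n. 0) = 0"
proof -
  have "rearr (\<lambda>x :: real ^ 'n. 0) u = 0" if "0 < u" for u
    by (rule rearr_eq_0[of "{}"]) (use that in auto)
  then have "(\<integral>\<^sup>+u\<in>{0<..}. epowr (ennreal (u powr (1 / p)) * rearr (\<lambda>x :: real ^ 'n. 0) u) q / ennreal u \<partial>lborel) = (\<integral>\<^sup>+(u::real). 0 \<partial>lborel)"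
    by (intro nn_integral_cong) (auto simp: indicator_def)
  then show ?thesis by (simp add: lorentz_norm_def)
qed

lemma block_zero: "block p q t Q (\<lambda>x. 0)"
  by (simp add: block_def lorentz_norm_zero)

lemma H_norm_zero: "H_norm p q t r (\<lambda>x :: real ^ 'n. 0) = 0"
proof -
  let ?z = "\<lambda>_ :: int \<times> (int ^ 'n). 0 :: complex"
  have "block_repr p q t r ?z (\<lambda>_ _. 0) (\<lambda>x :: real ^ 'n. 0)"
    by (auto simp: block_repr_def lseq_norm_def block_zero)
  then have "H_norm p q t r (\<lambda>x :: real ^ 'n. 0) \<le> lseq_norm r ?z"
    unfolding H_norm_def by (intro Inf_lower) blast
  also have "\<dots> = 0" by (simp add: lseq_norm_def)
  finally have "H_norm p q t r (\<lambda>x :: real ^ 'n. 0) \<le> 0" .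
  then show ?thesis by simp
qed

text \<open>A finite block representation within one generation: cut \<open>g\<close> along the
  dyadic cubes that cover its support, and use the same coefficient for all pieces.\<close>

lemma bounded_in_H_space:
  fixes g :: "('n::finite) cfun"
  assumes e: "0 < p" "0 < q" and g[measurable]: "g \<in> borel_measurable lebesgue"
    and l: "0 < l" and b: "\<And>x. cmod (g x) \<le> indicator (cube c l) x"
  shows "g \<in> H_space p q t r"
proof -
  obtain j :: int where j: "l \<le> 2 powi (- j)" "2 powi (- j) \<le> 2 * l" using dyadic_scale_exists[OF l] .
  define I where "I = (\<lambda>\<epsilon>. (j, near_dyadic c l j \<epsilon>)) ` UNIV"
  have I: "finite I" by (simp add: I_def)
  define D where "D = 2 powr (- real CARD('n) * of_int j)"
  \<comment> \<open>Chosen such that division by it turns the Lorentz bound for a function bounded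
    by 1 on a cube of measure \<open>D\<close> into exactly the block normalisation
    \<open>D powr (1 / p - 1 / t)\<close>.\<close>
  define \<Lambda> where "\<Lambda> = D powr (1 / t) * (p / q) powr (1 / q)"
  have \<Lambda>: "0 < \<Lambda>" using e by (simp add: \<Lambda>_def D_def)
  define lam where "lam i = (if i \<in> I then complex_of_real \<Lambda> else 0)" for i
  define a where "a i x = (if i \<in> I then g x * indicator (dyadic_cube (fst i) (snd i)) x / of_real \<Lambda> else 0)" for i x
  have "block_repr p q t r lam a g"
    unfolding block_repr_def
  proof (intro conjI allI impI)
    show "lseq_norm r lam < \<infinity>"
    proof -
      have "(\<Sum>\<^sub>\<infinity>i. ennreal (cmod (lam i) powr r)) = (\<Sum>\<^sub>\<infinity>i\<in>I. ennreal (cmod (lam i) powr r))"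
        by (rule infsum_cong_neutral) (auto simp: lam_def)
      also have "\<dots> = ennreal (\<Sum>i\<in>I. cmod (lam i) powr r)" using I by (simp add: sum_ennreal)
      finally show ?thesis by (simp add: lseq_norm_def sum_nonneg)
    qed
  next
    fix j' k
    show "block p q t (dyadic_cube j' k) (a (j', k))"
    proof (cases "(j', k) \<in> I")
      case False
      then have "a (j', k) = (\<lambda>x. 0)" by (auto simp: a_def)
      then show ?thesis by (simp add: block_zero)
    next
      case True
      then have j': "j' = j" by (auto simp: I_def)
      have Qm: "dyadic_cube j k \<in> lmeasurable" by (rule dyadic_cube_measure)
      then have [measurable]: "dyadic_cube j k \<in> sets lebesgue" by auto
      have a_eq: "a (j, k) = (\<lambda>x. g x * indicator (dyadic_cube j k) x / of_real \<Lambda>)"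
        using True j' by (auto simp: a_def)
      have gb: "cmod (g x) \<le> 1" for x using b[of x] by (cases "x \<in> cube c l") auto
      have "lorentz_norm p q (a (j, k)) \<le> ennreal (1 / \<Lambda> * measure lebesgue (dyadic_cube j k) powr (1 / p) * (p / q) powr (1 / q))"
      proof (rule lorentz_norm_bounded[OF e _ _ Qm])
        show "cmod (a (j, k) x) \<le> 1 / \<Lambda> * indicator (dyadic_cube j k) x" for x
          using gb[of x] \<Lambda> by (simp add: a_eq norm_divide norm_mult indicator_def divide_right_mono)
      qed (use \<Lambda> in auto)
      also have "1 / \<Lambda> * measure lebesgue (dyadic_cube j k) powr (1 / p) * (p / q) powr (1 / q)
          = measure lebesgue (dyadic_cube j k) powr (1 / p - 1 / t)"
        using e unfolding dyadic_cube_measure D_def[symmetric] by (simp add: \<Lambda>_def powr_diff)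
      finally have "lorentz_norm p q (a (j, k)) \<le> ennreal (measure lebesgue (dyadic_cube j k) powr (1 / p - 1 / t))" .
      then show ?thesis unfolding j' block_def by (auto simp: a_eq)
    qed
  next
    fix S :: "(real^'n) set" assume "compact S"
    have sg: "(\<Sum>i\<in>F. lam i * a i x) = g x" if F: "finite F" "I \<subseteq> F" for F x
    proof -
      have "(\<Sum>i\<in>F. lam i * a i x) = (\<Sum>i\<in>I. lam i * a i x)"
        using F by (intro sum.mono_neutral_right) (auto simp: lam_def)
      also have "\<dots> = (\<Sum>i\<in>I. g x * indicator (dyadic_cube (fst i) (snd i)) x)"
        using \<Lambda> by (intro sum.cong) (auto simp: lam_def a_def)
      also have "\<dots> = g x"
      proof (cases "x \<in> cube c l")
        case False
        then have "g x = 0" using b[of x] by simp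
        then show ?thesis by simp
      next
        case True
        then obtain \<epsilon> where \<epsilon>: "x \<in> dyadic_cube j (near_dyadic c l j \<epsilon>)" using cube_covered[OF j(1)] by blast
        let ?i = "(j, near_dyadic c l j \<epsilon>)"
        have "(\<Sum>i\<in>I. g x * indicator (dyadic_cube (fst i) (snd i)) x) = (\<Sum>i\<in>I. if i = ?i then g x else 0)"
        proof (rule sum.cong)
          fix i assume "i \<in> I"
          then obtain k where i: "i = (j, k)" by (auto simp: I_def)
          have "x \<in> dyadic_cube j k \<longleftrightarrow> k = near_dyadic c l j \<epsilon>"
            using \<epsilon> dyadic_cubes_disjoint[of k "near_dyadic c l j \<epsilon>" j] by auto
          then show "g x * indicator (dyadic_cube (fst i) (snd i)) x = (if i = ?i then g x else 0)"
            unfolding i by (simp add: indicator_def)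
        qed simp
        also have "\<dots> = g x" using I by (subst sum.delta) (auto simp: I_def)
        finally show ?thesis .
      qed
      finally show ?thesis .
    qed
    have "eventually (\<lambda>F. 0 = (\<integral>\<^sup>+x\<in>S. ennreal (cmod (g x - (\<Sum>i\<in>F. lam i * a i x))) \<partial>lebesgue)) (finite_subsets_at_top UNIV)"
      unfolding eventually_finite_subsets_at_top
    proof (intro exI[of _ I] conjI allI impI)
      fix F assume "finite F \<and> I \<subseteq> F \<and> F \<subseteq> UNIV"
      then have "(\<Sum>i\<in>F. lam i * a i x) = g x" for x using sg by blast
      then show "0 = (\<integral>\<^sup>+x\<in>S. ennreal (cmod (g x - (\<Sum>i\<in>F. lam i * a i x))) \<partial>lebesgue)" by simp
    qed (use I in auto)
    then show "((\<lambda>F. \<integral>\<^sup>+x\<in>S. ennreal (cmod (g x - (\<Sum>i\<in>F. lam i * a i x))) \<partial>lebesgue) \<longlongrightarrow> 0) (finite_subsets_at_top UNIV)"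
      by (rule Lim_transform_eventually[rotated]) simp
  qed
  then show ?thesis unfolding H_space_def by auto
qed

section \<open>From the block norm to integrals over a fixed set\<close>

definition dyadic_weight :: "real \<Rightarrow> real \<Rightarrow> (real ^ 'n) set \<Rightarrow> int \<times> (int ^ 'n) \<Rightarrow> real" where
  "dyadic_weight p t S i = measure lebesgue (S \<inter> dyadic_cube (fst i) (snd i)) powr (1 / p) *
     measure lebesgue (dyadic_cube (fst i) (snd i)) powr (1 / t - 1 / p)"

lemma conj_exp_facts:
  assumes "1 < p"
  shows "1 < conj_exp p" "1 / conj_exp p = 1 - 1 / p"
  using assms by (auto simp: conj_exp_def field_simps)

lemma block_measurable: "block p q t Q a \<Longrightarrow> a \<in> borel_measurable lebesgue"
  by (simp add: block_def)

text \<open>Conjugation turns the Hoelder exponent 1 - 1/p' into 1/p and the block exponent 1/p' -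
  1/t' into 1/t - 1/p. Together they form \<open>dyadic_weight\<close>, the quantity whose sums over
  dyadic cubes are already controlled.\<close>

lemma block_L1_le:
  fixes a :: "('n::finite) cfun"
  assumes e: "1 < p" "1 < q" "1 < t" and S: "S \<in> lmeasurable"
    and a: "block (conj_exp p) (conj_exp q) (conj_exp t) (dyadic_cube (fst i) (snd i)) a"
  shows "(\<integral>\<^sup>+x\<in>S. ennreal (cmod (a x)) \<partial>lebesgue)
    \<le> ennreal (lorentz_L1_const (conj_exp p) (conj_exp q) * dyadic_weight p t S i)"
proof -
  let ?Q = "dyadic_cube (fst i) (snd i)" and ?L = "lorentz_L1_const (conj_exp p) (conj_exp q)"
  have Q: "?Q \<in> lmeasurable" by (rule dyadic_cube_measure)
  have L: "0 < ?L" using conj_exp_facts[OF e(1)] conj_exp_facts[OF e(2)] by (intro lorentz_L1_const_pos) auto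
  have [measurable]: "a \<in> borel_measurable lebesgue" and z: "\<And>x. x \<notin> ?Q \<Longrightarrow> a x = 0"
    and n: "lorentz_norm (conj_exp p) (conj_exp q) a \<le> ennreal (measure lebesgue ?Q powr (1 / conj_exp p - 1 / conj_exp t))"
    using a by (auto simp: block_def)
  have "(\<integral>\<^sup>+x\<in>S. ennreal (cmod (a x)) \<partial>lebesgue) = (\<integral>\<^sup>+x\<in>S \<inter> ?Q. ennreal (cmod (a x)) \<partial>lebesgue)"
    using z by (intro nn_integral_cong) (auto simp: indicator_def)
  also have "\<dots> \<le> ennreal (?L * measure lebesgue (S \<inter> ?Q) powr (1 - 1 / conj_exp p)) * lorentz_norm (conj_exp p) (conj_exp q) a"
    using conj_exp_facts[OF e(1)] conj_exp_facts[OF e(2)] S Q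
    by (intro nn_integral_le_lorentz) (auto intro: fmeasurable.Int)
  also have "\<dots> \<le> ennreal (?L * measure lebesgue (S \<inter> ?Q) powr (1 - 1 / conj_exp p)) *
      ennreal (measure lebesgue ?Q powr (1 / conj_exp p - 1 / conj_exp t))"
    using n by (rule mult_left_mono) simp
  also have "\<dots> = ennreal (?L * dyadic_weight p t S i)"
    using L by (simp add: conj_exp_facts(2)[OF e(1)] conj_exp_facts(2)[OF e(3)] dyadic_weight_def mult.assoc flip: ennreal_mult)
  finally show ?thesis .
qed

text \<open>The weights of \<open>S\<close> form a sequence in \<ell>^r, to be paired with
  coefficients in \<ell>^r'. For r = \<infinity> they are bounded and r' = 1; for finite r their
  r-th powers are summable by \<open>dyadic_sum_le\<close>. The bound is uniform in the finite set
  \<open>F\<close>.\<close>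

lemma sequence_duality:
  fixes S :: "(real ^ 'n) set" and p t :: real and r :: ereal
  assumes e: "(1 < p \<and> p < t \<and> ereal t < r \<and> r < \<infinity>) \<or> (1 < p \<and> p \<le> t \<and> ereal t < r \<and> r = \<infinity>)"
    and S: "S \<in> lmeasurable" "0 < measure lebesgue S"
  obtains C where "0 < C" "\<And>F (lam :: int \<times> (int ^ 'n) \<Rightarrow> complex) \<epsilon>. finite F \<Longrightarrow> 0 < \<epsilon> \<Longrightarrow>
     lseq_norm (econj_exp r) lam < ennreal \<epsilon> \<Longrightarrow> (\<Sum>i\<in>F. cmod (lam i) * dyadic_weight p t S i) \<le> C * \<epsilon>"
proof -
  have lseq: "(\<Sum>i\<in>F. cmod (lam i) powr R) \<le> \<epsilon> powr R"
    if R: "0 < R" and F: "finite F" and \<epsilon>: "0 < \<epsilon>" and le: "lseq_norm R lam < ennreal \<epsilon>"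
    for F and lam :: "int \<times> (int ^ 'n) \<Rightarrow> complex" and \<epsilon> R
  proof -
    let ?X = "\<Sum>\<^sub>\<infinity>i. ennreal (cmod (lam i) powr R)"
    have "ennreal (\<Sum>i\<in>F. cmod (lam i) powr R) = (\<Sum>i\<in>F. ennreal (cmod (lam i) powr R))"
      by (rule sum_ennreal[symmetric]) simp
    also have "\<dots> \<le> ?X" by (rule sum_le_infsum_ennreal[OF F]) simp
    also have "?X = epowr (epowr ?X (1 / R)) R"
      using epowr_epowr_inverse[of "1 / R" ?X] R by simp
    also have "\<dots> \<le> epowr (ennreal \<epsilon>) R"
      using le R unfolding lseq_norm_def by (intro epowr_mono) auto
    also have "\<dots> = ennreal (\<epsilon> powr R)" using \<epsilon> by simp
    finally have "ennreal (\<Sum>i\<in>F. cmod (lam i) powr R) \<le> ennreal (\<epsilon> powr R)" .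
    then show ?thesis by (rule ennreal_le_iff[THEN iffD1, rotated]) simp
  qed
  show thesis
  proof (cases "r = \<infinity>")
    case True
    let ?C = "measure lebesgue S powr (1 / t)"
    show thesis
    proof (rule that[of ?C])
      show "0 < ?C" using S by simp
      fix F :: "(int \<times> (int ^ 'n)) set" and lam :: "int \<times> (int ^ 'n) \<Rightarrow> complex" and \<epsilon> :: real
      assume F: "finite F" "0 < \<epsilon>" "lseq_norm (econj_exp r) lam < ennreal \<epsilon>"
      have "(\<Sum>i\<in>F. cmod (lam i) * dyadic_weight p t S i) \<le> (\<Sum>i\<in>F. cmod (lam i) * ?C)"
        unfolding dyadic_weight_def using e by (intro sum_mono mult_left_mono dyadic_term_le S) auto
      also have "\<dots> = ?C * (\<Sum>i\<in>F. cmod (lam i) powr 1)" by (simp add: sum_distrib_right mult.commute)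
      also have "\<dots> \<le> ?C * \<epsilon>"
        using lseq[of 1 F \<epsilon> lam] F True by (intro mult_left_mono) (auto simp: econj_exp_def)
      finally show "(\<Sum>i\<in>F. cmod (lam i) * dyadic_weight p t S i) \<le> ?C * \<epsilon>" .
    qed
  next
    case False
    with e obtain s where s: "r = ereal s" by (cases r) auto
    then have s1: "p < t" "t < s" "1 < p" "1 < s" using e by auto
    define R where "R = conj_exp s"
    have R: "1 < R" "1 / R + 1 / s = 1" "econj_exp r = R"
      using conj_exp_facts[OF s1(4)] s by (auto simp: R_def econj_exp_def)
    define D where "D = dyadic_const p t s * measure lebesgue S powr (s / t)"
    have D: "0 < D" unfolding D_def using dyadic_const_pos[of p t s] s1 S by (intro mult_pos_pos) auto
    show thesis
    proof (rule that[of "1 + D"])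
      show "0 < 1 + D" using D by simp
      fix F :: "(int \<times> (int ^ 'n)) set" and lam :: "int \<times> (int ^ 'n) \<Rightarrow> complex" and \<epsilon> :: real
      assume F: "finite F" "0 < \<epsilon>" "lseq_norm (econj_exp r) lam < ennreal \<epsilon>"
      let ?w = "dyadic_weight p t S"
      have w: "0 \<le> ?w i" for i by (simp add: dyadic_weight_def)
      \<comment> \<open>Young's inequality for the coefficient divided by \<epsilon>: both resulting
        sums are then bounded independently of \<epsilon>, and one factor \<epsilon> remains in
        front.\<close>
      have y: "cmod (lam i) * ?w i \<le> \<epsilon> * (cmod (lam i) powr R / \<epsilon> powr R + ?w i powr s)" for i
      proof -
        have "(cmod (lam i) / \<epsilon>) * ?w i \<le> (cmod (lam i) / \<epsilon>) powr R / R + ?w i powr s / s"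
          using R s1 F w by (intro Youngs_inequality) auto
        also have "\<dots> \<le> (cmod (lam i) / \<epsilon>) powr R + ?w i powr s"
          using R s1 by (intro add_mono) (auto simp: divide_le_eq mult_le_cancel_left1)
        finally have "\<epsilon> * ((cmod (lam i) / \<epsilon>) * ?w i) \<le> \<epsilon> * ((cmod (lam i) / \<epsilon>) powr R + ?w i powr s)"
          using F by (intro mult_left_mono) auto
        then show ?thesis using F by (simp add: powr_divide)
      qed
      have "(\<Sum>i\<in>F. cmod (lam i) * ?w i) \<le> (\<Sum>i\<in>F. \<epsilon> * (cmod (lam i) powr R / \<epsilon> powr R + ?w i powr s))"
        by (intro sum_mono y)
      also have "\<dots> = \<epsilon> * ((\<Sum>i\<in>F. cmod (lam i) powr R) / \<epsilon> powr R + (\<Sum>i\<in>F. ?w i powr s))"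
        by (simp add: sum_distrib_left[symmetric] sum.distrib sum_divide_distrib)
      also have "\<dots> \<le> \<epsilon> * (1 + D)"
      proof (intro mult_left_mono add_mono)
        show "(\<Sum>i\<in>F. cmod (lam i) powr R) / \<epsilon> powr R \<le> 1"
          using lseq[of R F \<epsilon> lam] R F by (simp add: divide_le_eq)
        show "(\<Sum>i\<in>F. ?w i powr s) \<le> D"
          using dyadic_sum_le[OF S, of p t s F] s1 F unfolding D_def dyadic_weight_def by (simp add: case_prod_unfold)
      qed (use F in auto)
      finally show "(\<Sum>i\<in>F. cmod (lam i) * ?w i) \<le> (1 + D) * \<epsilon>" by (simp add: mult.commute)
    qed
  qed
qed

text \<open>The block space embeds continuously into the integrable functions on a compact set. A
  norm strictly below \<epsilon> yields a representation with coefficients below \<epsilon>; its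
  finite partial sums are bounded uniformly, and the remainder tends to 0 because representations
  converge in L^1_loc.\<close>

lemma H_norm_L1_bound:
  fixes S :: "(real ^ 'n) set" and p q t :: real and r :: ereal
  assumes e: "(1 < p \<and> p < t \<and> ereal t < r \<and> r < \<infinity>) \<or> (1 < p \<and> p \<le> t \<and> ereal t < r \<and> r = \<infinity>)"
    and q: "1 < q" and S: "compact S" "0 < measure lebesgue S"
  obtains C where "0 < C" "\<And>(w :: 'n cfun) \<epsilon>. w \<in> borel_measurable lebesgue \<Longrightarrow> 0 < \<epsilon> \<Longrightarrow>
     H_norm (conj_exp p) (conj_exp q) (conj_exp t) (econj_exp r) w < ennreal \<epsilon> \<Longrightarrow>
     (\<integral>\<^sup>+x\<in>S. ennreal (cmod (w x)) \<partial>lebesgue) \<le> ennreal (C * \<epsilon>)"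
proof -
  have Sm: "S \<in> lmeasurable" using S(1) by (rule lmeasurable_compact)
  then have [measurable]: "S \<in> sets lebesgue" by auto
  have pt: "1 < p" "1 < t" using e by auto
  obtain C where C: "0 < C" "\<And>F (lam :: int \<times> (int ^ 'n) \<Rightarrow> complex) \<epsilon>. finite F \<Longrightarrow> 0 < \<epsilon> \<Longrightarrow>
     lseq_norm (econj_exp r) lam < ennreal \<epsilon> \<Longrightarrow> (\<Sum>i\<in>F. cmod (lam i) * dyadic_weight p t S i) \<le> C * \<epsilon>"
    using sequence_duality[OF e Sm S(2)] by blast
  let ?L = "lorentz_L1_const (conj_exp p) (conj_exp q)"
  have L: "0 < ?L" using conj_exp_facts[OF pt(1)] conj_exp_facts[OF q] by (intro lorentz_L1_const_pos) auto
  show thesis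
  proof (rule that[of "?L * C"])
    show "0 < ?L * C" using L C by simp
    fix w :: "'n cfun" and \<epsilon> :: real
    assume w[measurable]: "w \<in> borel_measurable lebesgue" and \<epsilon>: "0 < \<epsilon>"
      and H: "H_norm (conj_exp p) (conj_exp q) (conj_exp t) (econj_exp r) w < ennreal \<epsilon>"
    then obtain lam a where la: "lseq_norm (econj_exp r) lam < ennreal \<epsilon>"
      and rep: "block_repr (conj_exp p) (conj_exp q) (conj_exp t) (econj_exp r) lam a w"
      unfolding H_norm_def by (auto simp: Inf_less_iff)
    have "block (conj_exp p) (conj_exp q) (conj_exp t) (dyadic_cube j k) (a (j, k))" for j k
      using rep unfolding block_repr_def by blast
    note blk0 = this
    have blk: "block (conj_exp p) (conj_exp q) (conj_exp t) (dyadic_cube (fst i) (snd i)) (a i)" for i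
      using blk0[of "fst i" "snd i"] by (simp only: prod.collapse)
    have [measurable]: "a i \<in> borel_measurable lebesgue" for i
      using blk[of i] by (rule block_measurable)
    have fin: "(\<integral>\<^sup>+x\<in>S. ennreal (cmod (w x)) \<partial>lebesgue) \<le>
        (\<integral>\<^sup>+x\<in>S. ennreal (cmod (w x - (\<Sum>i\<in>F. lam i * a i x))) \<partial>lebesgue) + ennreal (?L * C * \<epsilon>)"
      if F: "finite F" for F
    proof -
      have "(\<integral>\<^sup>+x\<in>S. ennreal (cmod (w x)) \<partial>lebesgue) \<le>
        (\<integral>\<^sup>+x. ennreal (cmod (w x - (\<Sum>i\<in>F. lam i * a i x))) * indicator S x +
          (\<Sum>i\<in>F. ennreal (cmod (lam i)) * (ennreal (cmod (a i x)) * indicator S x)) \<partial>lebesgue)"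
      proof (rule nn_integral_mono)
        fix x
        have "cmod (w x) \<le> cmod (w x - (\<Sum>i\<in>F. lam i * a i x)) + cmod (\<Sum>i\<in>F. lam i * a i x)"
          using norm_triangle_ineq[of "w x - (\<Sum>i\<in>F. lam i * a i x)" "\<Sum>i\<in>F. lam i * a i x"] by simp
        also have "cmod (\<Sum>i\<in>F. lam i * a i x) \<le> (\<Sum>i\<in>F. cmod (lam i) * cmod (a i x))"
          by (rule order_trans[OF norm_sum]) (simp add: norm_mult)
        finally have "ennreal (cmod (w x)) \<le> ennreal (cmod (w x - (\<Sum>i\<in>F. lam i * a i x)) + (\<Sum>i\<in>F. cmod (lam i) * cmod (a i x)))"
          by (simp add: ennreal_leI)
        also have "\<dots> = ennreal (cmod (w x - (\<Sum>i\<in>F. lam i * a i x))) + (\<Sum>i\<in>F. ennreal (cmod (lam i)) * ennreal (cmod (a i x)))"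
        proof -
          have "ennreal (\<Sum>i\<in>F. cmod (lam i) * cmod (a i x)) = (\<Sum>i\<in>F. ennreal (cmod (lam i)) * ennreal (cmod (a i x)))"
            by (subst sum_ennreal[symmetric]) (auto simp: ennreal_mult)
          then show ?thesis by (simp add: ennreal_plus sum_nonneg)
        qed
        finally show "ennreal (cmod (w x)) * indicator S x \<le> ennreal (cmod (w x - (\<Sum>i\<in>F. lam i * a i x))) * indicator S x +
          (\<Sum>i\<in>F. ennreal (cmod (lam i)) * (ennreal (cmod (a i x)) * indicator S x))"
          by (simp add: indicator_def)
      qed
      also have "\<dots> = (\<integral>\<^sup>+x\<in>S. ennreal (cmod (w x - (\<Sum>i\<in>F. lam i * a i x))) \<partial>lebesgue) +
          (\<Sum>i\<in>F. ennreal (cmod (lam i)) * (\<integral>\<^sup>+x\<in>S. ennreal (cmod (a i x)) \<partial>lebesgue))"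
        by (subst nn_integral_add) (auto simp: nn_integral_sum nn_integral_cmult)
      also have "(\<Sum>i\<in>F. ennreal (cmod (lam i)) * (\<integral>\<^sup>+x\<in>S. ennreal (cmod (a i x)) \<partial>lebesgue))
          \<le> (\<Sum>i\<in>F. ennreal (cmod (lam i)) * ennreal (?L * dyadic_weight p t S i))"
        using block_L1_le[OF pt(1) q pt(2) Sm blk] by (intro sum_mono mult_left_mono) auto
      also have "\<dots> = ennreal (?L * (\<Sum>i\<in>F. cmod (lam i) * dyadic_weight p t S i))"
      proof -
        have "ennreal (cmod (lam i)) * ennreal (?L * dyadic_weight p t S i) = ennreal (?L * (cmod (lam i) * dyadic_weight p t S i))" for i
          using L by (subst ennreal_mult[symmetric]) (auto simp: dyadic_weight_def mult_ac)
        then have "(\<Sum>i\<in>F. ennreal (cmod (lam i)) * ennreal (?L * dyadic_weight p t S i)) = ennreal (\<Sum>i\<in>F. ?L * (cmod (lam i) * dyadic_weight p t S i))"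
          using L by (simp only:) (rule sum_ennreal, auto simp: dyadic_weight_def)
        then show ?thesis by (simp only: sum_distrib_left)
      qed
      also have "\<dots> \<le> ennreal (?L * (C * \<epsilon>))"
        using L C(2)[OF F \<epsilon> la] by (intro ennreal_leI mult_left_mono) auto
      finally show ?thesis by (simp add: mult.assoc)
    qed
    show "(\<integral>\<^sup>+x\<in>S. ennreal (cmod (w x)) \<partial>lebesgue) \<le> ennreal (?L * C * \<epsilon>)"
    proof (rule ennreal_le_epsilon)
      fix \<eta> :: real assume "0 < \<eta>"
      moreover have "((\<lambda>F. \<integral>\<^sup>+x\<in>S. ennreal (cmod (w x - (\<Sum>i\<in>F. lam i * a i x))) \<partial>lebesgue) \<longlongrightarrow> 0) (finite_subsets_at_top UNIV)"
        using rep S(1) unfolding block_repr_def by blast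
      ultimately have "eventually (\<lambda>F. (\<integral>\<^sup>+x\<in>S. ennreal (cmod (w x - (\<Sum>i\<in>F. lam i * a i x))) \<partial>lebesgue) < ennreal \<eta>) (finite_subsets_at_top UNIV)"
        by (intro order_tendstoD(2)) auto
      then obtain F where F: "finite F" "(\<integral>\<^sup>+x\<in>S. ennreal (cmod (w x - (\<Sum>i\<in>F. lam i * a i x))) \<partial>lebesgue) < ennreal \<eta>"
        unfolding eventually_finite_subsets_at_top by blast
      show "(\<integral>\<^sup>+x\<in>S. ennreal (cmod (w x)) \<partial>lebesgue) \<le> ennreal (?L * C * \<epsilon>) + ennreal \<eta>"
      proof -
        note fin[OF F(1)]
        also have "(\<integral>\<^sup>+x\<in>S. ennreal (cmod (w x - (\<Sum>i\<in>F. lam i * a i x))) \<partial>lebesgue) + ennreal (?L * C * \<epsilon>)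
            \<le> ennreal \<eta> + ennreal (?L * C * \<epsilon>)"
          using F(2) by (intro add_right_mono) simp
        finally show ?thesis by (simp only: add.commute)
      qed
    qed
  qed
qed

section \<open>Square integrable functions and bounded operators\<close>

lemma L2_integrable_mult:
  assumes "f \<in> L2" "g \<in> L2"
  shows "integrable lebesgue (\<lambda>x. f x * g x)"
proof (rule Bochner_Integration.integrable_bound)
  show "integrable lebesgue (\<lambda>x. (cmod (f x))\<^sup>2 + (cmod (g x))\<^sup>2)"
    using assms by (intro Bochner_Integration.integrable_add) (auto simp: L2_def)
  show "(\<lambda>x. f x * g x) \<in> borel_measurable lebesgue"
    using assms by (auto simp: L2_def)
  show "AE x in lebesgue. norm (f x * g x) \<le> norm ((cmod (f x))\<^sup>2 + (cmod (g x))\<^sup>2)"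
  proof (rule AE_I2)
    fix x
    have "2 * (cmod (f x) * cmod (g x)) \<le> (cmod (f x))\<^sup>2 + (cmod (g x))\<^sup>2"
      using sum_squares_bound[of "cmod (f x)" "cmod (g x)"] by (simp only: mult.assoc)
    then have "cmod (f x) * cmod (g x) \<le> (cmod (f x))\<^sup>2 + (cmod (g x))\<^sup>2"
      using mult_nonneg_nonneg[OF norm_ge_zero[of "f x"] norm_ge_zero[of "g x"]] by linarith
    then show "norm (f x * g x) \<le> norm ((cmod (f x))\<^sup>2 + (cmod (g x))\<^sup>2)"
      by (simp add: norm_mult)
  qed
qed

lemma L2_norm_nonneg: "0 \<le> L2_norm f"
  by (simp add: L2_norm_def)

lemma L2_norm_square: "(L2_norm f)\<^sup>2 = (LINT x|lebesgue. (cmod (f x))\<^sup>2)"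
  by (simp add: L2_norm_def)

text \<open>Integrate 2|fg| \<le> s|f|^2 + |g|^2/s with \<open>s\<close> the ratio of the two norms.
  The perturbation \<eta> keeps this ratio defined and positive when a norm vanishes, at a cost of
  at most \<open>e\<close>.\<close>

lemma L2_Cauchy_Schwarz:
  assumes f: "f \<in> L2" and g: "g \<in> L2"
  shows "(LINT x|lebesgue. cmod (f x * g x)) \<le> L2_norm f * L2_norm g"
proof (rule field_le_epsilon)
  fix e :: real assume e: "0 < e"
  let ?F = "L2_norm f" and ?G = "L2_norm g" and ?I = "LINT x|lebesgue. cmod (f x * g x)"
  note nn = L2_norm_nonneg[of f] L2_norm_nonneg[of g]
  define \<eta> where "\<eta> = e / (?F + ?G + 1)"
  have \<eta>: "0 < \<eta>" using e nn by (simp add: \<eta>_def)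
  define s where "s = (?G + \<eta>) / (?F + \<eta>)"
  have s: "0 < s" using \<eta> nn by (simp add: s_def)
  have int: "integrable lebesgue (\<lambda>x. (cmod (f x))\<^sup>2)" "integrable lebesgue (\<lambda>x. (cmod (g x))\<^sup>2)"
    using f g by (auto simp: L2_def)
  have "2 * ?I = (LINT x|lebesgue. 2 * cmod (f x * g x))" by simp
  also have "\<dots> \<le> (LINT x|lebesgue. s * (cmod (f x))\<^sup>2 + (cmod (g x))\<^sup>2 / s)"
  proof (rule integral_mono)
    show "integrable lebesgue (\<lambda>x. 2 * cmod (f x * g x))"
      using L2_integrable_mult[OF f g] by simp
    show "integrable lebesgue (\<lambda>x. s * (cmod (f x))\<^sup>2 + (cmod (g x))\<^sup>2 / s)"
      using int by simp
    fix x
    have "2 * (sqrt s * cmod (f x)) * (cmod (g x) / sqrt s) \<le> (sqrt s * cmod (f x))\<^sup>2 + (cmod (g x) / sqrt s)\<^sup>2"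
      by (rule sum_squares_bound)
    then show "2 * cmod (f x * g x) \<le> s * (cmod (f x))\<^sup>2 + (cmod (g x))\<^sup>2 / s"
      using s by (simp add: norm_mult power_mult_distrib power_divide)
  qed
  also have "\<dots> = s * ?F\<^sup>2 + ?G\<^sup>2 / s"
    using int by (simp add: L2_norm_square)
  also have "\<dots> \<le> ?F * (?G + \<eta>) + ?G * (?F + \<eta>)"
  proof (rule add_mono)
    have "s * ?F\<^sup>2 = ?F * (?G + \<eta>) * (?F / (?F + \<eta>))" by (simp add: s_def power2_eq_square)
    also have "\<dots> \<le> ?F * (?G + \<eta>) * 1" using nn \<eta> by (intro mult_left_mono) (auto simp: divide_le_eq)
    finally show "s * ?F\<^sup>2 \<le> ?F * (?G + \<eta>)" by simp
    have "?G\<^sup>2 / s = ?G * (?F + \<eta>) * (?G / (?G + \<eta>))" by (simp add: s_def power2_eq_square)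
    also have "\<dots> \<le> ?G * (?F + \<eta>) * 1" using nn \<eta> by (intro mult_left_mono) (auto simp: divide_le_eq)
    finally show "?G\<^sup>2 / s \<le> ?G * (?F + \<eta>)" by simp
  qed
  also have "\<dots> = 2 * (?F * ?G) + \<eta> * (?F + ?G)" by (simp add: algebra_simps)
  also have "\<eta> * (?F + ?G) \<le> \<eta> * (?F + ?G + 1)" using \<eta> by simp
  also have "\<dots> = e" using nn by (simp add: \<eta>_def)
  finally show "?I \<le> ?F * ?G + e" using e by simp
qed

lemma L2_pairing_bound:
  assumes f: "f \<in> L2" and g: "g \<in> L2"
  shows "cmod (LINT x|lebesgue. f x * g x) \<le> L2_norm f * L2_norm g"
  using integral_norm_bound[of lebesgue "\<lambda>x. f x * g x"] L2_Cauchy_Schwarz[OF f g] by linarith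

lemma L2_diff:
  assumes "f \<in> L2" "g \<in> L2" shows "(\<lambda>x. f x - g x) \<in> L2"
  unfolding L2_def
proof (intro CollectI conjI)
  have [measurable]: "f \<in> borel_measurable lebesgue" "g \<in> borel_measurable lebesgue" using assms by (auto simp: L2_def)
  show m: "(\<lambda>x. f x - g x) \<in> borel_measurable lebesgue" by measurable
  show "integrable lebesgue (\<lambda>x. (cmod (f x - g x))\<^sup>2)"
  proof (rule Bochner_Integration.integrable_bound)
    show "integrable lebesgue (\<lambda>x. 2 * (cmod (f x))\<^sup>2 + 2 * (cmod (g x))\<^sup>2)"
      using assms by (auto simp: L2_def)
    show "AE x in lebesgue. norm ((cmod (f x - g x))\<^sup>2) \<le> norm (2 * (cmod (f x))\<^sup>2 + 2 * (cmod (g x))\<^sup>2)"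
    proof (rule AE_I2)
      fix x
      have "(cmod (f x - g x))\<^sup>2 \<le> (cmod (f x) + cmod (g x))\<^sup>2"
        using norm_triangle_ineq4 by (intro power_mono) auto
      also have "\<dots> \<le> 2 * (cmod (f x))\<^sup>2 + 2 * (cmod (g x))\<^sup>2"
        using sum_squares_bound[of "cmod (f x)" "cmod (g x)"] by (simp add: power2_sum)
      finally show "norm ((cmod (f x - g x))\<^sup>2) \<le> norm (2 * (cmod (f x))\<^sup>2 + 2 * (cmod (g x))\<^sup>2)" by simp
    qed
  qed measurable
qed

lemma L2_scale: "f \<in> L2 \<Longrightarrow> (\<lambda>x. c * f x) \<in> L2"
  by (auto simp: L2_def norm_mult power_mult_distrib)

section \<open>Bounded functions supported in a fixed set\<close>

definition bounded_on :: "(real ^ 'n) set \<Rightarrow> ('n::finite) cfun \<Rightarrow> bool" where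
  "bounded_on Q f \<longleftrightarrow> f \<in> borel_measurable lebesgue \<and> (\<exists>B. \<forall>x. cmod (f x) \<le> B) \<and> (\<forall>x. x \<notin> Q \<longrightarrow> f x = 0)"

lemma integrable_indicator_lmeasurable: "Q \<in> lmeasurable \<Longrightarrow> integrable lebesgue (indicat_real Q)"
  by (intro integrable_real_indicator) (auto simp: fmeasurable_def)

lemma integral_indicator_complex:
  assumes "Q \<in> lmeasurable"
  shows "(LINT x|lebesgue. indicator Q x) = complex_of_real (measure lebesgue Q)"
proof -
  have "(LINT x|lebesgue. indicator Q x :: complex) = (LINT x|lebesgue. complex_of_real (indicator Q x))"
    by (rule Bochner_Integration.integral_cong) (auto simp: indicator_def)
  also have "\<dots> = of_real (LINT x|lebesgue. indicator Q x)" by (rule integral_complex_of_real)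
  finally show ?thesis by simp
qed

text \<open>Division by 0 yields 0, so \<sigma> vanishes together with \<open>w\<close> and the
  product formula holds there too.\<close>

lemma conjugate_sign:
  fixes w :: "'a \<Rightarrow> complex"
  defines "\<sigma> \<equiv> \<lambda>x. cnj (w x) / of_real (cmod (w x))"
  shows "w \<in> borel_measurable M \<Longrightarrow> \<sigma> \<in> borel_measurable M"
    and "cmod (\<sigma> x) \<le> 1" and "w x * \<sigma> x = of_real (cmod (w x))"
proof -
  have [measurable]: "cnj \<in> borel_measurable borel" "complex_of_real \<in> borel_measurable borel"
    by (auto intro!: borel_measurable_continuous_onI continuous_intros)
  show "\<sigma> \<in> borel_measurable M" if [measurable]: "w \<in> borel_measurable M"
    unfolding \<sigma>_def by measurable
  show "cmod (\<sigma> x) \<le> 1" by (simp add: \<sigma>_def norm_divide)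
  show "w x * \<sigma> x = of_real (cmod (w x))"
  proof (cases "w x = 0")
    case False
    have "w x * \<sigma> x = (w x * cnj (w x)) / of_real (cmod (w x))" by (simp add: \<sigma>_def)
    also have "w x * cnj (w x) = of_real ((cmod (w x))\<^sup>2)" by (rule complex_norm_square[symmetric])
    finally show ?thesis using False by (simp add: power2_eq_square)
  qed (simp add: \<sigma>_def)
qed

lemma bounded_on_measurable: "bounded_on Q f \<Longrightarrow> f \<in> borel_measurable lebesgue"
  by (simp add: bounded_on_def)

lemma bounded_on_integrable:
  assumes f: "bounded_on Q f" and Q: "Q \<in> lmeasurable"
  shows "integrable lebesgue f" "f \<in> L2"
proof -
  have [measurable]: "Q \<in> sets lebesgue" "f \<in> borel_measurable lebesgue" using f Q by (auto simp: bounded_on_def)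
  obtain B where B: "\<And>x. cmod (f x) \<le> B" using f by (auto simp: bounded_on_def)
  have z: "f x = 0" if "x \<notin> Q" for x using f that by (auto simp: bounded_on_def)
  have i: "integrable lebesgue (\<lambda>x. c * indicator Q x)" for c :: real
    by (intro integrable_mult_right integrable_indicator_lmeasurable Q)
  show "integrable lebesgue f"
  proof (rule Bochner_Integration.integrable_bound[OF i[of B]])
    show "AE x in lebesgue. norm (f x) \<le> norm (B * indicator Q x)"
    proof (rule AE_I2)
      fix x show "norm (f x) \<le> norm (B * indicator Q x)"
        using z[of x] B[of x] by (cases "x \<in> Q") auto
    qed
  qed measurable
  have "integrable lebesgue (\<lambda>x. (cmod (f x))\<^sup>2)"
  proof (rule Bochner_Integration.integrable_bound[OF i[of "B\<^sup>2"]])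
    show "AE x in lebesgue. norm ((cmod (f x))\<^sup>2) \<le> norm (B\<^sup>2 * indicator Q x)"
    proof (rule AE_I2)
      fix x show "norm ((cmod (f x))\<^sup>2) \<le> norm (B\<^sup>2 * indicator Q x)"
        using z[of x] power_mono[OF B[of x], of 2] by (cases "x \<in> Q") auto
    qed
  qed measurable
  then show "f \<in> L2" by (simp add: L2_def)
qed

lemma bounded_on_diff:
  assumes "bounded_on Q f" "bounded_on Q g" shows "bounded_on Q (\<lambda>x. f x - g x)"
proof -
  obtain B C where "\<And>x. cmod (f x) \<le> B" "\<And>x. cmod (g x) \<le> C" using assms by (auto simp: bounded_on_def)
  then have "cmod (f x - g x) \<le> B + C" for x
    using norm_triangle_ineq4[of "f x" "g x"] add_mono by (meson order_trans)
  with assms show ?thesis by (auto simp: bounded_on_def)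
qed

lemma bounded_on_scale:
  assumes "bounded_on Q f" shows "bounded_on Q (\<lambda>x. c * f x)"
proof -
  obtain B where "\<And>x. cmod (f x) \<le> B" using assms by (auto simp: bounded_on_def)
  then have "cmod (c * f x) \<le> cmod c * B" for x by (simp add: norm_mult mult_left_mono)
  with assms show ?thesis by (auto simp: bounded_on_def)
qed

lemma bounded_on_indicator: "Q \<in> sets lebesgue \<Longrightarrow> bounded_on Q (indicator Q)"
  unfolding bounded_on_def by (auto intro!: exI[of _ 1] simp: indicator_def)

lemma smooth_alg_bounded_on:
  assumes "smooth_alg \<phi>" "compact Q" "\<And>x. x \<notin> Q \<Longrightarrow> \<phi> x = 0"
  shows "bounded_on Q \<phi>"
proof -
  have "continuous_on Q \<phi>"
    using smooth_alg_closed(1)[OF assms(1)] differentiable_imp_continuous_within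
    by (metis continuous_at_imp_continuous_on)
  then have "bounded (\<phi> ` Q)" using assms(2) compact_continuous_image compact_imp_bounded by blast
  then obtain B where "\<And>x. x \<in> Q \<Longrightarrow> cmod (\<phi> x) \<le> B" by (auto simp: bounded_iff)
  then have "cmod (\<phi> x) \<le> max B 0" for x using assms(3)[of x] by (cases "x \<in> Q") (auto simp: le_max_iff_disj)
  with assms show ?thesis unfolding bounded_on_def by (auto intro: smooth_alg_measurable)
qed

text \<open>With supports in one set of finite measure, L^2 convergence implies L^1 convergence,
  which the error terms of the kernel estimates need.\<close>

lemma bounded_on_L1_le:
  assumes f: "bounded_on Q f" and Q: "Q \<in> lmeasurable"
  shows "(LINT x|lebesgue. cmod (f x)) \<le> L2_norm f * L2_norm (indicator Q)"
proof -
  have "(LINT x|lebesgue. cmod (f x)) = (LINT x|lebesgue. cmod (f x * indicator Q x))"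
    using f by (intro Bochner_Integration.integral_cong) (auto simp: bounded_on_def indicator_def)
  also have "\<dots> \<le> L2_norm f * L2_norm (indicator Q)"
    using Q by (intro L2_Cauchy_Schwarz bounded_on_integrable(2)[OF f Q]
        bounded_on_integrable(2)[OF bounded_on_indicator Q]) auto
  finally show ?thesis .
qed

lemma test_approx_sequence:
  fixes f :: "('n::finite) cfun"
  assumes f: "bounded_on (cbox a b) f"
  obtains \<phi> where "\<And>n. smooth_alg (\<phi> n)" "\<And>n x. x \<notin> cbox a b \<Longrightarrow> \<phi> n x = 0"
    "(\<lambda>n. L2_norm (\<lambda>x. \<phi> n x - f x)) \<longlonglongrightarrow> 0"
proof -
  let ?Q = "cbox a b"
  obtain B where B: "\<And>x. cmod (f x) \<le> B" using f by (auto simp: bounded_on_def)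
  have "test_approx ?Q f"
    using f B by (intro test_approx_bounded[where B=B]) (auto simp: bounded_on_def)
  then have "\<forall>n. \<exists>\<phi>. smooth_alg \<phi> \<and> (\<forall>x. x \<notin> ?Q \<longrightarrow> \<phi> x = 0) \<and> l2_dist \<phi> f < ennreal ((1 / real (Suc n))\<^sup>2)"
    unfolding test_approx_def by simp
  then obtain \<phi> where \<phi>: "\<And>n. smooth_alg (\<phi> n)" "\<And>n x. x \<notin> ?Q \<Longrightarrow> \<phi> n x = 0"
      "\<And>n. l2_dist (\<phi> n) f < ennreal ((1 / real (Suc n))\<^sup>2)"
    by metis
  have "L2_norm (\<lambda>x. \<phi> n x - f x) \<le> 1 / real (Suc n)" for n
  proof -
    have "bounded_on ?Q (\<lambda>x. \<phi> n x - f x)"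
      using smooth_alg_bounded_on[OF \<phi>(1) _ \<phi>(2)] f by (intro bounded_on_diff) auto
    then have "(\<lambda>x. \<phi> n x - f x) \<in> L2" by (rule bounded_on_integrable(2)) simp
    then have "integrable lebesgue (\<lambda>x. (cmod (\<phi> n x - f x))\<^sup>2)" by (simp add: L2_def)
    then have "ennreal (LINT x|lebesgue. (cmod (\<phi> n x - f x))\<^sup>2) = l2_dist (\<phi> n) f"
      unfolding l2_dist_def by (intro nn_integral_eq_integral[symmetric]) auto
    also have "\<dots> \<le> ennreal ((1 / real (Suc n))\<^sup>2)" using \<phi>(3)[of n] by simp
    finally have "(L2_norm (\<lambda>x. \<phi> n x - f x))\<^sup>2 \<le> (1 / real (Suc n))\<^sup>2"
      unfolding L2_norm_square by (rule ennreal_le_iff[THEN iffD1, rotated]) simp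
    then show ?thesis by (rule power2_le_imp_le) simp
  qed
  then have "(\<lambda>n. L2_norm (\<lambda>x. \<phi> n x - f x)) \<longlonglongrightarrow> 0"
    by (intro Lim_null_comparison[OF always_eventually LIMSEQ_inverse_real_of_nat] allI)
      (simp add: L2_norm_nonneg inverse_eq_divide)
  with \<phi>(1,2) show thesis by (rule that)
qed

section \<open>Bounded operators and their pairings with test functions\<close>

definition bounded_L2_op :: "(('n::finite) cfun \<Rightarrow> 'n cfun) \<Rightarrow> bool" where
  "bounded_L2_op U \<longleftrightarrow>
     (\<forall>f\<in>L2. U f \<in> L2) \<and>
     (\<forall>f\<in>L2. \<forall>g\<in>L2. AE x in lebesgue. U (\<lambda>x. f x + g x) x = U f x + U g x) \<and>
     (\<forall>c. \<forall>f\<in>L2. AE x in lebesgue. U (\<lambda>x. c * f x) x = c * U f x) \<and>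
     (\<exists>C. \<forall>f\<in>L2. L2_norm (U f) \<le> C * L2_norm f)"

text \<open>Forgetting \<open>T\<close> lets the same limit arguments serve the extensions of
  \<open>T\<close> and those of its transpose.\<close>

lemma L2_extension_bounded: "L2_extension T U \<Longrightarrow> bounded_L2_op U"
  by (simp add: L2_extension_def bounded_L2_op_def)

lemma bounded_L2_op_in: "bounded_L2_op U \<Longrightarrow> f \<in> L2 \<Longrightarrow> U f \<in> L2"
  by (simp add: bounded_L2_op_def)

lemma bounded_L2_op_combination:
  assumes U: "bounded_L2_op U" and f: "f \<in> L2" and g: "g \<in> L2"
  shows "AE x in lebesgue. U (\<lambda>x. c * f x - g x) x = c * U f x - U g x"
proof -
  have "(\<lambda>x. c * f x) \<in> L2" "(\<lambda>x. (-1) * g x) \<in> L2" by (rule L2_scale[OF f] L2_scale[OF g])+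
  moreover have "\<forall>f\<in>L2. \<forall>g\<in>L2. AE x in lebesgue. U (\<lambda>x. f x + g x) x = U f x + U g x"
    using U unfolding bounded_L2_op_def by (elim conjE)
  ultimately have "AE x in lebesgue. U (\<lambda>x. c * f x + (-1) * g x) x = U (\<lambda>x. c * f x) x + U (\<lambda>x. (-1) * g x) x"
    by (elim ballE[of _ _ "\<lambda>x. c * f x"] ballE[of _ _ "\<lambda>x. (-1) * g x"]) auto
  moreover have "AE x in lebesgue. U (\<lambda>x. c * f x) x = c * U f x"
    using U f unfolding bounded_L2_op_def by blast
  moreover have "AE x in lebesgue. U (\<lambda>x. (-1) * g x) x = (-1) * U g x"
    using U g unfolding bounded_L2_op_def by blast
  ultimately show ?thesis by eventually_elim simp
qed

lemma bounded_L2_op_diff: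
  assumes U: "bounded_L2_op U"
  obtains C where "0 \<le> C" "\<And>f g. f \<in> L2 \<Longrightarrow> g \<in> L2 \<Longrightarrow> L2_norm (\<lambda>x. U f x - U g x) \<le> C * L2_norm (\<lambda>x. f x - g x)"
proof -
  obtain C where "\<forall>f\<in>L2. L2_norm (U f) \<le> C * L2_norm f" using U unfolding bounded_L2_op_def by blast
  then have C: "L2_norm (U f) \<le> C * L2_norm f" if "f \<in> L2" for f using that by blast
  show thesis
  proof (rule that[of "\<bar>C\<bar>"])
    fix f g :: "'a cfun" assume f: "f \<in> L2" and g: "g \<in> L2"
    have "(LINT x|lebesgue. (cmod (U f x - U g x))\<^sup>2) = (LINT x|lebesgue. (cmod (U (\<lambda>x. f x - g x) x))\<^sup>2)"
    proof (rule integral_cong_AE)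
      have "U f \<in> L2" "U g \<in> L2" "U (\<lambda>x. f x - g x) \<in> L2"
        using f g L2_diff U by (auto intro: bounded_L2_op_in)
      then show "(\<lambda>x. (cmod (U f x - U g x))\<^sup>2) \<in> borel_measurable lebesgue"
        "(\<lambda>x. (cmod (U (\<lambda>x. f x - g x) x))\<^sup>2) \<in> borel_measurable lebesgue" by (auto simp: L2_def)
      show "AE x in lebesgue. (cmod (U f x - U g x))\<^sup>2 = (cmod (U (\<lambda>x. f x - g x) x))\<^sup>2"
        using bounded_L2_op_combination[OF U f g, of 1] by eventually_elim simp
    qed
    then have "L2_norm (\<lambda>x. U f x - U g x) = L2_norm (U (\<lambda>x. f x - g x))" by (simp add: L2_norm_def)
    also have "\<dots> \<le> C * L2_norm (\<lambda>x. f x - g x)" using f g by (intro C L2_diff)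
    also have "\<dots> \<le> \<bar>C\<bar> * L2_norm (\<lambda>x. f x - g x)" by (intro mult_right_mono L2_norm_nonneg) simp
    finally show "L2_norm (\<lambda>x. U f x - U g x) \<le> \<bar>C\<bar> * L2_norm (\<lambda>x. f x - g x)" .
  qed simp
qed

lemma integral_add3:
  fixes a b c :: "'a \<Rightarrow> complex"
  assumes "integrable M a" "integrable M b" "integrable M c"
  shows "(LINT x|M. a x + b x + c x) = (LINT x|M. a x) + (LINT x|M. b x) + (LINT x|M. c x)"
  using assms by simp

lemma bounded_L2_op_pairing_tendsto:
  assumes U: "bounded_L2_op U" and f: "f \<in> L2" and g: "g \<in> L2"
    and fn: "\<And>n. \<phi> n \<in> L2" and gn: "\<And>n. \<psi> n \<in> L2"
    and cf: "(\<lambda>n. L2_norm (\<lambda>x. \<phi> n x - f x)) \<longlonglongrightarrow> 0"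
    and cg: "(\<lambda>n. L2_norm (\<lambda>x. \<psi> n x - g x)) \<longlonglongrightarrow> 0"
  shows "(\<lambda>n. LINT x|lebesgue. U (\<phi> n) x * \<psi> n x) \<longlonglongrightarrow> (LINT x|lebesgue. U f x * g x)"
proof -
  obtain C where C: "0 \<le> C" "\<And>f g. f \<in> L2 \<Longrightarrow> g \<in> L2 \<Longrightarrow> L2_norm (\<lambda>x. U f x - U g x) \<le> C * L2_norm (\<lambda>x. f x - g x)"
    using bounded_L2_op_diff[OF U] by blast
  have in2: "U (\<phi> n) \<in> L2" "U f \<in> L2" for n using fn f by (auto intro: bounded_L2_op_in[OF U])
  let ?a = "\<lambda>n. L2_norm (\<lambda>x. \<phi> n x - f x)" and ?b = "\<lambda>n. L2_norm (\<lambda>x. \<psi> n x - g x)"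
  have "cmod ((LINT x|lebesgue. U (\<phi> n) x * \<psi> n x) - (LINT x|lebesgue. U f x * g x))
    \<le> C * ?a n * ?b n + C * ?a n * L2_norm g + L2_norm (U f) * ?b n" for n
  proof -
    let ?d = "\<lambda>x. U (\<phi> n) x - U f x" and ?e = "\<lambda>x. \<psi> n x - g x"
    have d: "?d \<in> L2" and e: "?e \<in> L2" using in2 gn g by (auto intro: L2_diff)
    have "(LINT x|lebesgue. U (\<phi> n) x * \<psi> n x) - (LINT x|lebesgue. U f x * g x)
      = (LINT x|lebesgue. U (\<phi> n) x * \<psi> n x - U f x * g x)"
      using in2 gn g by (intro Bochner_Integration.integral_diff[symmetric] L2_integrable_mult) auto
    also have "\<dots> = (LINT x|lebesgue. ?d x * ?e x + ?d x * g x + U f x * ?e x)"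
      by (intro Bochner_Integration.integral_cong) (auto simp: algebra_simps)
    also have "\<dots> = (LINT x|lebesgue. ?d x * ?e x) + (LINT x|lebesgue. ?d x * g x) + (LINT x|lebesgue. U f x * ?e x)"
      by (rule integral_add3[OF L2_integrable_mult[OF d e] L2_integrable_mult[OF d g] L2_integrable_mult[OF in2(2) e]])
    finally have "cmod ((LINT x|lebesgue. U (\<phi> n) x * \<psi> n x) - (LINT x|lebesgue. U f x * g x))
      = cmod ((LINT x|lebesgue. ?d x * ?e x) + (LINT x|lebesgue. ?d x * g x) + (LINT x|lebesgue. U f x * ?e x))"
      by (rule arg_cong)
    also have "\<dots> \<le> L2_norm ?d * L2_norm ?e + L2_norm ?d * L2_norm g + L2_norm (U f) * L2_norm ?e"
      by (rule norm_triangle_mono[OF norm_triangle_mono[OF L2_pairing_bound[OF d e] L2_pairing_bound[OF d g]]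
        L2_pairing_bound[OF in2(2) e]])
    also have "\<dots> \<le> C * ?a n * ?b n + C * ?a n * L2_norm g + L2_norm (U f) * ?b n"
      using C(2)[OF fn f] by (intro add_mono mult_right_mono L2_norm_nonneg order.refl) auto
    finally show ?thesis .
  qed
  note bound = this
  have "(\<lambda>n. C * ?a n * ?b n + C * ?a n * L2_norm g + L2_norm (U f) * ?b n) \<longlonglongrightarrow>
     C * 0 * 0 + C * 0 * L2_norm g + L2_norm (U f) * 0"
    by (intro tendsto_add tendsto_mult tendsto_const cf cg)
  then have lim: "(\<lambda>n. C * ?a n * ?b n + C * ?a n * L2_norm g + L2_norm (U f) * ?b n) \<longlonglongrightarrow> 0"
    by simp
  have "(\<lambda>n. (LINT x|lebesgue. U (\<phi> n) x * \<psi> n x) - (LINT x|lebesgue. U f x * g x)) \<longlonglongrightarrow> 0"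
    by (rule Lim_null_comparison[OF always_eventually lim]) (rule allI, rule bound)
  then show ?thesis by (simp add: LIM_zero_iff)
qed

lemma bounded_on_integral_tendsto:
  assumes f: "bounded_on Q f" and fn: "\<And>n. bounded_on Q (\<phi> n)" and Q: "Q \<in> lmeasurable"
    and c: "(\<lambda>n. L2_norm (\<lambda>x. \<phi> n x - f x)) \<longlonglongrightarrow> 0"
  shows "(\<lambda>n. LINT x|lebesgue. \<phi> n x) \<longlonglongrightarrow> (LINT x|lebesgue. f x)"
    and "(\<lambda>n. LINT x|lebesgue. cmod (\<phi> n x)) \<longlonglongrightarrow> (LINT x|lebesgue. cmod (f x))"
proof -
  let ?I = "\<lambda>n. LINT x|lebesgue. cmod (\<phi> n x - f x)"
  have i: "integrable lebesgue f" "integrable lebesgue (\<phi> n)" for n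
    using bounded_on_integrable(1)[OF f Q] bounded_on_integrable(1)[OF fn Q] by auto
  have "norm (?I n) \<le> L2_norm (\<lambda>x. \<phi> n x - f x) * L2_norm (indicator Q)" for n
    using bounded_on_L1_le[OF bounded_on_diff[OF fn f] Q] by simp
  note bound = this
  have lim: "(\<lambda>n. L2_norm (\<lambda>x. \<phi> n x - f x) * L2_norm (indicator Q)) \<longlonglongrightarrow> 0"
    using tendsto_mult_right[OF c] by simp
  have I: "?I \<longlonglongrightarrow> 0"
    by (rule Lim_null_comparison[OF always_eventually lim]) (rule allI, rule bound)
  have "(\<lambda>n. (LINT x|lebesgue. \<phi> n x) - (LINT x|lebesgue. f x)) \<longlonglongrightarrow> 0"
  proof (rule Lim_null_comparison[OF always_eventually I], rule allI)
    fix n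
    have "(LINT x|lebesgue. \<phi> n x) - (LINT x|lebesgue. f x) = (LINT x|lebesgue. \<phi> n x - f x)"
      using i by simp
    then show "norm ((LINT x|lebesgue. \<phi> n x) - (LINT x|lebesgue. f x)) \<le> ?I n"
      by (simp only: integral_norm_bound)
  qed
  then show "(\<lambda>n. LINT x|lebesgue. \<phi> n x) \<longlonglongrightarrow> (LINT x|lebesgue. f x)" by (simp only: LIM_zero_iff)
  have "(\<lambda>n. (LINT x|lebesgue. cmod (\<phi> n x)) - (LINT x|lebesgue. cmod (f x))) \<longlonglongrightarrow> 0"
  proof (rule Lim_null_comparison[OF always_eventually I], rule allI)
    fix n
    have "(LINT x|lebesgue. cmod (\<phi> n x)) - (LINT x|lebesgue. cmod (f x)) = (LINT x|lebesgue. cmod (\<phi> n x) - cmod (f x))"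
      using i by simp
    also have "norm \<dots> \<le> (LINT x|lebesgue. norm (cmod (\<phi> n x) - cmod (f x)))" by (rule integral_norm_bound)
    also have "\<dots> \<le> ?I n"
      using i by (intro integral_mono) (auto intro: norm_triangle_ineq3)
    finally show "norm ((LINT x|lebesgue. cmod (\<phi> n x)) - (LINT x|lebesgue. cmod (f x))) \<le> ?I n" .
  qed
  then show "(\<lambda>n. LINT x|lebesgue. cmod (\<phi> n x)) \<longlonglongrightarrow> (LINT x|lebesgue. cmod (f x))" by (simp only: LIM_zero_iff)
qed

text \<open>Both sides are continuous under L^2 convergence with supports kept in the two boxes, so
  an estimate for smooth functions extends to bounded ones. Density with support in the box itself
  is what makes this possible.\<close>

lemma pairing_estimate_extend:
  fixes U :: "('n::finite) cfun \<Rightarrow> 'n cfun"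
  assumes U: "bounded_L2_op U" and f: "bounded_on (cbox a b) f" and g: "bounded_on (cbox a' b') g"
    and est: "\<And>\<phi> \<psi>. smooth_alg \<phi> \<Longrightarrow> smooth_alg \<psi> \<Longrightarrow> (\<And>x. x \<notin> cbox a b \<Longrightarrow> \<phi> x = 0) \<Longrightarrow> (\<And>x. x \<notin> cbox a' b' \<Longrightarrow> \<psi> x = 0) \<Longrightarrow>
      cmod ((LINT x|lebesgue. U \<phi> x * \<psi> x) - \<kappa> * (LINT x|lebesgue. \<phi> x) * (LINT x|lebesgue. \<psi> x))
        \<le> \<epsilon> * (LINT x|lebesgue. cmod (\<phi> x)) * (LINT x|lebesgue. cmod (\<psi> x))"
  shows "cmod ((LINT x|lebesgue. U f x * g x) - \<kappa> * (LINT x|lebesgue. f x) * (LINT x|lebesgue. g x))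
        \<le> \<epsilon> * (LINT x|lebesgue. cmod (f x)) * (LINT x|lebesgue. cmod (g x))"
proof -
  obtain \<phi> where \<phi>: "\<And>n. smooth_alg (\<phi> n)" "\<And>n x. x \<notin> cbox a b \<Longrightarrow> \<phi> n x = 0"
    "(\<lambda>n. L2_norm (\<lambda>x. \<phi> n x - f x)) \<longlonglongrightarrow> 0" using test_approx_sequence[OF f] by blast
  obtain \<psi> where \<psi>: "\<And>n. smooth_alg (\<psi> n)" "\<And>n x. x \<notin> cbox a' b' \<Longrightarrow> \<psi> n x = 0"
    "(\<lambda>n. L2_norm (\<lambda>x. \<psi> n x - g x)) \<longlonglongrightarrow> 0" using test_approx_sequence[OF g] by blast
  have b\<phi>: "bounded_on (cbox a b) (\<phi> n)" for n using \<phi> by (intro smooth_alg_bounded_on) auto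
  have b\<psi>: "bounded_on (cbox a' b') (\<psi> n)" for n using \<psi> by (intro smooth_alg_bounded_on) auto
  have lm: "cbox a b \<in> lmeasurable" "cbox a' b' \<in> lmeasurable" by auto
  note tf = bounded_on_integral_tendsto[OF f b\<phi> lm(1) \<phi>(3)]
  note tg = bounded_on_integral_tendsto[OF g b\<psi> lm(2) \<psi>(3)]
  have tU: "(\<lambda>n. LINT x|lebesgue. U (\<phi> n) x * \<psi> n x) \<longlonglongrightarrow> (LINT x|lebesgue. U f x * g x)"
    by (intro bounded_L2_op_pairing_tendsto U \<phi>(3) \<psi>(3) bounded_on_integrable(2)[OF f lm(1)]
      bounded_on_integrable(2)[OF g lm(2)] bounded_on_integrable(2)[OF b\<phi> lm(1)] bounded_on_integrable(2)[OF b\<psi> lm(2)])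
  show ?thesis
  proof (rule LIMSEQ_le)
    show "(\<lambda>n. cmod ((LINT x|lebesgue. U (\<phi> n) x * \<psi> n x) - \<kappa> * (LINT x|lebesgue. \<phi> n x) * (LINT x|lebesgue. \<psi> n x)))
      \<longlonglongrightarrow> cmod ((LINT x|lebesgue. U f x * g x) - \<kappa> * (LINT x|lebesgue. f x) * (LINT x|lebesgue. g x))"
      by (intro tendsto_intros tU tf tg)
    show "(\<lambda>n. \<epsilon> * (LINT x|lebesgue. cmod (\<phi> n x)) * (LINT x|lebesgue. cmod (\<psi> n x)))
      \<longlonglongrightarrow> \<epsilon> * (LINT x|lebesgue. cmod (f x)) * (LINT x|lebesgue. cmod (g x))"
      by (intro tendsto_intros tf tg)
    show "\<exists>N. \<forall>n\<ge>N. cmod ((LINT x|lebesgue. U (\<phi> n) x * \<psi> n x) - \<kappa> * (LINT x|lebesgue. \<phi> n x) * (LINT x|lebesgue. \<psi> n x))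
      \<le> \<epsilon> * (LINT x|lebesgue. cmod (\<phi> n x)) * (LINT x|lebesgue. cmod (\<psi> n x))"
    proof (intro exI[of _ 0] allI impI)
      fix n :: nat
      show "cmod ((LINT x|lebesgue. U (\<phi> n) x * \<psi> n x) - \<kappa> * (LINT x|lebesgue. \<phi> n x) * (LINT x|lebesgue. \<psi> n x))
        \<le> \<epsilon> * (LINT x|lebesgue. cmod (\<phi> n x)) * (LINT x|lebesgue. cmod (\<psi> n x))"
        by (rule est[OF \<phi>(1) \<psi>(1) \<phi>(2) \<psi>(2)])
    qed
  qed
qed

text \<open>Test with the conjugate sign of \<open>w\<close> on the set where |w| > E. Then the
  integral of |w| - E over this set is at most 0 although the integrand is positive there, so the
  set is null.\<close>

lemma AE_bounded_by_testing:
  fixes w :: "('n::finite) cfun"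
  assumes w: "set_integrable lebesgue Q w" and Q: "Q \<in> lmeasurable" and E: "0 \<le> E"
    and test: "\<And>f. bounded_on Q f \<Longrightarrow> cmod (LINT x|lebesgue. w x * f x) \<le> E * (LINT x|lebesgue. cmod (f x))"
  shows "AE x in lebesgue. x \<in> Q \<longrightarrow> cmod (w x) \<le> E"
proof -
  have [measurable]: "Q \<in> sets lebesgue" using Q by auto
  define v where "v x = indicator Q x *\<^sub>R w x" for x
  have vi: "integrable lebesgue v" using w by (simp add: set_integrable_def v_def[abs_def])
  then have [measurable]: "v \<in> borel_measurable lebesgue" by auto
  define P where "P = {x. E < cmod (v x)}"
  have "{x \<in> space lebesgue. E < cmod (v x)} \<in> sets lebesgue" by measurable
  then have [measurable]: "P \<in> sets lebesgue" by (simp add: P_def)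
  have PQ: "P \<subseteq> Q" using E by (auto simp: P_def v_def indicator_def split: if_splits)
  have Pm: "P \<in> lmeasurable" using Q PQ by (rule fmeasurableI2) measurable
  define \<sigma> where "\<sigma> x = cnj (v x) / of_real (cmod (v x))" for x
  note \<sigma> = conjugate_sign[of v, folded \<sigma>_def]
  define f where "f x = indicator P x * \<sigma> x" for x
  have [measurable]: "\<sigma> \<in> borel_measurable lebesgue"
    unfolding \<sigma>_def[abs_def] by (rule conjugate_sign(1)) measurable
  have nf: "cmod (f x) \<le> indicator P x" for x
    using \<sigma>(2)[of x] by (simp add: f_def indicator_def)
  have fb: "bounded_on Q f"
    unfolding bounded_on_def
  proof (intro conjI exI allI impI)
    show "f \<in> borel_measurable lebesgue" unfolding f_def[abs_def] by measurable
    show "cmod (f x) \<le> 1" for x using nf[of x] by (cases "x \<in> P") auto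
    show "f x = 0" if "x \<notin> Q" for x
    proof -
      have "x \<notin> P" using that PQ by blast
      then show ?thesis by (simp add: f_def)
    qed
  qed
  have wf: "w x * f x = of_real (cmod (v x) * indicator P x)" for x
  proof (cases "x \<in> P")
    case True
    then have "w x = v x" using PQ by (auto simp: v_def)
    then show ?thesis using True \<sigma>(3)[of x] by (simp add: f_def)
  qed (simp add: f_def)
  have i1: "integrable lebesgue (\<lambda>x. cmod (v x) * indicator P x)"
    using integrable_real_mult_indicator[OF _ integrable_norm[OF vi], of P] by simp
  have i2: "integrable lebesgue (\<lambda>x. E * indicator P x)"
    by (intro integrable_mult_right integrable_indicator_lmeasurable Pm)
  have "(LINT x|lebesgue. cmod (v x) * indicator P x) \<le> cmod (LINT x|lebesgue. w x * f x)"
    unfolding wf integral_complex_of_real norm_of_real by simp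
  also have "\<dots> \<le> E * (LINT x|lebesgue. cmod (f x))" by (rule test[OF fb])
  also have "\<dots> \<le> E * (LINT x|lebesgue. indicator P x)"
    using bounded_on_integrable(1)[OF fb Q] nf E
    by (intro mult_left_mono integral_mono integrable_norm integrable_indicator_lmeasurable Pm)
  also have "\<dots> = (LINT x|lebesgue. E * indicator P x)" by simp
  finally have le: "(LINT x|lebesgue. cmod (v x) * indicator P x) \<le> (LINT x|lebesgue. E * indicator P x)" .
  let ?d = "\<lambda>x. cmod (v x) * indicator P x - E * indicator P x"
  have i3: "integrable lebesgue ?d" using i1 i2 by (rule Bochner_Integration.integrable_diff)
  have nn: "0 \<le> ?d x" for x by (auto simp: P_def indicator_def)
  have "(LINT x|lebesgue. ?d x) \<le> 0"
    unfolding Bochner_Integration.integral_diff[OF i1 i2] using le by simp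
  moreover have "0 \<le> (LINT x|lebesgue. ?d x)" by (rule Bochner_Integration.integral_nonneg) (rule nn)
  ultimately have "(LINT x|lebesgue. ?d x) = 0" by (rule antisym)
  moreover have "AE x in lebesgue. 0 \<le> ?d x" using nn by (intro AE_I2)
  ultimately have "AE x in lebesgue. ?d x = 0"
    using integral_nonneg_eq_0_iff_AE[OF i3] by blast
  then show ?thesis
  proof eventually_elim
    case (elim x)
    show ?case
    proof
      assume "x \<in> Q"
      then have vw: "v x = w x" by (simp add: v_def)
      show "cmod (w x) \<le> E"
      proof (rule ccontr)
        assume "\<not> cmod (w x) \<le> E"
        moreover from this have "x \<in> P" by (simp add: P_def vw)
        ultimately show False using elim vw by simp
      qed
    qed
  qed
qed

section \<open>Local approximation of Calderon--Zygmund operators by a constant kernel\<close>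

text \<open>The first kernel variable lives in \<open>Q'\<close>, where the operator is evaluated,
  and the integration variable in \<open>Q\<close>. Continuity provides the measurability of the
  kernel integrals.\<close>

definition kernel_near ::
  "(real ^ 'n \<Rightarrow> real ^ 'n \<Rightarrow> complex) \<Rightarrow> complex \<Rightarrow> real \<Rightarrow> (real ^ 'n) set \<Rightarrow> (real ^ 'n) set \<Rightarrow> bool" where
  "kernel_near K \<kappa> \<epsilon> Q Q' \<longleftrightarrow>
     (\<forall>x\<in>Q'. continuous_on Q (K x) \<and> (\<forall>y\<in>Q. cmod (K x y - \<kappa>) \<le> \<epsilon>))"

lemma kernel_integral_estimate:
  fixes K :: "real ^ 'n \<Rightarrow> real ^ 'n \<Rightarrow> complex"
  assumes K: "kernel_near K \<kappa> \<epsilon> Q Q'" and Q: "compact Q" and x: "x \<in> Q'" and f: "bounded_on Q f"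
  shows "cmod ((LINT y|lebesgue. K x y * f y) - \<kappa> * (LINT y|lebesgue. f y)) \<le> \<epsilon> * (LINT y|lebesgue. cmod (f y))"
proof -
  \<comment> \<open>Cutting off the kernel outside \<open>Q\<close> gives a measurable function on
    the whole space; nothing is known of the values of \<open>K\<close> on the diagonal.\<close>
  define h where "h y = indicator Q y *\<^sub>R K x y" for y
  have Qm: "Q \<in> lmeasurable" using Q by (rule lmeasurable_compact)
  have cont: "continuous_on Q (K x)" and near: "\<And>y. y \<in> Q \<Longrightarrow> cmod (K x y - \<kappa>) \<le> \<epsilon>"
    using K x by (auto simp: kernel_near_def)
  have "(\<lambda>y. indicator Q y *\<^sub>R K x y) \<in> borel_measurable borel"
    using cont Q by (intro borel_measurable_continuous_on_indicator) (auto simp: compact_imp_closed borel_closed)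
  then have hm: "h \<in> borel_measurable lebesgue"
    unfolding h_def[abs_def] by (simp add: measurable_completion)
  have fi: "integrable lebesgue f" by (rule bounded_on_integrable(1)[OF f Qm])
  have fz: "f y = 0" if "y \<notin> Q" for y using f that by (simp add: bounded_on_def)
  have pw: "cmod ((h y - \<kappa>) * f y) \<le> \<epsilon> * cmod (f y)" for y
    using near[of y] fz[of y] by (cases "y \<in> Q") (auto simp: h_def norm_mult intro: mult_right_mono)
  have int: "integrable lebesgue (\<lambda>y. (h y - \<kappa>) * f y)"
  proof (rule Bochner_Integration.integrable_bound)
    show "integrable lebesgue (\<lambda>y. \<epsilon> * cmod (f y))" using fi by simp
    show "(\<lambda>y. (h y - \<kappa>) * f y) \<in> borel_measurable lebesgue"
      using hm borel_measurable_integrable[OF fi] by measurable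
    show "AE y in lebesgue. norm ((h y - \<kappa>) * f y) \<le> norm (\<epsilon> * cmod (f y))"
      using pw order_trans[OF pw abs_ge_self] by (intro AE_I2) simp
  qed
  have "(LINT y|lebesgue. K x y * f y) = (LINT y|lebesgue. (h y - \<kappa>) * f y + \<kappa> * f y)"
    by (rule Bochner_Integration.integral_cong) (use fz in \<open>auto simp: h_def indicator_def algebra_simps\<close>)
  also have "\<dots> = (LINT y|lebesgue. (h y - \<kappa>) * f y) + (LINT y|lebesgue. \<kappa> * f y)"
    using int fi by (intro Bochner_Integration.integral_add) simp_all
  finally have "(LINT y|lebesgue. K x y * f y) - \<kappa> * (LINT y|lebesgue. f y) = (LINT y|lebesgue. (h y - \<kappa>) * f y)"
    by simp
  then have "cmod ((LINT y|lebesgue. K x y * f y) - \<kappa> * (LINT y|lebesgue. f y)) \<le> (LINT y|lebesgue. cmod ((h y - \<kappa>) * f y))"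
    by (simp only: integral_norm_bound)
  also have "\<dots> \<le> (LINT y|lebesgue. \<epsilon> * cmod (f y))"
    using int fi pw by (intro integral_mono) simp_all
  finally show ?thesis by simp
qed

text \<open>The conclusion speaks of \<open>T\<close> rather than of the extension that carries the
  kernel formula, so it transfers to every other extension and to the transpose. Disjointness of the
  sets puts all of \<open>Q'\<close> off the support of \<phi>.\<close>

lemma smooth_pairing_estimate:
  fixes T :: "('n::finite) dist_op"
  assumes U: "L2_extension T U"
    and rep: "\<And>f. f \<in> Cc_infty \<Longrightarrow> AE x in lebesgue. x \<notin> supp f \<longrightarrow> U f x = (LINT y|lebesgue. K x y * f y)"
    and K: "kernel_near K \<kappa> \<epsilon> Q Q'" and Q: "compact Q" "compact Q'" "Q \<inter> Q' = {}"
    and \<phi>: "smooth_alg \<phi>" "\<And>x. x \<notin> Q \<Longrightarrow> \<phi> x = 0" and \<psi>: "smooth_alg \<psi>" "\<And>x. x \<notin> Q' \<Longrightarrow> \<psi> x = 0"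
  shows "cmod (T \<phi> \<psi> - \<kappa> * (LINT x|lebesgue. \<phi> x) * (LINT x|lebesgue. \<psi> x))
    \<le> \<epsilon> * (LINT x|lebesgue. cmod (\<phi> x)) * (LINT x|lebesgue. cmod (\<psi> x))"
proof -
  have C: "\<phi> \<in> Cc_infty" "\<psi> \<in> Cc_infty"
    using smooth_alg_Cc_infty[OF \<phi>(1) Q(1) \<phi>(2)] smooth_alg_Cc_infty[OF \<psi>(1) Q(2) \<psi>(2)] by auto
  then have S: "\<phi> \<in> schwartz" "\<psi> \<in> schwartz" using Cc_infty_schwartz by auto
  have Qm: "Q \<in> lmeasurable" "Q' \<in> lmeasurable" using Q by (auto intro: lmeasurable_compact)
  have b: "bounded_on Q \<phi>" "bounded_on Q' \<psi>"
    using smooth_alg_bounded_on[OF \<phi>(1) Q(1) \<phi>(2)] smooth_alg_bounded_on[OF \<psi>(1) Q(2) \<psi>(2)] by auto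
  have L: "\<phi> \<in> L2" "\<psi> \<in> L2" using bounded_on_integrable(2)[OF b(1) Qm(1)] bounded_on_integrable(2)[OF b(2) Qm(2)] by auto
  have Ul: "U \<phi> \<in> L2" using L2_extension_bounded[OF U] L(1) by (rule bounded_L2_op_in)
  have \<psi>i: "integrable lebesgue \<psi>" by (rule bounded_on_integrable(1)[OF b(2) Qm(2)])
  define I where "I = (LINT x|lebesgue. \<phi> x)"
  define J where "J = (LINT x|lebesgue. cmod (\<phi> x))"
  have "T \<phi> \<psi> = (LINT x|lebesgue. U \<phi> x * \<psi> x)" using U S by (simp add: L2_extension_def)
  then have eq: "T \<phi> \<psi> - \<kappa> * I * (LINT x|lebesgue. \<psi> x) = (LINT x|lebesgue. U \<phi> x * \<psi> x - \<kappa> * I * \<psi> x)"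
    using L2_integrable_mult[OF Ul L(2)] \<psi>i by simp
  have int: "integrable lebesgue (\<lambda>x. U \<phi> x * \<psi> x - \<kappa> * I * \<psi> x)"
    using L2_integrable_mult[OF Ul L(2)] \<psi>i by simp
  have "cmod (T \<phi> \<psi> - \<kappa> * I * (LINT x|lebesgue. \<psi> x)) \<le> (LINT x|lebesgue. cmod (U \<phi> x * \<psi> x - \<kappa> * I * \<psi> x))"
    unfolding eq by (rule integral_norm_bound)
  also have "\<dots> \<le> (LINT x|lebesgue. \<epsilon> * J * cmod (\<psi> x))"
  proof (rule integral_mono_AE)
    show "integrable lebesgue (\<lambda>x. cmod (U \<phi> x * \<psi> x - \<kappa> * I * \<psi> x))" using int by (rule integrable_norm)
    show "integrable lebesgue (\<lambda>x. \<epsilon> * J * cmod (\<psi> x))" using \<psi>i by simp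
    show "AE x in lebesgue. cmod (U \<phi> x * \<psi> x - \<kappa> * I * \<psi> x) \<le> \<epsilon> * J * cmod (\<psi> x)"
      using rep[OF C(1)]
    proof eventually_elim
      case (elim x)
      show ?case
      proof (cases "x \<in> Q'")
        case True
        then have "x \<notin> Q" using Q by auto
        then have "x \<notin> supp \<phi>" using compact_suppI(2)[of Q \<phi>, OF Q(1) \<phi>(2)] by auto
        then have "U \<phi> x * \<psi> x - \<kappa> * I * \<psi> x = ((LINT y|lebesgue. K x y * \<phi> y) - \<kappa> * I) * \<psi> x"
          using elim by (simp add: left_diff_distrib)
        then have "cmod (U \<phi> x * \<psi> x - \<kappa> * I * \<psi> x) = cmod ((LINT y|lebesgue. K x y * \<phi> y) - \<kappa> * I) * cmod (\<psi> x)"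
          by (simp only: norm_mult)
        also have "\<dots> \<le> \<epsilon> * J * cmod (\<psi> x)"
          unfolding I_def J_def by (intro mult_right_mono kernel_integral_estimate[OF K Q(1) True b(1)]) simp
        finally show ?thesis .
      qed (simp add: \<psi>(2))
    qed
  qed
  also have "\<dots> = \<epsilon> * J * (LINT x|lebesgue. cmod (\<psi> x))" by simp
  finally show ?thesis unfolding I_def J_def .
qed

text \<open>Here \<open>U\<close> is an arbitrary extension, while the kernel formula belongs to a
  possibly different one, \<open>U0\<close>. Both reproduce \<open>T\<close> on smooth functions
  supported in the cubes, and density does the rest.\<close>

lemma cz_pairing_estimate:
  fixes T :: "('n::finite) dist_op"
  assumes T: "cz_operator K T" and U: "L2_extension T U"
    and K: "kernel_near K \<kappa> \<epsilon> (cube c l) (cube c' l)" and dj: "cube c l \<inter> cube c' l = {}"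
    and f: "bounded_on (cube c l) f" and g: "bounded_on (cube c' l) g"
  shows "cmod ((LINT x|lebesgue. U f x * g x) - \<kappa> * (LINT x|lebesgue. f x) * (LINT x|lebesgue. g x))
    \<le> \<epsilon> * (LINT x|lebesgue. cmod (f x)) * (LINT x|lebesgue. cmod (g x))"
proof -
  obtain U0 where U0: "L2_extension T U0"
    and "\<forall>f\<in>Cc_infty. AE x in lebesgue. x \<notin> supp f \<longrightarrow> U0 f x = (LINT y|lebesgue. K x y * f y)"
    using T by (auto simp: cz_operator_def)
  then have rep: "\<And>f. f \<in> Cc_infty \<Longrightarrow> AE x in lebesgue. x \<notin> supp f \<longrightarrow> U0 f x = (LINT y|lebesgue. K x y * f y)"
    by blast
  show ?thesis
  proof (rule pairing_estimate_extend[OF L2_extension_bounded[OF U] f[unfolded cube_eq_cbox] g[unfolded cube_eq_cbox], folded cube_eq_cbox])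
    fix \<phi> \<psi> :: "'n cfun"
    assume a: "smooth_alg \<phi>" "smooth_alg \<psi>" "\<And>x. x \<notin> cube c l \<Longrightarrow> \<phi> x = 0" "\<And>x. x \<notin> cube c' l \<Longrightarrow> \<psi> x = 0"
    then have "\<phi> \<in> schwartz" "\<psi> \<in> schwartz"
      using smooth_alg_Cc_infty[OF _ cube_compact] Cc_infty_schwartz by blast+
    then have "(LINT x|lebesgue. U \<phi> x * \<psi> x) = T \<phi> \<psi>" using U by (simp add: L2_extension_def)
    then show "cmod ((LINT x|lebesgue. U \<phi> x * \<psi> x) - \<kappa> * (LINT x|lebesgue. \<phi> x) * (LINT x|lebesgue. \<psi> x))
        \<le> \<epsilon> * (LINT x|lebesgue. cmod (\<phi> x)) * (LINT x|lebesgue. cmod (\<psi> x))"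
      using smooth_pairing_estimate[OF U0 rep K cube_compact cube_compact dj a(1) a(3) a(2) a(4)] by simp
  qed
qed

text \<open>The transpose only exchanges the two arguments of the form, so the kernel of
  \<open>T\<close>, with the same orientation of the cubes, controls it as well.\<close>

lemma cz_transpose_pairing_estimate:
  fixes T :: "('n::finite) dist_op"
  assumes T: "cz_operator K T" and U: "L2_extension (transpose_op T) U"
    and K: "kernel_near K \<kappa> \<epsilon> (cube c l) (cube c' l)" and dj: "cube c l \<inter> cube c' l = {}"
    and f: "bounded_on (cube c l) f" and g: "bounded_on (cube c' l) g"
  shows "cmod ((LINT x|lebesgue. U g x * f x) - \<kappa> * (LINT x|lebesgue. g x) * (LINT x|lebesgue. f x))
    \<le> \<epsilon> * (LINT x|lebesgue. cmod (g x)) * (LINT x|lebesgue. cmod (f x))"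
proof -
  obtain U0 where U0: "L2_extension T U0"
    and "\<forall>f\<in>Cc_infty. AE x in lebesgue. x \<notin> supp f \<longrightarrow> U0 f x = (LINT y|lebesgue. K x y * f y)"
    using T by (auto simp: cz_operator_def)
  then have rep: "\<And>f. f \<in> Cc_infty \<Longrightarrow> AE x in lebesgue. x \<notin> supp f \<longrightarrow> U0 f x = (LINT y|lebesgue. K x y * f y)"
    by blast
  show ?thesis
  proof (rule pairing_estimate_extend[OF L2_extension_bounded[OF U] g[unfolded cube_eq_cbox] f[unfolded cube_eq_cbox], folded cube_eq_cbox])
    fix \<psi> \<phi> :: "'n cfun"
    assume a: "smooth_alg \<psi>" "smooth_alg \<phi>" "\<And>x. x \<notin> cube c' l \<Longrightarrow> \<psi> x = 0" "\<And>x. x \<notin> cube c l \<Longrightarrow> \<phi> x = 0"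
    then have "\<phi> \<in> schwartz" "\<psi> \<in> schwartz"
      using smooth_alg_Cc_infty[OF _ cube_compact] Cc_infty_schwartz by blast+
    then have "(LINT x|lebesgue. U \<psi> x * \<phi> x) = T \<phi> \<psi>" using U by (simp add: L2_extension_def transpose_op_def)
    then show "cmod ((LINT x|lebesgue. U \<psi> x * \<phi> x) - \<kappa> * (LINT x|lebesgue. \<psi> x) * (LINT x|lebesgue. \<phi> x))
        \<le> \<epsilon> * (LINT x|lebesgue. cmod (\<psi> x)) * (LINT x|lebesgue. cmod (\<phi> x))"
      using smooth_pairing_estimate[OF U0 rep K cube_compact cube_compact dj a(2) a(4) a(1) a(3)] by (simp add: mult_ac)
  qed
qed

text \<open>The pairing bound, valid for all bounded \<open>g\<close> on \<open>Q'\<close>, is the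
  testing condition for the difference between \<open>U f\<close> and the constant \<kappa> times
  the integral of f.\<close>

lemma AE_estimate_from_pairing:
  fixes U :: "('n::finite) cfun \<Rightarrow> 'n cfun"
  assumes U: "bounded_L2_op U" and f: "bounded_on Q f" and Q: "Q \<in> lmeasurable" "Q' \<in> lmeasurable" and \<epsilon>: "0 \<le> \<epsilon>"
    and est: "\<And>g. bounded_on Q' g \<Longrightarrow> cmod ((LINT x|lebesgue. U f x * g x) - \<kappa> * (LINT x|lebesgue. f x) * (LINT x|lebesgue. g x))
      \<le> \<epsilon> * (LINT x|lebesgue. cmod (f x)) * (LINT x|lebesgue. cmod (g x))"
  shows "AE x in lebesgue. x \<in> Q' \<longrightarrow> cmod (U f x - \<kappa> * (LINT x|lebesgue. f x)) \<le> \<epsilon> * (LINT x|lebesgue. cmod (f x))"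
proof -
  define d where "d = \<kappa> * (LINT x|lebesgue. f x)"
  have Ul: "U f \<in> L2" using U bounded_on_integrable(2)[OF f Q(1)] by (rule bounded_L2_op_in)
  have ind: "bounded_on Q' (indicator Q')" using Q by (intro bounded_on_indicator) auto
  have "integrable lebesgue (\<lambda>x. U f x * indicator Q' x)"
    by (rule L2_integrable_mult[OF Ul bounded_on_integrable(2)[OF ind Q(2)]])
  moreover have "integrable lebesgue (\<lambda>x. d * indicator Q' x)"
    using bounded_on_integrable(1)[OF ind Q(2)] by simp
  ultimately have "integrable lebesgue (\<lambda>x. U f x * indicator Q' x - d * indicator Q' x)"
    by (rule Bochner_Integration.integrable_diff)
  moreover have "(\<lambda>x. U f x * indicator Q' x - d * indicator Q' x) = (\<lambda>x. indicator Q' x *\<^sub>R (U f x - d))"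
    by (auto simp: indicator_def)
  ultimately have si: "set_integrable lebesgue Q' (\<lambda>x. U f x - d)" by (simp add: set_integrable_def)
  have "AE x in lebesgue. x \<in> Q' \<longrightarrow> cmod (U f x - d) \<le> \<epsilon> * (LINT x|lebesgue. cmod (f x))"
  proof (rule AE_bounded_by_testing[OF si Q(2)])
    show "0 \<le> \<epsilon> * (LINT x|lebesgue. cmod (f x))" using \<epsilon> by (intro mult_nonneg_nonneg Bochner_Integration.integral_nonneg) auto
    fix g assume g: "bounded_on Q' g"
    have "(LINT x|lebesgue. (U f x - d) * g x) = (LINT x|lebesgue. U f x * g x - d * g x)"
      by (simp add: left_diff_distrib)
    also have "\<dots> = (LINT x|lebesgue. U f x * g x) - d * (LINT x|lebesgue. g x)"
      using L2_integrable_mult[OF Ul bounded_on_integrable(2)[OF g Q(2)]] bounded_on_integrable(1)[OF g Q(2)] by simp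
    finally show "cmod (LINT x|lebesgue. (U f x - d) * g x) \<le> \<epsilon> * (LINT x|lebesgue. cmod (f x)) * (LINT x|lebesgue. cmod (g x))"
      using est[OF g] by (simp add: d_def)
  qed
  then show ?thesis by (simp add: d_def)
qed

text \<open>The product \<open>b g\<close> is approximated by its truncations to \<open>\<bar>b\<bar> \<le> k\<close>; their images converge uniformly on \<open>Q\<close>
  up to the stated error, which identifies the limit in measure.\<close>

lemma L1_value_estimate:
  fixes U :: "('n::finite) cfun \<Rightarrow> 'n cfun"
  assumes U: "bounded_L2_op U" and Q: "Q \<in> lmeasurable" "Q' \<in> lmeasurable" and \<epsilon>: "0 \<le> \<epsilon>"
    and est: "\<And>g. bounded_on Q' g \<Longrightarrow> AE y in lebesgue. y \<in> Q \<longrightarrow>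
        cmod (U g y - \<kappa> * (LINT x|lebesgue. g x)) \<le> \<epsilon> * (LINT x|lebesgue. cmod (g x))"
    and b: "b \<in> borel_measurable lebesgue" "set_integrable lebesgue Q' b" and g: "bounded_on Q' g"
    and v: "L1_value U (\<lambda>x. b x * g x) g'"
  shows "AE y in lebesgue. y \<in> Q \<longrightarrow> cmod (c * U g y - g' y - \<kappa> * (LINT x|lebesgue. (c - b x) * g x))
      \<le> \<epsilon> * (LINT x|lebesgue. cmod ((c - b x) * g x))"
proof -
  have [measurable]: "Q \<in> sets lebesgue" "b \<in> borel_measurable lebesgue" "g \<in> borel_measurable lebesgue" "g' \<in> borel_measurable lebesgue"
    using Q b g v by (auto simp: bounded_on_def L1_value_def)
  obtain B where B: "\<And>x. cmod (g x) \<le> B" using g by (auto simp: bounded_on_def)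
  have B0: "0 \<le> B" using B[of undefined] norm_ge_zero order_trans by blast
  have gz: "g x = 0" if "x \<notin> Q'" for x using g that by (simp add: bounded_on_def)
  define u where "u k x = (if cmod (b x) \<le> real k then b x * g x else 0)" for k x
  have um: "u k \<in> borel_measurable lebesgue" for k unfolding u_def[abs_def] by measurable
  have ub: "bounded_on Q' (u k)" for k
  proof -
    have "cmod (u k x) \<le> real k * B" for x
      using B[of x] B0 by (auto simp: u_def norm_mult intro: mult_mono)
    moreover have "u k x = 0" if "x \<notin> Q'" for x using gz[OF that] by (simp add: u_def)
    ultimately show ?thesis unfolding bounded_on_def using um by blast
  qed
  have bg: "integrable lebesgue (\<lambda>x. b x * g x)"
    using v by (simp add: L1_value_def L1_def)
  have gi: "integrable lebesgue g" by (rule bounded_on_integrable(1)[OF g Q(2)])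
  have ui: "integrable lebesgue (u k)" for k by (rule bounded_on_integrable(1)[OF ub Q(2)])
  have ul: "u k \<in> L2" for k by (rule bounded_on_integrable(2)[OF ub Q(2)])
  have gl: "g \<in> L2" by (rule bounded_on_integrable(2)[OF g Q(2)])
  let ?D = "\<lambda>k. L1_norm (\<lambda>x. u k x - b x * g x)"
  have D: "?D \<longlonglongrightarrow> 0"
  proof -
    have "(\<lambda>k. LINT x|lebesgue. cmod (u k x - b x * g x)) \<longlonglongrightarrow> (LINT (x::real^'n)|lebesgue. 0)"
    proof (rule integral_dominated_convergence[where w="\<lambda>x. cmod (b x * g x)"])
      show "integrable lebesgue (\<lambda>x. cmod (b x * g x))" using bg by (rule integrable_norm)
      show "AE x in lebesgue. norm (cmod (u k x - b x * g x)) \<le> cmod (b x * g x)" for k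
        by (intro AE_I2) (simp add: u_def)
      show "AE x in lebesgue. (\<lambda>k. cmod (u k x - b x * g x)) \<longlonglongrightarrow> 0"
      proof (rule AE_I2)
        fix x
        obtain N :: nat where N: "cmod (b x) \<le> real N" using real_arch_simple by blast
        have "eventually (\<lambda>k. 0 = cmod (u k x - b x * g x)) sequentially"
          using eventually_ge_at_top[of N]
        proof eventually_elim
          case (elim k)
          then have "cmod (b x) \<le> real k" using N by linarith
          then show ?case by (simp add: u_def)
        qed
        then show "(\<lambda>k. cmod (u k x - b x * g x)) \<longlonglongrightarrow> 0"
          by (rule Lim_transform_eventually[OF tendsto_const])
      qed
    qed (use um in measurable)
    then show ?thesis by (simp add: L1_norm_def)
  qed
  have meas: "(\<lambda>k. emeasure lebesgue {x. \<eta> < cmod (U (u k) x - g' x)}) \<longlonglongrightarrow> 0" if "0 < \<eta>" for \<eta>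
    using v ui ul D that unfolding L1_value_def L1_def by blast
  define J where "J = (LINT x|lebesgue. (c - b x) * g x)"
  define E where "E = \<epsilon> * (LINT x|lebesgue. cmod ((c - b x) * g x))"
  define Jk where "Jk k = (LINT x|lebesgue. c * g x - u k x)" for k
  define Ek where "Ek k = \<epsilon> * (LINT x|lebesgue. cmod (c * g x - u k x))" for k
  have cbg: "integrable lebesgue (\<lambda>x. (c - b x) * g x)"
    using bg gi by (simp add: left_diff_distrib)
  have Jd: "cmod (Jk k - J) \<le> ?D k" for k
  proof -
    have "Jk k - J = (LINT x|lebesgue. (c * g x - u k x) - (c - b x) * g x)"
      unfolding Jk_def J_def using cbg gi ui by (intro Bochner_Integration.integral_diff[symmetric]) simp_all
    also have "\<dots> = (LINT x|lebesgue. - (u k x - b x * g x))"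
      by (rule Bochner_Integration.integral_cong) (simp_all add: algebra_simps)
    also have "cmod \<dots> \<le> (LINT x|lebesgue. cmod (- (u k x - b x * g x)))" by (rule integral_norm_bound)
    finally show ?thesis by (simp add: L1_norm_def norm_minus_commute)
  qed
  have Ed: "Ek k \<le> E + \<epsilon> * ?D k" for k
  proof -
    have "(LINT x|lebesgue. cmod (c * g x - u k x)) \<le> (LINT x|lebesgue. cmod ((c - b x) * g x) + cmod (u k x - b x * g x))"
    proof (rule integral_mono)
      show "integrable lebesgue (\<lambda>x. cmod (c * g x - u k x))" using gi ui by simp
      show "integrable lebesgue (\<lambda>x. cmod ((c - b x) * g x) + cmod (u k x - b x * g x))"
        using cbg ui bg by simp
      fix x
      show "cmod (c * g x - u k x) \<le> cmod ((c - b x) * g x) + cmod (u k x - b x * g x)"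
        using norm_triangle_ineq4[of "(c - b x) * g x" "u k x - b x * g x"] by (simp add: algebra_simps)
    qed
    also have "\<dots> = (LINT x|lebesgue. cmod ((c - b x) * g x)) + ?D k"
      unfolding L1_norm_def using cbg ui bg by (intro Bochner_Integration.integral_add) simp_all
    finally show ?thesis unfolding Ek_def E_def using \<epsilon> by (simp add: mult_left_mono flip: distrib_left)
  qed
  \<comment> \<open>By linearity, the difference of \<open>c * U g\<close> and
    \<open>U (u k)\<close> is the image of one bounded function on \<open>Q'\<close>, to which
    \<open>est\<close> applies.\<close>
  have step: "AE y in lebesgue. y \<in> Q \<longrightarrow> cmod (c * U g y - U (u k) y - \<kappa> * Jk k) \<le> Ek k" for k
  proof -
    have "bounded_on Q' (\<lambda>x. c * g x - u k x)" by (intro bounded_on_diff bounded_on_scale g ub)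
    from est[OF this] bounded_L2_op_combination[OF U gl ul, of c k]
    show ?thesis by eventually_elim (simp add: Jk_def Ek_def)
  qed
  \<comment> \<open>For large \<open>k\<close> the exceptional set is, up to null sets, contained in
    the set where \<open>U (u k)\<close> and \<open>g'\<close> differ by more than \<eta>/3.
    Convergence in measure then makes it null.\<close>
  have one: "AE y in lebesgue. y \<in> Q \<longrightarrow> cmod (c * U g y - g' y - \<kappa> * J) \<le> E + \<eta>" if \<eta>: "0 < \<eta>" for \<eta>
  proof -
    define N where "N = {y \<in> Q. E + \<eta> < cmod (c * U g y - g' y - \<kappa> * J)}"
    have [measurable]: "U g \<in> borel_measurable lebesgue"
      using bounded_L2_op_in[OF U gl] by (simp add: L2_def)
    have Uu[measurable]: "U (u k) \<in> borel_measurable lebesgue" for k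
      using bounded_L2_op_in[OF U ul] by (simp add: L2_def)
    have "{y \<in> space lebesgue. y \<in> Q \<and> E + \<eta> < cmod (c * U g y - g' y - \<kappa> * J)} \<in> sets lebesgue" by measurable
    then have Ns: "N \<in> sets lebesgue" by (simp add: N_def)
    \<comment> \<open>Below this threshold both |\<kappa>| and \<epsilon> times the L^1 distance are
      less than \<eta>/3; the summand 1 keeps the divisor positive.\<close>
    let ?\<alpha> = "\<eta> / 3 / (cmod \<kappa> + \<epsilon> + 1)"
    have \<alpha>: "0 < ?\<alpha>" using \<eta> \<epsilon> by (intro divide_pos_pos add_nonneg_pos add_nonneg_nonneg) auto
    have "eventually (\<lambda>k. emeasure lebesgue N \<le> emeasure lebesgue {x. \<eta> / 3 < cmod (U (u k) x - g' x)}) sequentially"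
      using order_tendstoD(2)[OF D \<alpha>]
    proof eventually_elim
      case (elim k)
      have D0: "0 \<le> ?D k" unfolding L1_norm_def by (rule Bochner_Integration.integral_nonneg) simp
      have k1: "(cmod \<kappa> + \<epsilon> + 1) * ?D k < \<eta> / 3"
      proof -
        have "0 < cmod \<kappa> + \<epsilon> + 1" using \<epsilon> norm_ge_zero[of \<kappa>] by linarith
        then show ?thesis using elim by (simp only: pos_less_divide_eq mult.commute)
      qed
      have k2: "cmod \<kappa> * ?D k \<le> (cmod \<kappa> + \<epsilon> + 1) * ?D k" "\<epsilon> * ?D k \<le> (cmod \<kappa> + \<epsilon> + 1) * ?D k"
        using D0 \<epsilon> by (auto intro!: mult_right_mono)
      have ae: "AE y in lebesgue. y \<in> N \<longrightarrow> y \<in> {x. \<eta> / 3 < cmod (U (u k) x - g' x)}"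
        using step[of k]
      proof eventually_elim
        case (elim y)
        show ?case
        proof
          assume y: "y \<in> N"
          then have s: "cmod (c * U g y - U (u k) y - \<kappa> * Jk k) \<le> Ek k" using elim by (auto simp: N_def)
          have "c * U g y - g' y - \<kappa> * J = (c * U g y - U (u k) y - \<kappa> * Jk k) + (U (u k) y - g' y) + \<kappa> * (Jk k - J)"
            by (simp add: algebra_simps)
          then have "cmod (c * U g y - g' y - \<kappa> * J) \<le> cmod (c * U g y - U (u k) y - \<kappa> * Jk k) + cmod (U (u k) y - g' y) + cmod (\<kappa> * (Jk k - J))"
            by (metis norm_triangle_mono order.refl)
          moreover have "cmod (\<kappa> * (Jk k - J)) \<le> cmod \<kappa> * ?D k"
            unfolding norm_mult using Jd by (intro mult_left_mono) auto
          moreover have "E + \<eta> < cmod (c * U g y - g' y - \<kappa> * J)" using y by (simp add: N_def)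
          ultimately have "\<eta> / 3 < cmod (U (u k) y - g' y)"
            using s Ed[of k] k1 k2 by linarith
          then show "y \<in> {x. \<eta> / 3 < cmod (U (u k) x - g' x)}" by simp
        qed
      qed
      have "{x \<in> space lebesgue. \<eta> / 3 < cmod (U (u k) x - g' x)} \<in> sets lebesgue" by measurable
      then show ?case using ae by (intro emeasure_mono_AE) simp_all
    qed
    moreover have "(\<lambda>k. emeasure lebesgue {x. \<eta> / 3 < cmod (U (u k) x - g' x)}) \<longlonglongrightarrow> 0"
      using \<eta> by (intro meas) simp
    ultimately have "emeasure lebesgue N \<le> 0"
      by (intro tendsto_lowerbound[where F=sequentially]) auto
    then have "N \<in> null_sets lebesgue" using Ns by (intro null_setsI) simp_all
    from AE_not_in[OF this] show ?thesis by eventually_elim (auto simp: N_def)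
  qed
  have "AE y in lebesgue. \<forall>m. y \<in> Q \<longrightarrow> cmod (c * U g y - g' y - \<kappa> * J) \<le> E + 1 / real (Suc m)"
    using one by (subst AE_all_countable) simp
  then show ?thesis
    unfolding J_def[symmetric] E_def[symmetric]
  proof eventually_elim
    case (elim y)
    show ?case
    proof
      assume y: "y \<in> Q"
      show "cmod (c * U g y - g' y - \<kappa> * J) \<le> E"
      proof (rule field_le_epsilon)
        fix e :: real assume "0 < e"
        then obtain m where "1 / real (Suc m) < e" by (rule nat_approx_posE)
        then show "cmod (c * U g y - g' y - \<kappa> * J) \<le> E + e" using elim y by (meson add_left_mono less_imp_le order_trans)
      qed
    qed
  qed
qed

section \<open>Separated cubes and the size of the kernel\<close>

lemma cube_norm_le:
  fixes x c :: "real ^ 'n"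
  assumes "x \<in> cube c l" shows "norm (x - c) \<le> real CARD('n) * l / 2"
proof -
  have "norm (x - c) \<le> (\<Sum>i\<in>UNIV. \<bar>(x - c) $ i\<bar>)" by (rule norm_le_l1_cart)
  also have "\<dots> \<le> (\<Sum>i\<in>(UNIV :: 'n set). l / 2)"
    using assms by (intro sum_mono) (simp add: cube_def)
  finally show ?thesis by simp
qed

text \<open>Points of a cube lie within n l / 2 of its centre, and n l \<le> N l / 4, so at least
  three quarters of the distance N l between the centres is left.\<close>

lemma separated_cubes:
  fixes c :: "real ^ 'n" and i :: 'n
  assumes l: "0 < l" and N: "4 * real CARD('n) \<le> N"
  defines "c' \<equiv> c + (N * l) *\<^sub>R axis i 1"
  shows "x \<in> cube c' l \<Longrightarrow> y \<in> cube c l \<Longrightarrow> N * l / 2 \<le> norm (x - y)"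
    and "cube c l \<inter> cube c' l = {}"
proof -
  have n: "1 \<le> real CARD('n)" by (simp add: Suc_leI)
  have Nl: "real CARD('n) * l \<le> N * l / 4" using N l by (simp add: mult.commute)
  have "0 < N" using N n by linarith
  then have R: "0 < N * l / 2" using l by simp
  have d: "norm (c' - c) = N * l" using \<open>0 < N\<close> l by (simp add: c'_def)
  show *: "N * l / 2 \<le> norm (x - y)" if "x \<in> cube c' l" "y \<in> cube c l" for x y
  proof -
    have "c' - c = (x - y) - (x - c') + (y - c)" by simp
    then have "N * l \<le> norm (x - y) + norm (x - c') + norm (y - c)"
      using norm_triangle_ineq[of "(x - y) - (x - c')" "y - c"] norm_triangle_ineq4[of "x - y" "x - c'"] d by simp
    then show ?thesis using cube_norm_le[OF that(1)] cube_norm_le[OF that(2)] Nl R by linarith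
  qed
  from R show "cube c l \<inter> cube c' l = {}" using * by fastforce
qed

lemma holder_continuous_on:
  fixes f :: "'a::real_normed_vector \<Rightarrow> 'b::real_normed_vector"
  assumes \<delta>: "0 < \<delta>" and D: "0 \<le> D"
    and h: "\<And>x y. x \<in> S \<Longrightarrow> y \<in> S \<Longrightarrow> norm (f x - f y) \<le> D * norm (x - y) powr \<delta>"
  shows "continuous_on S f"
  unfolding continuous_on_iff
proof (intro ballI allI impI)
  fix x e assume x: "x \<in> S" and e: "(0::real) < e"
  define d where "d = (e / (D + 1)) powr (1 / \<delta>)"
  have d: "0 < d" using e D by (simp add: d_def)
  show "\<exists>d>0. \<forall>x'\<in>S. dist x' x < d \<longrightarrow> dist (f x') (f x) < e"
  proof (intro exI conjI ballI impI)
    show "0 < d" by fact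
    fix y assume y: "y \<in> S" and yd: "dist y x < d"
    have "norm (y - x) powr \<delta> \<le> d powr \<delta>" using yd \<delta> by (intro powr_mono2) (auto simp: dist_norm)
    also have "\<dots> = e / (D + 1)" using e D \<delta> by (simp add: d_def powr_powr)
    finally have "D * norm (y - x) powr \<delta> \<le> D * (e / (D + 1))" using D by (rule mult_left_mono)
    also have "\<dots> < e" using e D by (simp add: field_simps)
    finally show "dist (f y) (f x) < e" using h[OF y x] by (simp add: dist_norm)
  qed
qed

text \<open>Move the first variable to the centre c', then the second to the centre c. Each move is
  at most n l long at distance at least N l / 2 and costs one regularity estimate of the kernel,
  whence the factor 2. Regularity in the second variable also gives the continuity.\<close>

lemma kernel_near_separated:
  fixes K :: "real ^ 'n \<Rightarrow> real ^ 'n \<Rightarrow> complex" and c :: "real ^ 'n" and i :: 'n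
  assumes K: "K \<in> SK \<delta> A" and \<delta>: "0 < \<delta>" and A: "0 < A" and l: "0 < l" and N: "4 * real CARD('n) \<le> N"
  defines "c' \<equiv> c + (N * l) *\<^sub>R axis i 1"
  shows "kernel_near K (K c' c) (2 * (A * (real CARD('n) * l) powr \<delta> / (N * l / 2) powr (real CARD('n) + \<delta>)))
      (cube c l) (cube c' l)"
proof -
  let ?n = "real CARD('n)"
  have n: "1 \<le> ?n" by (simp add: Suc_leI)
  have Nl: "?n * l \<le> N * l / 4" using N l by (simp add: mult.commute)
  have "0 < N" using N n by linarith
  then have R: "0 < N * l / 2" using l by simp
  have sep: "N * l / 2 \<le> norm (x - y)" if "x \<in> cube c' l" "y \<in> cube c l" for x y
    using separated_cubes(1)[OF l N, of x c i y] that by (simp only: c'_def)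
  have cc: "c' \<in> cube c' l" "c \<in> cube c l" using l by (auto simp: cube_def)
  have K1: "cmod (K x y - K x' y) \<le> A * norm (x - x') powr \<delta> / (norm (x - y) + norm (x' - y)) powr (?n + \<delta>)"
    if "x \<noteq> y" "x' \<noteq> y" "norm (x - x') \<le> max (norm (x - y)) (norm (x' - y)) / 2" for x x' y
    using K that unfolding SK_def by blast
  have K2: "cmod (K x y - K x y') \<le> A * norm (y - y') powr \<delta> / (norm (x - y) + norm (x - y')) powr (?n + \<delta>)"
    if "x \<noteq> y" "x \<noteq> y'" "norm (y - y') \<le> max (norm (x - y)) (norm (x - y')) / 2" for x y y'
    using K that unfolding SK_def by blast
  have frac: "A * a powr \<delta> / s powr (?n + \<delta>) \<le> A * b powr \<delta> / (N * l / 2) powr (?n + \<delta>)"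
    if "0 \<le> a" "a \<le> b" "N * l / 2 \<le> s" for a b s
    using that A \<delta> R n by (intro frac_le mult_left_mono powr_mono2) auto
  have H2: "cmod (K x y - K x y') \<le> A * norm (y - y') powr \<delta> / (N * l / 2) powr (?n + \<delta>)"
    if "x \<in> cube c' l" "y \<in> cube c l" "y' \<in> cube c l" for x y y'
  proof -
    note s = sep[OF that(1) that(2)] sep[OF that(1) that(3)]
    have "norm (y - y') \<le> norm (y - c) + norm (y' - c)" using norm_triangle_ineq4[of "y - c" "y' - c"] by simp
    then have "norm (y - y') \<le> max (norm (x - y)) (norm (x - y')) / 2"
      using cube_norm_le[OF that(2)] cube_norm_le[OF that(3)] Nl s by linarith
    then have "cmod (K x y - K x y') \<le> A * norm (y - y') powr \<delta> / (norm (x - y) + norm (x - y')) powr (?n + \<delta>)"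
      using s R by (intro K2) auto
    also have "\<dots> \<le> A * norm (y - y') powr \<delta> / (N * l / 2) powr (?n + \<delta>)"
    proof (rule frac)
      show "N * l / 2 \<le> norm (x - y) + norm (x - y')" using s R by linarith
    qed auto
    finally show ?thesis .
  qed
  show ?thesis
    unfolding kernel_near_def
  proof (intro ballI conjI)
    fix x assume x: "x \<in> cube c' l"
    show "continuous_on (cube c l) (K x)"
    proof (rule holder_continuous_on[OF \<delta>])
      show "0 \<le> A / (N * l / 2) powr (?n + \<delta>)" using A by simp
      show "cmod (K x y - K x y') \<le> A / (N * l / 2) powr (?n + \<delta>) * norm (y - y') powr \<delta>"
        if "y \<in> cube c l" "y' \<in> cube c l" for y y'
        using H2[OF x that] by simp
    qed
    fix y assume y: "y \<in> cube c l"
    have s: "N * l / 2 \<le> norm (x - y)" "N * l / 2 \<le> norm (c' - y)" using sep x y cc by auto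
    have "norm (x - c') \<le> max (norm (x - y)) (norm (c' - y)) / 2"
      using cube_norm_le[OF x] Nl s R by linarith
    then have "cmod (K x y - K c' y) \<le> A * norm (x - c') powr \<delta> / (norm (x - y) + norm (c' - y)) powr (?n + \<delta>)"
      using s R by (intro K1) auto
    also have "\<dots> \<le> A * (?n * l) powr \<delta> / (N * l / 2) powr (?n + \<delta>)"
    proof (rule frac)
      have "0 < ?n * l" using n l by simp
      then show "norm (x - c') \<le> ?n * l" using cube_norm_le[OF x] by linarith
      show "N * l / 2 \<le> norm (x - y) + norm (c' - y)" using s R by linarith
    qed simp
    finally have 1: "cmod (K x y - K c' y) \<le> A * (?n * l) powr \<delta> / (N * l / 2) powr (?n + \<delta>)" .
    have "cmod (K c' y - K c' c) \<le> A * norm (y - c) powr \<delta> / (N * l / 2) powr (?n + \<delta>)"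
      by (rule H2[OF cc(1) y cc(2)])
    also have "\<dots> \<le> A * (?n * l) powr \<delta> / (N * l / 2) powr (?n + \<delta>)"
    proof (rule frac)
      have "0 < ?n * l" using n l by simp
      then show "norm (y - c) \<le> ?n * l" using cube_norm_le[OF y] by linarith
    qed auto
    finally have "cmod (K c' y - K c' c) \<le> A * (?n * l) powr \<delta> / (N * l / 2) powr (?n + \<delta>)" .
    with 1 have "cmod ((K x y - K c' y) + (K c' y - K c' c)) \<le> 2 * (A * (?n * l) powr \<delta> / (N * l / 2) powr (?n + \<delta>))"
      using norm_triangle_ineq[of "K x y - K c' y" "K c' y - K c' c"] by linarith
    then show "cmod (K x y - K c' c) \<le> 2 * (A * (?n * l) powr \<delta> / (N * l / 2) powr (?n + \<delta>))" by simp
  qed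
qed

text \<open>Homogeneity is applied to the full cube \<Omega> = Q. On the translate, the image of its
  indicator differs from \<kappa> l^n by at most \<epsilon> l^n, so a lower bound for the image is
  one for |\<kappa>| + \<epsilon>.\<close>

lemma homogeneous_kernel_lower_bound:
  fixes T :: "('n::finite) dist_op" and c :: "real ^ 'n"
  assumes T: "cz_operator K T" and hom: "homogeneous T" and l: "0 < l" and N: "4 * real CARD('n) \<le> N" "10 \<le> N"
    and \<epsilon>: "0 \<le> \<epsilon>" and near: "kernel_near K \<kappa> \<epsilon> (cube c l) (cube c' l)"
    and c': "c' = c + (N * l) *\<^sub>R axis i 1"
  shows "1 / (4 * N) ^ CARD('n) \<le> (cmod \<kappa> + \<epsilon>) * l ^ CARD('n)"
proof -
  let ?n = "real CARD('n)" and ?Q = "cube c l"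
  have n: "1 \<le> ?n" by (simp add: Suc_leI)
  have Nl: "?n * l \<le> N * l / 4" using N l by (simp add: mult.commute)
  have mQ: "measure lebesgue ?Q = l ^ CARD('n)" using l by (intro measure_cube) simp
  have dj: "cube c l \<inter> cube c' l = {}" unfolding c' by (rule separated_cubes(2)[OF l N(1)])
  obtain U where U: "L2_extension T U" and h: "\<And>c l \<Omega>. 0 < l \<and> \<Omega> \<in> sets borel \<and> \<Omega> \<subseteq> cube c l \<Longrightarrow>
         (AE x in lebesgue. \<forall>M>10. norm (x - c) = M * l / 2 \<longrightarrow>
            cmod (U (indicator \<Omega>) x)
              \<ge> measure lebesgue \<Omega> / (M ^ CARD('n) * measure lebesgue (cube c l)))"
    using hom unfolding homogeneous_def by blast
  have bQ: "bounded_on ?Q (indicator ?Q)" by (intro bounded_on_indicator cube_sets)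
  have ae1: "AE x in lebesgue. x \<in> cube c' l \<longrightarrow>
      cmod (U (indicator ?Q) x - \<kappa> * (LINT x|lebesgue. indicator ?Q x)) \<le> \<epsilon> * (LINT x|lebesgue. cmod (indicator ?Q x))"
    by (rule AE_estimate_from_pairing[OF L2_extension_bounded[OF U] bQ cube_lmeasurable cube_lmeasurable \<epsilon>])
      (rule cz_pairing_estimate[OF T U near dj bQ])
  have i1: "(LINT x|lebesgue. indicator ?Q x :: complex) = of_real (l ^ CARD('n))"
    unfolding integral_indicator_complex[OF cube_lmeasurable] mQ ..
  have i2: "(LINT x|lebesgue. cmod (indicator ?Q x)) = l ^ CARD('n)"
  proof -
    have "(LINT x|lebesgue. cmod (indicator ?Q x)) = (LINT x|lebesgue. indicator ?Q x)"
      by (rule Bochner_Integration.integral_cong) (auto simp: indicator_def)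
    then show ?thesis using mQ by simp
  qed
  have "?Q \<in> sets borel" by (simp add: cube_eq_cbox)
  then have ae2: "AE x in lebesgue. \<forall>M>10. norm (x - c) = M * l / 2 \<longrightarrow> cmod (U (indicator ?Q) x)
              \<ge> measure lebesgue ?Q / (M ^ CARD('n) * measure lebesgue ?Q)"
    using l by (intro h) auto
  \<comment> \<open>Both bounds hold only almost everywhere; since the translate is not a null set,
    they hold together at some point of it.\<close>
  have "\<exists>x\<in>cube c' l. cmod (U (indicator ?Q) x - \<kappa> * of_real (l ^ CARD('n))) \<le> \<epsilon> * l ^ CARD('n) \<and>
     (\<forall>M>10. norm (x - c) = M * l / 2 \<longrightarrow> cmod (U (indicator ?Q) x) \<ge> 1 / M ^ CARD('n))"
  proof (rule ccontr)
    assume no: "\<not> ?thesis"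
    have "AE x in lebesgue. x \<notin> cube c' l"
      using ae1 ae2
    proof eventually_elim
      case (elim x)
      show ?case
      proof
        assume x: "x \<in> cube c' l"
        have "1 / M ^ CARD('n) = measure lebesgue ?Q / (M ^ CARD('n) * measure lebesgue ?Q)" for M :: real
          unfolding mQ using l by simp
        then show False using elim x no unfolding i1 i2 by metis
      qed
    qed
    then have "cube c' l \<in> null_sets lebesgue"
      using cube_sets[of c' l] by (subst AE_iff_null_sets) simp_all
    then have "measure lebesgue (cube c' l) = 0" by (rule measure_eq_0_null_sets)
    moreover have "measure lebesgue (cube c' l) = l ^ CARD('n)" using l by (intro measure_cube) simp
    ultimately show False using l by simp
  qed
  then obtain x where x: "x \<in> cube c' l" "cmod (U (indicator ?Q) x - \<kappa> * of_real (l ^ CARD('n))) \<le> \<epsilon> * l ^ CARD('n)"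
     and lowM: "\<And>M. 10 < M \<Longrightarrow> norm (x - c) = M * l / 2 \<Longrightarrow> cmod (U (indicator ?Q) x) \<ge> 1 / M ^ CARD('n)" by blast
  have d: "norm (c' - c) = N * l" using N l by (simp add: c' norm_axis_1)
  have up: "norm (x - c) \<le> 2 * (N * l)" and lo: "3 * (N * l) / 4 \<le> norm (x - c)"
  proof -
    have "0 < N * l" using N l by simp
    moreover have "norm (x - c) \<le> norm (x - c') + norm (c' - c)" using norm_triangle_ineq[of "x - c'" "c' - c"] by simp
    moreover have "norm (c' - c) \<le> norm (x - c) + norm (x - c')" using norm_triangle_ineq4[of "x - c" "x - c'"] by simp
    ultimately show "norm (x - c) \<le> 2 * (N * l)" "3 * (N * l) / 4 \<le> norm (x - c)"
      using cube_norm_le[OF x(1)] Nl d by linarith+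
  qed
  \<comment> \<open>The parameter which homogeneity assigns to \<open>x\<close>. The distance from
    \<open>x\<close> to \<open>c\<close> is at least 3 N l / 4 and at most 2 N l, so
    \<open>M\<close> lies between 3 N / 2 \<ge> 15 and 4 N.\<close>
  define M where "M = 2 * norm (x - c) / l"
  have M1: "10 < M"
  proof -
    have "3 * N / 2 \<le> M" using lo l by (simp add: M_def field_simps)
    then show ?thesis using N by linarith
  qed
  have M2: "M \<le> 4 * N" using up l by (simp add: M_def field_simps)
  have "1 / (4 * N) ^ CARD('n) \<le> 1 / M ^ CARD('n)"
    using M1 M2 by (intro divide_left_mono power_mono mult_pos_pos zero_less_power) auto
  also have "\<dots> \<le> cmod (U (indicator ?Q) x)" by (rule lowM[OF M1]) (use l in \<open>simp add: M_def\<close>)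
  also have "\<dots> \<le> cmod (U (indicator ?Q) x - \<kappa> * of_real (l ^ CARD('n))) + cmod (\<kappa> * of_real (l ^ CARD('n)))"
    using norm_triangle_ineq[of "U (indicator ?Q) x - \<kappa> * of_real (l ^ CARD('n))" "\<kappa> * of_real (l ^ CARD('n))"] by simp
  also have "cmod (\<kappa> * of_real (l ^ CARD('n))) = cmod \<kappa> * l ^ CARD('n)"
    using l by (simp add: norm_mult norm_power)
  finally show ?thesis using x(2) by (simp add: distrib_right)
qed

section \<open>Testing the commutator\<close>

text \<open>The double integral of \<open>(b(y) - b(x)) f(y) g(x)\<close>.\<close>

definition cross_mean :: "('n::finite) cfun \<Rightarrow> 'n cfun \<Rightarrow> 'n cfun \<Rightarrow> complex" where
  "cross_mean b f g = (LINT x|lebesgue. b x * f x) * (LINT x|lebesgue. g x) -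
     (LINT x|lebesgue. f x) * (LINT x|lebesgue. b x * g x)"

lemma set_integrable_mult_bounded_on:
  assumes b: "set_integrable lebesgue Q b" and f: "bounded_on Q f"
  shows "integrable lebesgue (\<lambda>x. b x * f x)"
proof -
  obtain B where B: "\<And>x. cmod (f x) \<le> B" using f by (auto simp: bounded_on_def)
  have z: "f x = 0" if "x \<notin> Q" for x using f that by (simp add: bounded_on_def)
  have bi: "integrable lebesgue (\<lambda>x. indicator Q x *\<^sub>R b x)" using b by (simp add: set_integrable_def)
  have "integrable lebesgue (\<lambda>x. (indicator Q x *\<^sub>R b x) * f x)"
  proof (rule Bochner_Integration.integrable_bound)
    show "integrable lebesgue (\<lambda>x. B * cmod (indicator Q x *\<^sub>R b x))"
      by (intro integrable_mult_right integrable_norm bi)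
    show "(\<lambda>x. (indicator Q x *\<^sub>R b x) * f x) \<in> borel_measurable lebesgue"
      using borel_measurable_integrable[OF bi] bounded_on_measurable[OF f] by (rule borel_measurable_times)
    show "AE x in lebesgue. norm ((indicator Q x *\<^sub>R b x) * f x) \<le> norm (B * cmod (indicator Q x *\<^sub>R b x))"
    proof (rule AE_I2)
      fix x
      have "norm ((indicator Q x *\<^sub>R b x) * f x) \<le> cmod (indicator Q x *\<^sub>R b x) * B"
        unfolding norm_mult using B by (intro mult_left_mono) auto
      then show "norm ((indicator Q x *\<^sub>R b x) * f x) \<le> norm (B * cmod (indicator Q x *\<^sub>R b x))"
        by (metis abs_ge_self mult.commute order_trans real_norm_def)
    qed
  qed
  moreover have "(\<lambda>x. (indicator Q x *\<^sub>R b x) * f x) = (\<lambda>x. b x * f x)"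
    using z by (fastforce simp: indicator_def)
  ultimately show ?thesis by simp
qed

lemma set_integrable_const_lmeasurable:
  fixes m :: complex
  assumes "Q \<in> lmeasurable" shows "set_integrable lebesgue Q (\<lambda>_. m)"
  unfolding set_integrable_def
  by (intro Bochner_Integration.integrable_scaleR_left integrable_indicator_lmeasurable assms)

lemma bounded_on_L1_le_measure:
  assumes f: "bounded_on Q f" "\<And>x. cmod (f x) \<le> 1" and Q: "Q \<in> lmeasurable"
  shows "(LINT x|lebesgue. cmod (f x)) \<le> measure lebesgue Q"
proof -
  have "(LINT x|lebesgue. cmod (f x)) \<le> (LINT x|lebesgue. indicator Q x)"
  proof (rule integral_mono)
    show "integrable lebesgue (\<lambda>x. cmod (f x))" using bounded_on_integrable(1)[OF f(1) Q] by simp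
    show "integrable lebesgue (indicat_real Q)" using Q by (rule integrable_indicator_lmeasurable)
    show "cmod (f x) \<le> indicator Q x" for x
      using f by (cases "x \<in> Q") (auto simp: bounded_on_def)
  qed
  then show ?thesis by simp
qed

text \<open>A commutator does not see constants: with T' for the transpose, [b,T']g = (b - m) T'g +
  (m T'g - T'(b g)). The first term uses the kernel estimate for \<open>g\<close>, the second
  \<open>L1_value_estimate\<close> with c = m, that is for (m - b) g. All errors are thus measured
  by the oscillation of \<open>b\<close> about the freely chosen \<open>m\<close>.\<close>

lemma commutator_local_estimate:
  fixes T :: "('n::finite) dist_op"
  assumes T: "cz_operator K T" and comm: "comm_Lc b (transpose_op T) g v"
    and near: "kernel_near K \<kappa> \<epsilon> (cube c l) (cube c' l)" and dj: "cube c l \<inter> cube c' l = {}" and \<epsilon>: "0 \<le> \<epsilon>"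
    and b: "b \<in> L1_loc" and l: "0 < l"
    and f: "bounded_on (cube c l) f" "\<And>x. cmod (f x) \<le> 1" and g: "bounded_on (cube c' l) g" "\<And>x. cmod (g x) \<le> 1"
  shows "integrable lebesgue (\<lambda>x. f x * v x)"
    and "cmod ((LINT x|lebesgue. f x * v x) - \<kappa> * cross_mean b f g) \<le>
      \<epsilon> * (l ^ CARD('n) * ((LINT x:cube c l|lebesgue. cmod (b x - m)) + (LINT x:cube c' l|lebesgue. cmod (b x - m))))"
proof -
  let ?Q = "cube c l" and ?Q' = "cube c' l"
  have mQ: "measure lebesgue ?Q = l ^ CARD('n)" "measure lebesgue ?Q' = l ^ CARD('n)"
    using l by (auto intro: measure_cube)
  have bm[measurable]: "b \<in> borel_measurable lebesgue" and bi: "set_integrable lebesgue ?Q b" "set_integrable lebesgue ?Q' b"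
    using b cube_compact by (auto simp: L1_loc_def)
  have const: "set_integrable lebesgue (cube a l) (\<lambda>_. m)" for a :: "real^'n"
    by (rule set_integrable_const_lmeasurable) simp
  have bmi: "set_integrable lebesgue ?Q (\<lambda>x. b x - m)" "set_integrable lebesgue ?Q' (\<lambda>x. b x - m)"
    using bi const by (auto intro: set_integral_diff(1))
  obtain U g1 where U: "L2_extension (transpose_op T) U" and g1: "L1_value U (\<lambda>x. b x * g x) g1"
    and v: "AE x in lebesgue. v x = b x * U g x - g1 x" and vm[measurable]: "v \<in> borel_measurable lebesgue"
    using comm by (auto simp: comm_Lc_def)
  have est: "AE y in lebesgue. y \<in> ?Q \<longrightarrow> cmod (U g y - \<kappa> * (LINT x|lebesgue. g x)) \<le> \<epsilon> * (LINT x|lebesgue. cmod (g x))"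
    if "bounded_on ?Q' g" for g
    by (rule AE_estimate_from_pairing[OF L2_extension_bounded[OF U] that cube_lmeasurable cube_lmeasurable \<epsilon>])
      (rule cz_transpose_pairing_estimate[OF T U near dj _ that])
  define G where "G = (LINT x|lebesgue. g x)"
  define H where "H = (LINT x|lebesgue. b x * g x)"
  define P where "P = (LINT x:?Q|lebesgue. cmod (b x - m))"
  define P' where "P' = (LINT x:?Q'|lebesgue. cmod (b x - m))"
  have gi: "integrable lebesgue g" by (rule bounded_on_integrable(1)[OF g(1) cube_lmeasurable])
  have fi: "integrable lebesgue f" by (rule bounded_on_integrable(1)[OF f(1) cube_lmeasurable])
  have bgi: "integrable lebesgue (\<lambda>x. b x * g x)" by (rule set_integrable_mult_bounded_on[OF bi(2) g(1)])
  have bfi: "integrable lebesgue (\<lambda>x. b x * f x)" by (rule set_integrable_mult_bounded_on[OF bi(1) f(1)])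
  have mg: "(LINT x|lebesgue. (m - b x) * g x) = m * G - H"
    using gi bgi by (simp add: left_diff_distrib G_def H_def)
  have mgP: "(LINT x|lebesgue. cmod ((m - b x) * g x)) \<le> P'"
    unfolding P'_def set_lebesgue_integral_def
  proof (rule integral_mono)
    show "integrable lebesgue (\<lambda>x. cmod ((m - b x) * g x))"
      using gi bgi by (intro integrable_norm) (simp add: left_diff_distrib)
    show "integrable lebesgue (\<lambda>x. indicat_real ?Q' x *\<^sub>R cmod (b x - m))"
      using set_integrable_norm[OF bmi(2)] by (simp add: set_integrable_def)
    fix x show "cmod ((m - b x) * g x) \<le> indicat_real ?Q' x *\<^sub>R cmod (b x - m)"
      using g(2)[of x] g(1) mult_left_mono[of "cmod (g x)" 1 "cmod (b x - m)"]
      by (cases "x \<in> ?Q'") (auto simp: bounded_on_def norm_mult norm_minus_commute)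
  qed
  let ?q = "l ^ CARD('n)"
  have gq: "(LINT x|lebesgue. cmod (g x)) \<le> ?q"
    using bounded_on_L1_le_measure[OF g cube_lmeasurable] mQ by simp
  have L1e: "AE y in lebesgue. y \<in> ?Q \<longrightarrow> cmod (m * U g y - g1 y - \<kappa> * (LINT x|lebesgue. (m - b x) * g x))
      \<le> \<epsilon> * (LINT x|lebesgue. cmod ((m - b x) * g x))"
    by (rule L1_value_estimate[OF L2_extension_bounded[OF U] cube_lmeasurable cube_lmeasurable \<epsilon> _ bm bi(2) g(1) g1])
      (rule est)
  have pw: "AE y in lebesgue. y \<in> ?Q \<longrightarrow> cmod (v y - \<kappa> * (b y * G - H)) \<le> \<epsilon> * (cmod (b y - m) * ?q + P')"
    using v est[OF g(1)] L1e
  proof eventually_elim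
    case (elim y)
    show ?case
    proof
      assume y: "y \<in> ?Q"
      have "v y - \<kappa> * (b y * G - H) = (b y - m) * (U g y - \<kappa> * G) + (m * U g y - g1 y - \<kappa> * (m * G - H))"
        using elim(1) by (simp add: algebra_simps)
      then have "cmod (v y - \<kappa> * (b y * G - H)) \<le> cmod (b y - m) * cmod (U g y - \<kappa> * G) + cmod (m * U g y - g1 y - \<kappa> * (m * G - H))"
        using norm_triangle_ineq[of "(b y - m) * (U g y - \<kappa> * G)" "m * U g y - g1 y - \<kappa> * (m * G - H)"] by (simp add: norm_mult)
      also have "\<dots> \<le> cmod (b y - m) * (\<epsilon> * ?q) + \<epsilon> * P'"
      proof (intro add_mono mult_left_mono)
        show "cmod (U g y - \<kappa> * G) \<le> \<epsilon> * ?q"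
          using elim(2) y mult_left_mono[OF gq \<epsilon>] unfolding G_def by linarith
        show "cmod (m * U g y - g1 y - \<kappa> * (m * G - H)) \<le> \<epsilon> * P'"
          using elim(3) y mult_left_mono[OF mgP \<epsilon>] unfolding mg by linarith
      qed simp
      finally show "cmod (v y - \<kappa> * (b y * G - H)) \<le> \<epsilon> * (cmod (b y - m) * ?q + P')" by (simp add: algebra_simps)
    qed
  qed
  let ?w = "\<lambda>y. indicat_real ?Q y *\<^sub>R (\<epsilon> * (cmod (b y - m) * ?q + P'))"
  have wi1: "integrable lebesgue (\<lambda>y. indicat_real ?Q y *\<^sub>R cmod (b y - m))"
    using set_integrable_norm[OF bmi(1)] by (simp add: set_integrable_def)
  note wi2 = integrable_indicator_lmeasurable[OF cube_lmeasurable[of c l]]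
  have w: "?w = (\<lambda>y. \<epsilon> * ?q * (indicat_real ?Q y *\<^sub>R cmod (b y - m)) + \<epsilon> * P' * indicat_real ?Q y)"
    by (auto simp: algebra_simps)
  have wi: "integrable lebesgue ?w" unfolding w using wi1 wi2 by simp
  have wI: "(LINT y|lebesgue. ?w y) = \<epsilon> * (?q * (P + P'))"
  proof -
    have "(LINT y|lebesgue. ?w y) = \<epsilon> * ?q * P + \<epsilon> * P' * ?q"
      unfolding w using wi1 wi2 mQ by (simp add: P_def set_lebesgue_integral_def)
    then show ?thesis by (simp add: algebra_simps)
  qed
  let ?e = "\<lambda>y. f y * (v y - \<kappa> * (b y * G - H))"
  have ew: "AE y in lebesgue. cmod (?e y) \<le> ?w y"
    using pw
  proof eventually_elim
    case (elim y)
    show ?case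
    proof (cases "y \<in> ?Q")
      case True
      have "cmod (?e y) \<le> 1 * cmod (v y - \<kappa> * (b y * G - H))"
        unfolding norm_mult using f(2) by (intro mult_right_mono) auto
      then show ?thesis using elim True by simp
    next
      case False
      then show ?thesis using f(1) by (simp add: bounded_on_def)
    qed
  qed
  have ei: "integrable lebesgue ?e"
  proof (rule Bochner_Integration.integrable_bound[OF wi])
    show "?e \<in> borel_measurable lebesgue"
      using bounded_on_measurable[OF f(1)] by measurable
    show "AE y in lebesgue. norm (?e y) \<le> norm (?w y)"
      using ew
    proof eventually_elim
      case (elim y)
      show ?case unfolding real_norm_def using elim abs_ge_self by (rule order_trans)
    qed
  qed
  have fb: "integrable lebesgue (\<lambda>y. \<kappa> * G * (b y * f y) - \<kappa> * H * f y)"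
    using bfi fi by simp
  have sp: "(\<lambda>y. f y * v y) = (\<lambda>y. ?e y + (\<kappa> * G * (b y * f y) - \<kappa> * H * f y))"
    by (auto simp: algebra_simps)
  show "integrable lebesgue (\<lambda>x. f x * v x)"
    unfolding sp using ei fb by (rule Bochner_Integration.integrable_add)
  have "(LINT x|lebesgue. f x * v x) = (LINT x|lebesgue. ?e x) + (LINT y|lebesgue. \<kappa> * G * (b y * f y) - \<kappa> * H * f y)"
    unfolding sp using ei fb by (rule Bochner_Integration.integral_add)
  also have "(LINT y|lebesgue. \<kappa> * G * (b y * f y) - \<kappa> * H * f y) =
      \<kappa> * G * (LINT y|lebesgue. b y * f y) - \<kappa> * H * (LINT y|lebesgue. f y)"
    using bfi fi by simp
  also have "\<dots> = \<kappa> * cross_mean b f g"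
    by (simp add: cross_mean_def G_def H_def algebra_simps)
  finally have "cmod ((LINT x|lebesgue. f x * v x) - \<kappa> * cross_mean b f g) = cmod (LINT x|lebesgue. ?e x)" by simp
  also have "\<dots> \<le> (LINT x|lebesgue. cmod (?e x))" by (rule integral_norm_bound)
  also have "\<dots> \<le> (LINT x|lebesgue. ?w x)"
    using ew by (rule integral_mono_AE[OF integrable_norm[OF ei] wi])
  also have "\<dots> = \<epsilon> * (?q * (P + P'))" by (rule wI)
  finally show "cmod ((LINT x|lebesgue. f x * v x) - \<kappa> * cross_mean b f g) \<le>
      \<epsilon> * (?q * ((LINT x:cube c l|lebesgue. cmod (b x - m)) + (LINT x:cube c' l|lebesgue. cmod (b x - m))))"
    unfolding P_def P'_def .
qed

section \<open>Duality with the block space\<close>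

lemma cmod_integral_le_nn_integral:
  fixes f :: "'a \<Rightarrow> complex"
  assumes "(\<integral>\<^sup>+x. ennreal (cmod (f x)) \<partial>M) \<le> ennreal B" "0 \<le> B"
  shows "cmod (LINT x|M. f x) \<le> B"
proof (cases "integrable M f")
  case True
  have "ennreal (cmod (LINT x|M. f x)) \<le> ennreal B"
    using integral_norm_bound_ennreal[OF True] assms(1) by (rule order_trans)
  then show ?thesis using assms(2) by (simp add: ennreal_le_iff)
\<comment> \<open>The integral of a non-integrable function is 0 by convention, which
  \<open>0 \<le> B\<close> covers.\<close>
qed (use assms in \<open>simp add: not_integrable_integral_eq\<close>)

lemma bounded_on_indicator_bound:
  assumes "bounded_on Q f" "\<And>x. cmod (f x) \<le> 1"
  shows "cmod (f x) \<le> indicator Q x"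
  using assms by (cases "x \<in> Q") (auto simp: bounded_on_def)

lemma bounded_on_cube_Lc_infty:
  assumes g: "bounded_on (cube c l) g"
  shows "g \<in> Lc_infty"
proof -
  obtain R where R: "\<And>x. x \<in> cube c l \<Longrightarrow> norm x \<le> R"
    using compact_imp_bounded[OF cube_compact[of c l]] by (auto simp: bounded_iff)
  obtain B where B: "\<And>x. cmod (g x) \<le> B" using g by (auto simp: bounded_on_def)
  have z: "g x = 0" if "R < norm x" for x
  proof -
    have "x \<notin> cube c l" using R[of x] that by auto
    then show ?thesis using g by (simp add: bounded_on_def)
  qed
  show ?thesis
    unfolding Lc_infty_def
  proof (intro CollectI conjI)
    show "g \<in> borel_measurable lebesgue" using g by (rule bounded_on_measurable)
    show "\<exists>B. AE x in lebesgue. cmod (g x) \<le> B" using B by (intro exI[of _ B] AE_I2)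
    show "\<exists>R. AE x in lebesgue. R < norm x \<longrightarrow> g x = 0" using z by (intro exI[of _ R] AE_I2) blast
  qed
qed

text \<open>Duality moves the commutator from \<open>f\<close> to \<open>g\<close>: the integral of
  h g is minus that of f G, with \<open>G\<close> the value at \<open>g\<close> of the commutator of
  the transpose on the block space. Replacing \<open>G\<close> by a true commutator
  \<open>v k\<close> changes the pairing with \<open>f\<close> by at most \<eta>, since the block
  norm dominates the integral over Q. Then \<open>commutator_local_estimate\<close> applies.\<close>

lemma commutator_test:
  fixes T :: "('n::finite) dist_op" and p q t :: real and r :: ereal
  assumes e: "(1 < p \<and> p < t \<and> ereal t < r \<and> r < \<infinity>) \<or> (1 < p \<and> p \<le> t \<and> ereal t < r \<and> r = \<infinity>)"
    and q: "1 < q"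
    and T: "cz_operator K T"
    and near: "kernel_near K \<kappa> \<epsilon> (cube c l) (cube c' l)" and dj: "cube c l \<inter> cube c' l = {}" and \<epsilon>: "0 \<le> \<epsilon>"
    and b: "b \<in> L1_loc" and l: "0 < l"
    and f: "bounded_on (cube c l) f" "\<And>x. cmod (f x) \<le> 1" and g: "bounded_on (cube c' l) g" "\<And>x. cmod (g x) \<le> 1"
    and comm: "comm_M p q t r b T f h"
    and W: "(\<integral>\<^sup>+x\<in>cube c' l. ennreal (cmod (h x)) \<partial>lebesgue) \<le> ennreal W" "0 \<le> W"
  shows "cmod \<kappa> * cmod (cross_mean b f g) \<le> W +
      \<epsilon> * (l ^ CARD('n) * ((LINT x:cube c l|lebesgue. cmod (b x - m)) + (LINT x:cube c' l|lebesgue. cmod (b x - m))))"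
    (is "_ \<le> W + ?E")
proof (rule field_le_epsilon)
  fix \<eta> :: real assume \<eta>: "0 < \<eta>"
  let ?Q = "cube c l" and ?H = "H_norm (conj_exp p) (conj_exp q) (conj_exp t) (econj_exp r)"
  have pp: "0 < conj_exp p" "0 < conj_exp q" using e q conj_exp_facts(1)[of p] conj_exp_facts(1)[of q] by auto
  have mQ: "0 < measure lebesgue ?Q" using l by (simp add: measure_cube)
  obtain C where C: "0 < C" "\<And>(w :: 'n cfun) \<epsilon>. w \<in> borel_measurable lebesgue \<Longrightarrow> 0 < \<epsilon> \<Longrightarrow> ?H w < ennreal \<epsilon> \<Longrightarrow>
     (\<integral>\<^sup>+x\<in>?Q. ennreal (cmod (w x)) \<partial>lebesgue) \<le> ennreal (C * \<epsilon>)"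
    using H_norm_L1_bound[OF e q cube_compact mQ] by blast
  have "g \<in> H_space (conj_exp p) (conj_exp q) (conj_exp t) (econj_exp r)"
    by (rule bounded_in_H_space[OF pp bounded_on_measurable[OF g(1)] l bounded_on_indicator_bound[OF g]])
  then obtain G where G: "comm_H (conj_exp p) (conj_exp q) (conj_exp t) (econj_exp r) b (transpose_op T) g G"
    and dual: "(LINT x|lebesgue. h x * g x) = - (LINT x|lebesgue. f x * G x)"
    using comm unfolding comm_M_def by blast
  have Gm[measurable]: "G \<in> borel_measurable lebesgue" using G by (simp add: comm_H_def H_space_def)
  \<comment> \<open>The constant sequence is admissible because \<open>g\<close> itself is bounded
    with compact support; it exhibits \<open>G\<close> as a limit of commutators of this very
    \<open>g\<close>.\<close>
  have pre: "(\<forall>k::nat. g \<in> Lc_infty) \<and> (\<lambda>k::nat. ?H (\<lambda>x. g x - g x)) \<longlonglongrightarrow> 0"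
    using bounded_on_cube_Lc_infty[OF g(1)] by (simp add: H_norm_zero)
  have "\<forall>u::nat \<Rightarrow> 'n cfun. (\<forall>k. u k \<in> Lc_infty) \<and> (\<lambda>k. ?H (\<lambda>x. u k x - g x)) \<longlonglongrightarrow> 0 \<longrightarrow>
        (\<exists>v. (\<forall>k. comm_Lc b (transpose_op T) (u k) (v k)) \<and> (\<lambda>k. ?H (\<lambda>x. v k x - G x)) \<longlonglongrightarrow> 0)"
    using G unfolding comm_H_def by (elim conjE)
  from this[THEN spec, of "\<lambda>k. g", THEN mp, OF pre]
  obtain v where v: "\<And>k::nat. comm_Lc b (transpose_op T) g (v k)" and lim: "(\<lambda>k. ?H (\<lambda>x. v k x - G x)) \<longlonglongrightarrow> 0"
    by blast
  have "eventually (\<lambda>k. ?H (\<lambda>x. v k x - G x) < ennreal (\<eta> / C)) sequentially"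
    using \<eta> C(1) by (intro order_tendstoD(2)[OF lim]) simp
  then obtain k where k: "?H (\<lambda>x. v k x - G x) < ennreal (\<eta> / C)" by (auto simp: eventually_sequentially)
  have vm[measurable]: "v k \<in> borel_measurable lebesgue" using v[of k] by (simp add: comm_Lc_def)
  note loc1 = commutator_local_estimate(1)[OF T v[of k] near dj \<epsilon> b l f g]
  note loc2 = commutator_local_estimate(2)[OF T v[of k] near dj \<epsilon> b l f g, of m]
  have "(\<integral>\<^sup>+x\<in>?Q. ennreal (cmod (v k x - G x)) \<partial>lebesgue) \<le> ennreal (C * (\<eta> / C))"
    using \<eta> C(1) k by (intro C(2)) simp_all
  then have n1: "(\<integral>\<^sup>+x\<in>?Q. ennreal (cmod (v k x - G x)) \<partial>lebesgue) \<le> ennreal \<eta>" using C(1) by simp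
  have n2: "(\<integral>\<^sup>+x. ennreal (cmod (f x * (v k x - G x))) \<partial>lebesgue) \<le> ennreal \<eta>"
  proof (rule order_trans[OF nn_integral_mono n1])
    fix x
    have "cmod (f x * (v k x - G x)) \<le> indicator ?Q x * cmod (v k x - G x)"
      unfolding norm_mult by (intro mult_right_mono bounded_on_indicator_bound f) simp
    then show "ennreal (cmod (f x * (v k x - G x))) \<le> ennreal (cmod (v k x - G x)) * indicator ?Q x"
      by (cases "x \<in> ?Q") (auto intro: ennreal_leI)
  qed
  have i1: "integrable lebesgue (\<lambda>x. f x * (v k x - G x))"
    unfolding integrable_iff_bounded
  proof
    show "(\<lambda>x. f x * (v k x - G x)) \<in> borel_measurable lebesgue"
      using bounded_on_measurable[OF f(1)] by measurable
    show "(\<integral>\<^sup>+x. ennreal (norm (f x * (v k x - G x))) \<partial>lebesgue) < \<infinity>"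
      using n2 by (rule le_less_trans) simp
  qed
  have "(LINT x|lebesgue. f x * G x) = (LINT x|lebesgue. f x * v k x - f x * (v k x - G x))"
    by (rule Bochner_Integration.integral_cong) (auto simp: algebra_simps)
  also have "\<dots> = (LINT x|lebesgue. f x * v k x) - (LINT x|lebesgue. f x * (v k x - G x))"
    using loc1 i1 by (rule Bochner_Integration.integral_diff)
  finally have fG: "(LINT x|lebesgue. f x * v k x) = (LINT x|lebesgue. f x * G x) + (LINT x|lebesgue. f x * (v k x - G x))"
    by simp
  have s1: "cmod (LINT x|lebesgue. f x * (v k x - G x)) \<le> \<eta>"
    using n2 \<eta> by (intro cmod_integral_le_nn_integral) auto
  have s2: "cmod (LINT x|lebesgue. f x * G x) \<le> W"
  proof -
    have "(\<integral>\<^sup>+x. ennreal (cmod (h x * g x)) \<partial>lebesgue) \<le> ennreal W"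
    proof (rule order_trans[OF nn_integral_mono W(1)])
      fix x
      have "cmod (h x * g x) \<le> cmod (h x) * indicator (cube c' l) x"
        unfolding norm_mult by (intro mult_left_mono bounded_on_indicator_bound g) simp
      then show "ennreal (cmod (h x * g x)) \<le> ennreal (cmod (h x)) * indicator (cube c' l) x"
        by (cases "x \<in> cube c' l") (auto intro: ennreal_leI)
    qed
    then have "cmod (LINT x|lebesgue. h x * g x) \<le> W" using W(2) by (rule cmod_integral_le_nn_integral)
    then show ?thesis unfolding dual by simp
  qed
  have "cmod \<kappa> * cmod (cross_mean b f g) = cmod (\<kappa> * cross_mean b f g)" by (simp add: norm_mult)
  also have "\<dots> \<le> cmod (LINT x|lebesgue. f x * v k x) + cmod ((LINT x|lebesgue. f x * v k x) - \<kappa> * cross_mean b f g)"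
    using norm_triangle_ineq4[of "LINT x|lebesgue. f x * v k x" "(LINT x|lebesgue. f x * v k x) - \<kappa> * cross_mean b f g"] by simp
  also have "cmod (LINT x|lebesgue. f x * v k x) \<le> W + \<eta>"
    unfolding fG using norm_triangle_ineq[of "LINT x|lebesgue. f x * G x" "LINT x|lebesgue. f x * (v k x - G x)"] s1 s2 by linarith
  finally show "cmod \<kappa> * cmod (cross_mean b f g) \<le> W + ?E + \<eta>"
    using loc2 by linarith
qed

text \<open>The conjugate sign of b - b_Q recovers the oscillation. Removing its mean kills one of
  the two terms of \<open>cross_mean\<close> and leaves the pairing unchanged, because b - b_Q has
  integral 0 over Q.\<close>

lemma oscillation_test_function:
  fixes b :: "('n::finite) cfun"
  assumes b: "set_integrable lebesgue Q b" and Q: "Q \<in> lmeasurable" "0 < measure lebesgue Q"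
  obtains f where "bounded_on Q f" "\<And>x. cmod (f x) \<le> 1" "(LINT x|lebesgue. f x) = 0"
    "(LINT x|lebesgue. b x * f x) = of_real ((LINT x:Q|lebesgue. cmod (b x - mean b Q)) / 2)"
proof -
  let ?q = "measure lebesgue Q" and ?m = "mean b Q"
  have Qs[measurable]: "Q \<in> sets lebesgue" using Q by auto
  define w where "w x = indicator Q x *\<^sub>R (b x - ?m)" for x
  have wi: "integrable lebesgue w"
    using set_integral_diff(1)[OF b set_integrable_const_lmeasurable[OF Q(1)], of ?m]
    by (simp add: set_integrable_def w_def[abs_def])
  have wm[measurable]: "w \<in> borel_measurable lebesgue" using wi by (rule borel_measurable_integrable)
  define \<sigma> where "\<sigma> x = cnj (w x) / of_real (cmod (w x))" for x
  have \<sigma>m: "\<sigma> \<in> borel_measurable lebesgue"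
    unfolding \<sigma>_def[abs_def] using wm by (rule conjugate_sign(1))
  have \<sigma>1: "cmod (\<sigma> x) \<le> 1" and \<sigma>w: "w x * \<sigma> x = of_real (cmod (w x))" for x
    unfolding \<sigma>_def by (rule conjugate_sign)+
  have \<sigma>b: "bounded_on Q \<sigma>"
    unfolding bounded_on_def using \<sigma>m \<sigma>1 by (auto simp: \<sigma>_def w_def)
  define s where "s = (LINT x|lebesgue. \<sigma> x)"
  have s1: "cmod s \<le> ?q"
  proof -
    have "cmod s \<le> (LINT x|lebesgue. cmod (\<sigma> x))" unfolding s_def by (rule integral_norm_bound)
    also have "\<dots> \<le> ?q" by (rule bounded_on_L1_le_measure[OF \<sigma>b \<sigma>1 Q(1)])
    finally show ?thesis .
  qed
  let ?ind = "indicator Q :: _ \<Rightarrow> complex"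
  have ib: "bounded_on Q ?ind" using Qs by (rule bounded_on_indicator)
  have iI: "(LINT x|lebesgue. ?ind x) = of_real ?q"
    by (rule integral_indicator_complex[OF Q(1)])
  \<comment> \<open>The mean has modulus at most 1, so the difference is bounded by 2; the factor
    1/2 normalises it and reappears in the pairing.\<close>
  define f where "f x = (1 / 2) * (\<sigma> x - s / of_real ?q * ?ind x)" for x
  have fb: "bounded_on Q f"
    unfolding f_def[abs_def] by (intro bounded_on_scale bounded_on_diff \<sigma>b ib)
  have f1: "cmod (f x) \<le> 1" for x
  proof -
    have "cmod (s / of_real ?q * ?ind x) \<le> 1 * 1"
      unfolding norm_mult using s1 Q(2) by (intro mult_mono) (auto simp: norm_divide indicator_def)
    then have "cmod (\<sigma> x - s / of_real ?q * ?ind x) \<le> 2"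
      using \<sigma>1[of x] norm_triangle_ineq4[of "\<sigma> x" "s / of_real ?q * ?ind x"] by linarith
    then show ?thesis by (simp add: f_def norm_mult)
  qed
  have \<sigma>i: "integrable lebesgue \<sigma>" by (rule bounded_on_integrable(1)[OF \<sigma>b Q(1)])
  have ii: "integrable lebesgue ?ind" by (rule bounded_on_integrable(1)[OF ib Q(1)])
  have f0: "(LINT x|lebesgue. f x) = 0"
  proof -
    have "(LINT x|lebesgue. f x) = (1 / 2) * ((LINT x|lebesgue. \<sigma> x) - s / of_real ?q * (LINT x|lebesgue. ?ind x))"
      unfolding f_def using \<sigma>i ii by simp
    then show ?thesis using Q(2) by (simp add: iI s_def[symmetric])
  qed
  have fi: "integrable lebesgue f" by (rule bounded_on_integrable(1)[OF fb Q(1)])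
  have bf: "integrable lebesgue (\<lambda>x. b x * f x)" by (rule set_integrable_mult_bounded_on[OF b fb])
  have w0: "(LINT x|lebesgue. w x) = 0"
  proof -
    have "(LINT x:Q|lebesgue. b x - ?m) = (LINT x:Q|lebesgue. b x) - (LINT x:Q|lebesgue. ?m)"
      by (rule set_integral_diff(2)[OF b set_integrable_const_lmeasurable[OF Q(1)]])
    also have "(LINT x:Q|lebesgue. ?m) = of_real ?q * ?m"
      unfolding set_lebesgue_integral_def using Q(1)
      by (simp add: scaleR_conv_of_real fmeasurable_def less_top[symmetric])
    finally show ?thesis using Q(2) by (simp add: mean_def w_def[abs_def] set_lebesgue_integral_def)
  qed
  have "(LINT x|lebesgue. b x * f x) = (LINT x|lebesgue. b x * f x) - ?m * (LINT x|lebesgue. f x)" using f0 by simp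
  also have "\<dots> = (LINT x|lebesgue. b x * f x - ?m * f x)" using bf fi by simp
  also have "\<dots> = (LINT x|lebesgue. (1 / 2) * (w x * \<sigma> x - s / of_real ?q * w x))"
  proof (rule Bochner_Integration.integral_cong[OF refl])
    fix x
    show "b x * f x - ?m * f x = (1 / 2) * (w x * \<sigma> x - s / of_real ?q * w x)"
    proof (cases "x \<in> Q")
      case True
      then have "b x = w x + ?m" by (simp add: w_def)
      then have "b x * f x - ?m * f x = w x * f x" by (simp add: distrib_right)
      also have "\<dots> = (1 / 2) * (w x * \<sigma> x - s / of_real ?q * w x)"
        using True by (simp add: f_def right_diff_distrib mult_ac)
      finally show ?thesis .
    next
      case False
      then have "f x = 0" using fb by (simp add: bounded_on_def)
      with False show ?thesis by (simp add: w_def)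
    qed
  qed
  also have "\<dots> = (1 / 2) * ((LINT x|lebesgue. w x * \<sigma> x) - s / of_real ?q * (LINT x|lebesgue. w x))"
  proof -
    have "integrable lebesgue (\<lambda>x. w x * \<sigma> x)" unfolding \<sigma>w using wi by simp
    then show ?thesis using wi by simp
  qed
  also have "(LINT x|lebesgue. w x * \<sigma> x) = of_real (LINT x|lebesgue. cmod (w x))"
    unfolding \<sigma>w by (rule integral_complex_of_real)
  also have "(LINT x|lebesgue. cmod (w x)) = (LINT x:Q|lebesgue. cmod (b x - ?m))"
    unfolding set_lebesgue_integral_def by (rule Bochner_Integration.integral_cong) (auto simp: w_def indicator_def)
  finally have "(LINT x|lebesgue. b x * f x) = of_real ((LINT x:Q|lebesgue. cmod (b x - ?m)) / 2)"
    using w0 by simp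
  with fb f1 f0 show thesis by (rule that)
qed

text \<open>Three tests isolate the three parts of the total oscillation: mean free against
  indicator gives \<alpha>/2, indicator against mean free \<beta>/2, and the two indicators give
  \<gamma>. Each test has the total oscillation in its error, so none can be closed alone; only
  their sum can be absorbed.\<close>

lemma oscillation_absorption:
  fixes T :: "('n::finite) dist_op" and p q t :: real and r :: ereal
  assumes e: "(1 < p \<and> p < t \<and> ereal t < r \<and> r < \<infinity>) \<or> (1 < p \<and> p \<le> t \<and> ereal t < r \<and> r = \<infinity>)"
    and q: "1 < q"
    and T: "cz_operator K T"
    and near: "kernel_near K \<kappa> \<epsilon> (cube c l) (cube c' l)" and dj: "cube c l \<inter> cube c' l = {}" and \<epsilon>: "0 \<le> \<epsilon>"
    and b: "b \<in> L1_loc" and l: "0 < l" and \<kappa>: "10 * \<epsilon> \<le> cmod \<kappa>"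
    and W: "0 \<le> W" "\<And>f. bounded_on (cube c l) f \<Longrightarrow> (\<And>x. cmod (f x) \<le> 1) \<Longrightarrow>
      \<exists>h. comm_M p q t r b T f h \<and> (\<integral>\<^sup>+x\<in>cube c' l. ennreal (cmod (h x)) \<partial>lebesgue) \<le> ennreal W"
  shows "cmod \<kappa> * (l ^ CARD('n) * (LINT x:cube c l|lebesgue. cmod (b x - mean b (cube c l)))) \<le> 10 * W"
proof -
  let ?Q = "cube c l" and ?Q' = "cube c' l" and ?s = "l ^ CARD('n)"
  have mQ: "measure lebesgue ?Q = ?s" "measure lebesgue ?Q' = ?s"
    using l by (auto intro: measure_cube)
  have s: "0 < ?s" using l by simp
  have bi: "set_integrable lebesgue ?Q b" "set_integrable lebesgue ?Q' b"
    using b cube_compact by (auto simp: L1_loc_def)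
  define m where "m = mean b ?Q"
  define m' where "m' = mean b ?Q'"
  define \<alpha> where "\<alpha> = (LINT x:?Q|lebesgue. cmod (b x - m))"
  define \<beta> where "\<beta> = (LINT x:?Q'|lebesgue. cmod (b x - m'))"
  define \<gamma> where "\<gamma> = ?s * cmod (m - m')"
  have nn: "0 \<le> \<alpha>" "0 \<le> \<beta>" "0 \<le> \<gamma>"
    unfolding \<alpha>_def \<beta>_def \<gamma>_def set_lebesgue_integral_def
    using s by (auto intro!: Bochner_Integration.integral_nonneg)
  have bmi: "set_integrable lebesgue ?Q (\<lambda>x. b x - a)" for a
    by (rule set_integral_diff(1)[OF bi(1) set_integrable_const_lmeasurable[OF cube_lmeasurable]])
  \<comment> \<open>The mean m' over the second cube serves as reference constant on both cubes; on
    the first cube this costs the difference of the means.\<close>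
  have tri: "(LINT x:?Q|lebesgue. cmod (b x - m')) \<le> \<alpha> + \<gamma>"
  proof -
    note i2 = integrable_indicator_lmeasurable[OF cube_lmeasurable[of c l]]
    have i1: "integrable lebesgue (\<lambda>x. indicat_real ?Q x *\<^sub>R cmod (b x - a))" for a
      using set_integrable_norm[OF bmi, of a] by (simp add: set_integrable_def)
    have "(LINT x:?Q|lebesgue. cmod (b x - m')) \<le> (LINT x|lebesgue. indicat_real ?Q x *\<^sub>R cmod (b x - m) + indicat_real ?Q x * cmod (m - m'))"
      unfolding set_lebesgue_integral_def
    proof (rule integral_mono)
      show "integrable lebesgue (\<lambda>x. indicat_real ?Q x *\<^sub>R cmod (b x - m'))" by (rule i1)
      show "integrable lebesgue (\<lambda>x. indicat_real ?Q x *\<^sub>R cmod (b x - m) + indicat_real ?Q x * cmod (m - m'))"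
        by (intro Bochner_Integration.integrable_add i1 integrable_mult_left i2)
      fix x
      show "indicat_real ?Q x *\<^sub>R cmod (b x - m') \<le> indicat_real ?Q x *\<^sub>R cmod (b x - m) + indicat_real ?Q x * cmod (m - m')"
        using norm_triangle_ineq[of "b x - m" "m - m'"] by (simp add: indicator_def)
    qed
    also have "\<dots> = \<alpha> + \<gamma>"
      using i1[of m] i2 mQ by (simp add: \<alpha>_def \<gamma>_def set_lebesgue_integral_def)
    finally show ?thesis .
  qed
  have test: "cmod \<kappa> * cmod (cross_mean b f g) \<le> W + \<epsilon> * (?s * (\<alpha> + \<gamma> + \<beta>))"
    if f: "bounded_on ?Q f" "\<And>x. cmod (f x) \<le> 1" and g: "bounded_on ?Q' g" "\<And>x. cmod (g x) \<le> 1" for f g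
  proof -
    obtain h where h: "comm_M p q t r b T f h" "(\<integral>\<^sup>+x\<in>?Q'. ennreal (cmod (h x)) \<partial>lebesgue) \<le> ennreal W"
      using W(2)[OF f] by blast
    have "cmod \<kappa> * cmod (cross_mean b f g) \<le> W +
      \<epsilon> * (?s * ((LINT x:?Q|lebesgue. cmod (b x - m')) + (LINT x:?Q'|lebesgue. cmod (b x - m'))))"
      by (rule commutator_test[OF e q T near dj \<epsilon> b l f g h W(1)])
    also have "\<dots> \<le> W + \<epsilon> * (?s * (\<alpha> + \<gamma> + \<beta>))"
      using tri \<epsilon> s by (intro add_left_mono mult_left_mono) (auto simp: \<beta>_def)
    finally show ?thesis .
  qed
  have ib: "bounded_on (cube a l) (indicator (cube a l))" for a :: "real^'n"
    by (intro bounded_on_indicator cube_sets)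
  have i1: "cmod (indicator A x) \<le> 1" for A and x :: "real^'n" by (simp add: indicator_def)
  have iI: "(LINT x|lebesgue. indicator (cube a l) x :: complex) = of_real ?s" for a :: "real^'n"
    using l by (simp add: integral_indicator_complex measure_cube)
  have bI: "(LINT x|lebesgue. b x * indicator (cube a l) x) = of_real ?s * mean b (cube a l)" for a :: "real^'n"
  proof -
    have "(LINT x|lebesgue. b x * indicator (cube a l) x) = (LINT x:cube a l|lebesgue. b x)"
      unfolding set_lebesgue_integral_def by (rule Bochner_Integration.integral_cong) (auto simp: indicator_def)
    then show ?thesis using l by (simp add: mean_def measure_cube)
  qed
  have mpos: "0 < measure lebesgue ?Q" "0 < measure lebesgue ?Q'" using s mQ by auto
  obtain f where f: "bounded_on ?Q f" "\<And>x. cmod (f x) \<le> 1" "(LINT x|lebesgue. f x) = 0"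
    "(LINT x|lebesgue. b x * f x) = of_real (\<alpha> / 2)"
    using oscillation_test_function[OF bi(1) cube_lmeasurable mpos(1)] unfolding \<alpha>_def m_def by blast
  obtain g where g: "bounded_on ?Q' g" "\<And>x. cmod (g x) \<le> 1" "(LINT x|lebesgue. g x) = 0"
    "(LINT x|lebesgue. b x * g x) = of_real (\<beta> / 2)"
    using oscillation_test_function[OF bi(2) cube_lmeasurable mpos(2)] unfolding \<beta>_def m'_def by blast
  define R where "R = W + \<epsilon> * (?s * (\<alpha> + \<gamma> + \<beta>))"
  have "cross_mean b f (indicator ?Q') = of_real (?s * (\<alpha> / 2))"
    by (simp add: cross_mean_def f(3,4) iI)
  then have c1: "cmod (cross_mean b f (indicator ?Q')) = ?s * (\<alpha> / 2)" using s nn by (simp only: norm_of_real) simp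
  have t1: "cmod \<kappa> * (?s * (\<alpha> / 2)) \<le> R" unfolding R_def c1[symmetric] by (rule test[OF f(1,2) ib i1])
  have "cross_mean b (indicator ?Q) g = - of_real (?s * (\<beta> / 2))"
    by (simp add: cross_mean_def g(3,4) iI)
  then have c2: "cmod (cross_mean b (indicator ?Q) g) = ?s * (\<beta> / 2)" using s nn by (simp only: norm_of_real norm_minus_cancel) simp
  have t2: "cmod \<kappa> * (?s * (\<beta> / 2)) \<le> R" unfolding R_def c2[symmetric] by (rule test[OF ib i1 g(1,2)])
  have "cross_mean b (indicator ?Q) (indicator ?Q') = of_real (?s * ?s) * (m - m')"
    by (simp add: cross_mean_def iI bI m_def m'_def algebra_simps)
  then have c3: "cmod (cross_mean b (indicator ?Q) (indicator ?Q')) = ?s * \<gamma>"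
    using s by (simp only: norm_mult norm_of_real) (simp add: \<gamma>_def)
  have t3: "cmod \<kappa> * (?s * \<gamma>) \<le> R"
  proof -
    have "cmod \<kappa> * cmod (cross_mean b (indicator ?Q) (indicator ?Q')) \<le> R"
      unfolding R_def by (rule test[OF ib i1 ib i1])
    then show ?thesis by (simp only: c3)
  qed
  define Z where "Z = ?s * (\<alpha> + \<gamma> + \<beta>)"
  have Z0: "0 \<le> Z" unfolding Z_def using s nn by (intro mult_nonneg_nonneg) auto
  \<comment> \<open>The weights 2, 2 and 1 add up to 5. As 10 \<epsilon> \<le> |\<kappa>|, the error
    5 \<epsilon> Z is at most half of the left-hand side, which leaves 10 W.\<close>
  have "cmod \<kappa> * Z = 2 * (cmod \<kappa> * (?s * (\<alpha> / 2))) + 2 * (cmod \<kappa> * (?s * (\<beta> / 2))) + cmod \<kappa> * (?s * \<gamma>)"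
    by (simp add: Z_def algebra_simps)
  also have "\<dots> \<le> 5 * R" using t1 t2 t3 by linarith
  also have "\<dots> = 5 * W + 5 * (\<epsilon> * Z)" by (simp add: R_def Z_def)
  finally have "cmod \<kappa> * Z \<le> 5 * W + 5 * (\<epsilon> * Z)" .
  moreover have "10 * (\<epsilon> * Z) \<le> cmod \<kappa> * Z" using mult_right_mono[OF \<kappa> Z0] by (simp add: mult.assoc)
  ultimately have "cmod \<kappa> * Z \<le> 10 * W" by linarith
  moreover have "cmod \<kappa> * (?s * \<alpha>) \<le> cmod \<kappa> * Z"
    unfolding Z_def using nn s by (intro mult_left_mono) auto
  ultimately show ?thesis unfolding \<alpha>_def m_def by linarith
qed

section \<open>Choice of the constants and conclusion\<close>

lemma M_norm_bounded:
  fixes p q t :: real and r :: ereal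
  assumes e: "(1 < p \<and> p < t \<and> ereal t < r \<and> r < \<infinity>) \<or> (1 < p \<and> p \<le> t \<and> ereal t < r \<and> r = \<infinity>)"
    and q: "0 < q"
  obtains C where "0 < C" "\<And>(f :: ('n::finite) cfun) S. (\<And>x. cmod (f x) \<le> indicator S x) \<Longrightarrow> S \<in> lmeasurable \<Longrightarrow>
     0 < measure lebesgue S \<Longrightarrow> M_norm p q t r f \<le> ennreal (C * measure lebesgue S powr (1 / t))"
proof (cases "r = \<infinity>")
  case True
  show thesis
  proof (rule that[of "(p / q) powr (1 / q)"])
    show "0 < (p / q) powr (1 / q)" using e q by auto
  qed (use e q True in \<open>auto intro: M_norm_bounded_infinite\<close>)
next
  case False
  with e obtain s where s: "r = ereal s" by (cases r) auto
  then have s1: "p < t" "t < s" "0 < p" using e by auto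
  show thesis
  proof (rule that[of "(p / q) powr (1 / q) * dyadic_const p t s powr (1 / s)"])
    show "0 < (p / q) powr (1 / q) * dyadic_const p t s powr (1 / s)"
      using s1 q dyadic_const_pos[of p t s] by auto
  qed (unfold s, rule M_norm_bounded_finite[OF s1(3) q s1(1,2)], auto)
qed

text \<open>The operator norm is an infimum that may fail to be attained, so the estimate is proved
  for each finite admissible constant first; infinite ones are harmless.\<close>

lemma ennreal_le_mult_Inf:
  fixes X :: ennreal
  assumes k: "0 < k" and le: "\<And>C. 0 \<le> C \<Longrightarrow> ennreal C \<in> S \<Longrightarrow> X \<le> ennreal (k * C)"
  shows "X \<le> ennreal k * Inf S"
proof -
  have "X / ennreal k \<le> Inf S"
  proof (rule Inf_greatest)
    fix D assume D: "D \<in> S"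
    show "X / ennreal k \<le> D"
    proof (cases D)
      case (real C)
      then have "X \<le> ennreal k * D" using le[of C] D k by (simp add: ennreal_mult)
      then have "X / ennreal k \<le> (ennreal k * D) / ennreal k" by (rule divide_right_mono_ennreal)
      also have "\<dots> = D" using k by (simp add: ennreal_mult_divide_eq mult.commute[of "ennreal k"])
      finally show ?thesis .
    qed simp
  qed
  then have "ennreal k * (X / ennreal k) \<le> ennreal k * Inf S" by (rule mult_left_mono) simp
  moreover have "ennreal k * (X / ennreal k) = X"
    using k by (simp add: ennreal_times_divide mult.commute[of "ennreal k"] ennreal_mult_divide_eq)
  ultimately show ?thesis by simp
qed

text \<open>The separation \<open>N\<close> is fixed before the operator, the symbol and the cube,
  so \<open>k\<close> depends only on the dimension, the exponents, \<delta> and A. This is possible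
  because \<epsilon> and the homogeneity bound scale alike in \<open>l\<close>.\<close>

lemma mean_oscillation_le:
  fixes p q t \<delta> A :: real and r :: ereal
  assumes q: "1 < q"
    and e: "(1 < p \<and> p < t \<and> ereal t < r \<and> r < \<infinity>) \<or> (1 < p \<and> p \<le> t \<and> ereal t < r \<and> r = \<infinity>)"
    and \<delta>: "0 < \<delta>" and A: "0 < A"
  obtains k where "0 < k" "\<And>(K :: real ^ 'n \<Rightarrow> real ^ 'n \<Rightarrow> complex) T b C c l.
    K \<in> SK \<delta> A \<Longrightarrow> cz_operator K T \<Longrightarrow> homogeneous T \<Longrightarrow> b \<in> L1_loc \<Longrightarrow> 0 \<le> C \<Longrightarrow>
    (\<forall>f \<in> M_space p q t r. \<exists>h. comm_M p q t r b T f h \<and> M_norm p q t r h \<le> ennreal C * M_norm p q t r f) \<Longrightarrow> 0 < l \<Longrightarrow>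
    (LINT x:cube c l|lebesgue. cmod (b x - mean b (cube c l))) \<le> k * C * l ^ CARD('n)"
proof -
  let ?n = "real CARD('n)"
  have n: "1 \<le> ?n" by (simp add: Suc_leI)
  have pt: "1 < p" "1 < t" "0 < r" using e q by (auto intro: less_trans[of 0 "ereal t" r])
  obtain C1 where C1: "0 < C1" "\<And>(f :: 'n cfun) S. (\<And>x. cmod (f x) \<le> indicator S x) \<Longrightarrow> S \<in> lmeasurable \<Longrightarrow>
     0 < measure lebesgue S \<Longrightarrow> M_norm p q t r f \<le> ennreal (C1 * measure lebesgue S powr (1 / t))"
    using M_norm_bounded[OF e, of q] q by auto
  define C2 where "C2 = real CARD('n \<Rightarrow> bool) * lorentz_L1_const p q * (2 ^ CARD('n)) powr (1 - 1 / t)"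
  have C2: "0 < C2" unfolding C2_def using lorentz_L1_const_pos[of p q] pt q
    by (intro mult_pos_pos) (auto simp del: card_fun simp: card_gt_0_iff)
  \<comment> \<open>The part of \<epsilon> l^n that is left after the powers of \<open>l\<close>
    have cancelled and N^(-n-\<delta>) has been split off.\<close>
  define E0 where "E0 = 2 * (A * ?n powr \<delta> * 2 powr (?n + \<delta>))"
  have E0: "0 < E0" unfolding E0_def using A n by simp
  \<comment> \<open>The bounds 10 and 4 n are the geometric requirements. The last entry gives 11
    \<epsilon> l^n \<le> (4 N)^-n; since (|\<kappa>| + \<epsilon>) l^n is at least (4 N)^-n, it
    follows that |\<kappa>| \<ge> 10 \<epsilon>.\<close>
  define N where "N = max (max 10 (4 * ?n)) ((11 * 4 ^ CARD('n) * E0) powr (1 / \<delta>))"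
  have N: "4 * ?n \<le> N" "10 \<le> N" by (auto simp: N_def)
  then have N0: "0 < N" by simp
  have N\<delta>: "11 * 4 ^ CARD('n) * E0 \<le> N powr \<delta>"
  proof -
    have "((11 * 4 ^ CARD('n) * E0) powr (1 / \<delta>)) powr \<delta> \<le> N powr \<delta>"
      using \<delta> by (intro powr_mono2) (auto simp: N_def)
    then show ?thesis using \<delta> E0 by (simp add: powr_powr)
  qed
  show thesis
  proof (rule that[of "20 * (C1 * C2) * (4 * N) ^ CARD('n)"])
    show "0 < 20 * (C1 * C2) * (4 * N) ^ CARD('n)" using C1 C2 N0 by simp
    fix K :: "real ^ 'n \<Rightarrow> real ^ 'n \<Rightarrow> complex" and T b C and c :: "real ^ 'n" and l :: real
    assume K: "K \<in> SK \<delta> A" and T: "cz_operator K T" and hom: "homogeneous T" and b: "b \<in> L1_loc" and C: "0 \<le> C"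
      and op: "\<forall>f \<in> M_space p q t r. \<exists>h. comm_M p q t r b T f h \<and> M_norm p q t r h \<le> ennreal C * M_norm p q t r f"
      and l: "0 < l"
    \<comment> \<open>Any coordinate direction will do for the translation.\<close>
    define i where "i = (undefined :: 'n)"
    define c' where "c' = c + (N * l) *\<^sub>R axis i 1"
    define \<kappa> where "\<kappa> = K c' c"
    define \<epsilon> where "\<epsilon> = 2 * (A * (?n * l) powr \<delta> / (N * l / 2) powr (?n + \<delta>))"
    define s where "s = l ^ CARD('n)"
    have s: "0 < s" "s = l powr ?n" using l by (auto simp: s_def powr_realpow)
    have mQ: "measure lebesgue (cube a l) = s" for a :: "real^'n" using l by (simp add: s_def measure_cube)
    have near: "kernel_near K \<kappa> \<epsilon> (cube c l) (cube c' l)"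
      unfolding \<kappa>_def \<epsilon>_def c'_def by (rule kernel_near_separated[OF K \<delta> A l N(1)])
    have dj: "cube c l \<inter> cube c' l = {}" unfolding c'_def by (rule separated_cubes(2)[OF l N(1)])
    have \<epsilon>0: "0 \<le> \<epsilon>" unfolding \<epsilon>_def using A by simp
    have \<epsilon>s: "11 * (\<epsilon> * s) \<le> 1 / (4 * N) ^ CARD('n)"
    proof -
      have "\<epsilon> * s = E0 / (N powr ?n * N powr \<delta>)"
        using l N0 n by (simp add: \<epsilon>_def E0_def s(2) powr_mult powr_divide powr_add field_simps)
      also have "\<dots> \<le> E0 / (N powr ?n * (11 * 4 ^ CARD('n) * E0))"
        using E0 N\<delta> N0 by (intro divide_left_mono mult_left_mono) auto
      also have "\<dots> = 1 / (4 * N) ^ CARD('n) / 11"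
        using E0 N0 by (simp add: powr_realpow power_mult_distrib field_simps)
      finally show ?thesis by simp
    qed
    have low: "1 / (4 * N) ^ CARD('n) \<le> (cmod \<kappa> + \<epsilon>) * s"
      unfolding s_def by (rule homogeneous_kernel_lower_bound[OF T hom l N \<epsilon>0 near c'_def])
    \<comment> \<open>Since \<epsilon> \<le> |\<kappa>|, the sum |\<kappa>| + \<epsilon> is at most
      2 |\<kappa>|; this 2 and the 10 of the absorption make up the 20 in the constant.\<close>
    have low2: "1 / (4 * N) ^ CARD('n) \<le> 2 * (cmod \<kappa> * s)" and \<kappa>\<epsilon>: "10 * \<epsilon> \<le> cmod \<kappa>"
    proof -
      have "0 \<le> \<epsilon> * s" using \<epsilon>0 s by simp
      then have a: "10 * (\<epsilon> * s) \<le> cmod \<kappa> * s" using \<epsilon>s low by (simp add: distrib_right)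
      then show "10 * \<epsilon> \<le> cmod \<kappa>" using s(1) by (simp add: mult.assoc[symmetric])
      show "1 / (4 * N) ^ CARD('n) \<le> 2 * (cmod \<kappa> * s)"
        using low a \<open>0 \<le> \<epsilon> * s\<close> by (simp add: distrib_right)
    qed
    \<comment> \<open>The norm of \<open>f\<close> contributes s^(1/t) and the integral over the
      second cube s^(1 - 1/t), so the exponents of the space disappear from the power of
      \<open>s\<close>.\<close>
    define W where "W = C * (C1 * C2) * s"
    have W0: "0 \<le> W" unfolding W_def using C C1 C2 s by simp
    have W: "\<exists>h. comm_M p q t r b T f h \<and> (\<integral>\<^sup>+x\<in>cube c' l. ennreal (cmod (h x)) \<partial>lebesgue) \<le> ennreal W"
      if f: "bounded_on (cube c l) f" "\<And>x. cmod (f x) \<le> 1" for f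
    proof -
      have "M_norm p q t r f \<le> ennreal (C1 * measure lebesgue (cube c l) powr (1 / t))"
        using C1(2)[OF bounded_on_indicator_bound[OF f] cube_lmeasurable] mQ s by simp
      then have Mf: "M_norm p q t r f \<le> ennreal (C1 * s powr (1 / t))" by (simp add: mQ)
      then have "f \<in> M_space p q t r"
        unfolding M_space_def using bounded_on_measurable[OF f(1)] by (auto intro: le_less_trans)
      then obtain h where h: "comm_M p q t r b T f h" "M_norm p q t r h \<le> ennreal C * M_norm p q t r f"
        using op by blast
      have "h \<in> borel_measurable lebesgue" using h(1) by (simp add: comm_M_def M_space_def)
      then have "(\<integral>\<^sup>+x\<in>cube c' l. ennreal (cmod (h x)) \<partial>lebesgue) \<le>
          ennreal (real CARD('n \<Rightarrow> bool) * lorentz_L1_const p q * (2 ^ CARD('n) * s) powr (1 - 1 / t)) * M_norm p q t r h"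
        using nn_integral_cube_le_M_norm[OF pt(1) _ _ pt(3) l, of q t h c'] q pt mQ by simp
      also have "real CARD('n \<Rightarrow> bool) * lorentz_L1_const p q * (2 ^ CARD('n) * s) powr (1 - 1 / t) = C2 * s powr (1 - 1 / t)"
        using s by (simp add: C2_def powr_mult del: card_fun)
      also have "ennreal (C2 * s powr (1 - 1 / t)) * M_norm p q t r h \<le>
          ennreal (C2 * s powr (1 - 1 / t)) * (ennreal C * ennreal (C1 * s powr (1 / t)))"
        using h(2) mult_left_mono[OF Mf, of "ennreal C"] by (intro mult_left_mono) (auto intro: order_trans)
      also have "\<dots> = ennreal (C2 * s powr (1 - 1 / t) * (C * (C1 * s powr (1 / t))))"
        using C C1 C2 s by (simp add: ennreal_mult)
      also have "C2 * s powr (1 - 1 / t) * (C * (C1 * s powr (1 / t))) = W"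
      proof -
        have "s powr (1 - 1 / t) * s powr (1 / t) = s" using s(1) by (simp flip: powr_add)
        then show ?thesis by (simp add: W_def mult_ac)
      qed
      finally show ?thesis using h(1) by blast
    qed
    define \<alpha> where "\<alpha> = (LINT x:cube c l|lebesgue. cmod (b x - mean b (cube c l)))"
    have \<alpha>0: "0 \<le> \<alpha>" unfolding \<alpha>_def set_lebesgue_integral_def by (auto intro!: Bochner_Integration.integral_nonneg)
    have "cmod \<kappa> * (s * \<alpha>) \<le> 10 * W"
      unfolding s_def \<alpha>_def
      by (rule oscillation_absorption[OF e q T near dj \<epsilon>0 b l \<kappa>\<epsilon> W0 W])
    then have "1 / (4 * N) ^ CARD('n) * \<alpha> \<le> 2 * (10 * W)"
      using mult_right_mono[OF low2 \<alpha>0] by (simp add: mult.assoc)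
    then have "\<alpha> \<le> 20 * W * (4 * N) ^ CARD('n)" using N0 by (simp add: field_simps)
    then show "\<alpha> \<le> 20 * (C1 * C2) * (4 * N) ^ CARD('n) * C * l ^ CARD('n)"
      by (simp add: W_def s_def mult_ac)
  qed
qed

text \<open>The implied constant is quantified before the kernel, the operator and the symbol.
  Boundedness of the commutator, implicit in writing its operator norm, is expressed by finiteness
  of \<open>comm_op_norm\<close>.\<close>

theorem theorem5p7:
  fixes p q t \<delta> A :: real and r :: ereal
  assumes "1 < q"
    and "(1 < p \<and> p < t \<and> ereal t < r \<and> r < \<infinity>) \<or> (1 < p \<and> p \<le> t \<and> ereal t < r \<and> r = \<infinity>)"
    and "0 < \<delta>" and "0 < A"
  shows "\<exists>c>0. \<forall>(K :: real ^ 'n \<Rightarrow> real ^ 'n \<Rightarrow> complex) T b.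
    K \<in> SK \<delta> A \<and> cz_operator K T \<and> homogeneous T \<and> b \<in> L1_loc \<and>
    comm_op_norm p q t r b T < \<infinity> \<longrightarrow>
      b \<in> BMO \<and> BMO_norm b \<le> ennreal c * comm_op_norm p q t r b T"
proof -
  obtain k where k: "0 < k" "\<And>(K :: real ^ 'n \<Rightarrow> real ^ 'n \<Rightarrow> complex) T b C c l.
    K \<in> SK \<delta> A \<Longrightarrow> cz_operator K T \<Longrightarrow> homogeneous T \<Longrightarrow> b \<in> L1_loc \<Longrightarrow> 0 \<le> C \<Longrightarrow>
    (\<forall>f \<in> M_space p q t r. \<exists>h. comm_M p q t r b T f h \<and> M_norm p q t r h \<le> ennreal C * M_norm p q t r f) \<Longrightarrow> 0 < l \<Longrightarrow>
    (LINT x:cube c l|lebesgue. cmod (b x - mean b (cube c l))) \<le> k * C * l ^ CARD('n)"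
    using mean_oscillation_le[OF assms] by blast
  show ?thesis
  proof (intro exI[of _ k] conjI k(1) allI impI)
    fix K :: "real ^ 'n \<Rightarrow> real ^ 'n \<Rightarrow> complex" and T b
    assume a: "K \<in> SK \<delta> A \<and> cz_operator K T \<and> homogeneous T \<and> b \<in> L1_loc \<and> comm_op_norm p q t r b T < \<infinity>"
    have le: "BMO_norm b \<le> ennreal k * comm_op_norm p q t r b T"
      unfolding comm_op_norm_def
    proof (rule ennreal_le_mult_Inf[OF k(1)])
      fix C :: real assume C: "0 \<le> C"
        "ennreal C \<in> {C. \<forall>f\<in>M_space p q t r. \<exists>h. comm_M p q t r b T f h \<and> M_norm p q t r h \<le> C * M_norm p q t r f}"
      show "BMO_norm b \<le> ennreal (k * C)"
        unfolding BMO_norm_def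
      proof (rule SUP_least, clarify)
        fix c :: "real ^ 'n" and l :: real assume l: "0 < l"
        let ?Q = "cube c l"
        have bi: "set_integrable lebesgue ?Q b" using a cube_compact by (auto simp: L1_loc_def)
        have "set_integrable lebesgue ?Q (\<lambda>x. cmod (b x - mean b ?Q))"
          by (intro set_integrable_norm set_integral_diff(1)[OF bi] set_integrable_const_lmeasurable cube_lmeasurable)
        then have i: "integrable lebesgue (\<lambda>x. indicator ?Q x *\<^sub>R cmod (b x - mean b ?Q))" by (simp add: set_integrable_def)
        have "(\<integral>\<^sup>+x\<in>?Q. ennreal (cmod (b x - mean b ?Q)) \<partial>lebesgue) = (\<integral>\<^sup>+x. ennreal (indicator ?Q x *\<^sub>R cmod (b x - mean b ?Q)) \<partial>lebesgue)"
          by (intro nn_integral_cong) (simp add: indicator_def)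
        also have "\<dots> = ennreal (LINT x:?Q|lebesgue. cmod (b x - mean b ?Q))"
          unfolding set_lebesgue_integral_def by (intro nn_integral_eq_integral i) simp
        also have "\<dots> \<le> ennreal (k * C * l ^ CARD('n))"
          using a C l by (intro ennreal_leI k(2)) auto
        finally have "(\<integral>\<^sup>+x\<in>?Q. ennreal (cmod (b x - mean b ?Q)) \<partial>lebesgue) / emeasure lebesgue ?Q
            \<le> ennreal (k * C * l ^ CARD('n)) / emeasure lebesgue ?Q"
          by (rule divide_right_mono_ennreal)
        also have "\<dots> = ennreal (k * C)"
          unfolding emeasure_lmeasurable[OF cube_lmeasurable] using l C k(1)
          by (simp add: measure_cube divide_ennreal)
        finally show "(\<integral>\<^sup>+x\<in>?Q. ennreal (cmod (b x - mean b ?Q)) \<partial>lebesgue) / emeasure lebesgue ?Q \<le> ennreal (k * C)" .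
      qed
    qed
    moreover have "ennreal k * comm_op_norm p q t r b T < \<infinity>"
      using a by (simp add: ennreal_mult_less_top)
    ultimately show "b \<in> BMO" using a by (auto simp: BMO_def intro: le_less_trans)
    show "BMO_norm b \<le> ennreal k * comm_op_norm p q t r b T" by (rule le)
  qed
qed

end
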